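(* Let $(X^\delta,Y^\delta)_{\delta\in\Delta}$ be a family of pairs of finite dimensional subspaces of $X$ and $Y$ such that $$\inf_{\delta\in\Delta}\ \inf_{\{w\in X^\delta\colon Bw\neq0\}}\ \sup_{0\neq\mu\in Y^\delta}\frac{(Bw)(\mu)}{\|Bw\|_{Y'}\|\mu\|_Y}>0,$$ and let $(Q^\delta)_{\delta\in\Delta}$ be a corresponding family of uniformly bounded Fortin interpolators, i.e., $Q^\delta\in\mathcal L(Y,Y)$, $\operatorname{ran}Q^\delta\subset Y^\delta$, $(Bw)(v-Q^\delta v)=0$ for all $w\in X^\delta$, $v\in Y$, and $\sup_{\delta}\|Q^\delta\|_{\mathcal L(Y,Y)}<\infty$. Put $e^\delta_{\rm osc}(g):=\|(\mathrm{Id}-(Q^\delta)')g\|_{Y'}$. Let $\eta\in(0,T)$. Then there is a constant $C>0$, independent of $\varepsilon$, $\delta$, $w$, $g$, $f$, such that for all $\varepsilon\ge0$, $g\in Y'$, $f\in L_2(I\times\omega)$, $\delta\in\Delta$ and $w\in X^\delta$, with $u_\varepsilon\in X$ denoting the minimizer over $X$ of $$G_\varepsilon(v):=\|Bv-g\|_{Y'}^2+\|\Gamma_\omega v-f\|_{L_2(I\times\omega)}^2+\varepsilon^2\|\gamma_0v\|_{L_2(\Omega)}^2,$$ one has $$\|u_\varepsilon-w\|_{X_\eta}\le C\Big(\sqrt{G_\varepsilon^\delta(w)}+e^\delta_{\rm osc}(g)\Big),$$ where $G_\varepsilon^\delta(w):=\|Bw-g\|_{(Y^\delta)'}^2+\|\Gamma_\omega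 w-f\|_{L_2(I\times\omega)}^2+\varepsilon^2\|\gamma_0w\|_{L_2(\Omega)}^2$.
   Context: Setting. $\Omega\subset\mathbb R^d$ is a bounded domain, $T>0$, $I=[0,T]$, and $\omega\subset\Omega$ is a fixed non-empty subdomain. For a.e. $t\in I$, $a(t;\cdot,\cdot)$ is a bilinear form on $H^1_0(\Omega)\times H^1_0(\Omega)$ such that $t\mapsto a(t;\theta,\zeta)$ is measurable for all $\theta,\zeta\in H_0^1(\Omega)$, and, with constants independent of $t$, $|a(t;\theta,\zeta)|\lesssim\|\theta\|_{H^1(\Omega)}\|\zeta\|_{H^1(\Omega)}$ and $a(t;\theta,\theta)\gtrsim\|\theta\|_{H^1(\Omega)}^2$. Spaces: $X:=L_2(I;H_0^1(\Omega))\cap H^1(I;H^{-1}(\Omega))$ with its usual norm, $Y:=L_2(I;H_0^1(\Omega))$ with inner product $\langle v,w\rangle_Y=\int_I\int_\Omega\nabla_{\bf x}v\cdot\nabla_{\bf x}w\,d{\bf x}\,dt$, $Y'$ its dual, and for $\eta\in(0,T)$, $X_\eta:=L_2([\eta,T];H_0^1(\Omega))\cap H^1([\eta,T];H^{-1}(\Omega))$ with its usual norm. Operators: $B\in\mathcal L(X,Y')$ is $(Bw)(v):=\int_I\frac{dw}{dt}(t)(v(t))+a(t;w(t),v(t))\,dt$; $\gamma_0\colon X\to L_2(\Omega)$, $\gamma_0w=w(0)$ (bounded); $\Gamma_\omega\colon X\to L_2(I\times\omega)$ is restriction to $I\times\omega$. Standing assumption (Carleman estimate): for every $\eta\in(0,T)$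 there is a constant $C_\eta$ with $\|w\|_{X_\eta}\le C_\eta\big(\|\Gamma_\omega w\|_{L_2(I\times\omega)}+\|Bw\|_{Y'}\big)$ for all $w\in X$. Notation: $\|\ell\|_{(Y^\delta)'}:=\sup_{0\ne\mu\in Y^\delta}|\ell(\mu)|/\|\mu\|_Y$; $(Q^\delta)'\colon Y'\to Y'$ is the dual operator of $Q^\delta$. The statement presupposes the minimizer $u_\varepsilon$ of $G_\varepsilon$ over $X$ (i.e. it is a statement about any minimizer). *)

theory Defs
  imports "HOL-Analysis.Analysis"
begin

section \<open>The Hilbert space of square-integrable functions modulo null sets\<close>

text \<open>
  Every Lebesgue-measurable function agrees a.e. with a Borel function, so using Borel
  representatives loses nothing.  They are convenient because all slices of a Borel function
  of several variables are again Borel.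
\<close>

definition sq_int :: "('a::euclidean_space \<Rightarrow> real) \<Rightarrow> bool" where
  "sq_int f \<longleftrightarrow> f \<in> borel_measurable lborel \<and> integrable lborel (\<lambda>x. (f x)\<^sup>2)"

lemma sq_int_mult:
  assumes "sq_int f" "sq_int g"
  shows "integrable lborel (\<lambda>x. f x * g x)"
proof (rule Bochner_Integration.integrable_bound)
  show "integrable lborel (\<lambda>x. (f x)\<^sup>2 + (g x)\<^sup>2)"
    using assms unfolding sq_int_def by auto
  show "(\<lambda>x. f x * g x) \<in> borel_measurable lborel"
    using assms unfolding sq_int_def by auto
  have "\<bar>f x * g x\<bar> \<le> (f x)\<^sup>2 + (g x)\<^sup>2" for x
  proof -
    have "2 * (\<bar>f x\<bar> * \<bar>g x\<bar>) \<le> \<bar>f x\<bar>\<^sup>2 + \<bar>g x\<bar>\<^sup>2"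
      using sum_squares_bound[of "\<bar>f x\<bar>" "\<bar>g x\<bar>"] by simp
    moreover have "0 \<le> \<bar>f x\<bar> * \<bar>g x\<bar>" by simp
    ultimately show ?thesis unfolding abs_mult power2_abs by linarith
  qed
  then show "AE x in lborel. norm (f x * g x) \<le> norm ((f x)\<^sup>2 + (g x)\<^sup>2)"
    by simp
qed

lemma sq_int_add: "sq_int f \<Longrightarrow> sq_int g \<Longrightarrow> sq_int (\<lambda>x. f x + g x)"
  using sq_int_mult[of f g]
  by (auto simp: sq_int_def power2_sum mult.assoc)

lemma sq_int_scale: "sq_int f \<Longrightarrow> sq_int (\<lambda>x. c * f x)"
  by (auto simp: sq_int_def power_mult_distrib)

lemma sq_int_zero: "sq_int (\<lambda>x. 0)"
  by (simp add: sq_int_def)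

lemma sq_int_uminus: "sq_int f \<Longrightarrow> sq_int (\<lambda>x. - f x)"
  by (auto simp: sq_int_def)

lemma sq_int_diff: "sq_int f \<Longrightarrow> sq_int g \<Longrightarrow> sq_int (\<lambda>x. f x - g x)"
  using sq_int_add[OF _ sq_int_uminus, of f g] by simp

lemma sq_int_indicator:
  assumes "sq_int f" "S \<in> sets borel"
  shows "sq_int (\<lambda>x. indicat_real S x * f x)"
proof -
  have "integrable lborel (\<lambda>x. indicat_real S x *\<^sub>R (f x)\<^sup>2)"
    using assms by (intro integrable_mult_indicator) (auto simp: sq_int_def)
  moreover have "(\<lambda>x. (indicat_real S x * f x)\<^sup>2) = (\<lambda>x. indicat_real S x *\<^sub>R (f x)\<^sup>2)"
    by (auto simp: fun_eq_iff indicator_def)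
  ultimately show ?thesis using assms by (auto simp: sq_int_def)
qed

quotient_type (overloaded) 'a lsq = "'a::euclidean_space \<Rightarrow> real" /
  partial: "\<lambda>f g. sq_int f \<and> sq_int g \<and> (AE x in lborel. f x = g x)"
proof (rule part_equivpI)
  show "\<exists>f::'a \<Rightarrow> real. sq_int f \<and> sq_int f \<and> (AE x in lborel. f x = f x)"
    using sq_int_zero by auto
  show "symp (\<lambda>f g::'a \<Rightarrow> real. sq_int f \<and> sq_int g \<and> (AE x in lborel. f x = g x))"
    by (auto simp: symp_def elim: AE_mp)
  show "transp (\<lambda>f g::'a \<Rightarrow> real. sq_int f \<and> sq_int g \<and> (AE x in lborel. f x = g x))"
  proof (rule transpI, elim conjE, intro conjI)
    fix f g h :: "'a \<Rightarrow> real"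
    assume "AE x in lborel. f x = g x" "AE x in lborel. g x = h x"
    then show "AE x in lborel. f x = h x" by eventually_elim simp
  qed
qed

instantiation lsq :: (euclidean_space) real_vector
begin

lift_definition zero_lsq :: "'a lsq" is "\<lambda>x. 0"
  by (simp add: sq_int_zero)

lift_definition plus_lsq :: "'a lsq \<Rightarrow> 'a lsq \<Rightarrow> 'a lsq" is "\<lambda>f g x. f x + g x"
  by (auto intro: sq_int_add)

lift_definition minus_lsq :: "'a lsq \<Rightarrow> 'a lsq \<Rightarrow> 'a lsq" is "\<lambda>f g x. f x - g x"
  by (auto intro: sq_int_diff)

lift_definition uminus_lsq :: "'a lsq \<Rightarrow> 'a lsq" is "\<lambda>f x. - f x"
  by (auto intro: sq_int_uminus)

lift_definition scaleR_lsq :: "real \<Rightarrow> 'a lsq \<Rightarrow> 'a lsq" is "\<lambda>c f x. c * f x"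
  by (auto intro: sq_int_scale)

instance
  by standard
    (transfer; auto simp: algebra_simps intro: sq_int_add sq_int_diff sq_int_uminus sq_int_scale
      sq_int_zero)+

end

instantiation lsq :: (euclidean_space) real_inner
begin

lift_definition inner_lsq :: "'a lsq \<Rightarrow> 'a lsq \<Rightarrow> real"
  is "\<lambda>f g. integral\<^sup>L lborel (\<lambda>x. f x * g x)"
proof (elim conjE)
  fix f f' g g' :: "'a \<Rightarrow> real"
  assume "AE x in lborel. f x = f' x" "AE x in lborel. g x = g' x"
    and "sq_int f" "sq_int f'" "sq_int g" "sq_int g'"
  then show "(\<integral>x. f x * g x \<partial>lborel) = (\<integral>x. f' x * g' x \<partial>lborel)"
    by (intro integral_cong_AE) (auto simp: sq_int_def)
qed

definition norm_lsq :: "'a lsq \<Rightarrow> real" where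
  "norm_lsq u = sqrt (inner u u)"

definition dist_lsq :: "'a lsq \<Rightarrow> 'a lsq \<Rightarrow> real" where
  "dist_lsq u v = norm (u - v)"

definition sgn_lsq :: "'a lsq \<Rightarrow> 'a lsq" where
  "sgn_lsq u = inverse (norm u) *\<^sub>R u"

definition uniformity_lsq :: "('a lsq \<times> 'a lsq) filter" where
  "uniformity_lsq = (INF e\<in>{0<..}. principal {(u, v). dist u v < e})"

definition open_lsq :: "'a lsq set \<Rightarrow> bool" where
  "open_lsq U \<longleftrightarrow> (\<forall>u\<in>U. eventually (\<lambda>(u', v). u' = u \<longrightarrow> v \<in> U) uniformity)"

instance
proof
  fix u v w :: "'a lsq" and c :: real and U :: "'a lsq set"
  show "dist u v = norm (u - v)" by (rule dist_lsq_def)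
  show "sgn u = inverse (norm u) *\<^sub>R u" by (rule sgn_lsq_def)
  show "uniformity = (INF e\<in>{0<..}. principal {(u, v :: 'a lsq). dist u v < e})"
    by (rule uniformity_lsq_def)
  show "open U \<longleftrightarrow> (\<forall>u\<in>U. eventually (\<lambda>(u', v). u' = u \<longrightarrow> v \<in> U) uniformity)"
    by (rule open_lsq_def)
  show "inner u v = inner v u" by transfer (simp add: mult.commute)
  show "inner (u + v) w = inner u w + inner v w"
    by transfer (auto simp: distrib_right intro!: Bochner_Integration.integral_add sq_int_mult)
  show "inner (c *\<^sub>R u) v = c * inner u v"
    by transfer (simp add: mult.assoc)
  show "0 \<le> inner u u" by transfer simp
  show "inner u u = 0 \<longleftrightarrow> u = 0"
  proof transfer
    fix f :: "'a \<Rightarrow> real"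
    assume f: "sq_int f \<and> sq_int f \<and> (AE x in lborel. f x = f x)"
    then have "integrable lborel (\<lambda>x. f x * f x)" by (intro sq_int_mult) auto
    then have "(\<integral>x. f x * f x \<partial>lborel) = 0 \<longleftrightarrow> (AE x in lborel. f x * f x = 0)"
      by (intro integral_nonneg_eq_0_iff_AE) auto
    then show "((\<integral>x. f x * f x \<partial>lborel) = 0) =
      (sq_int f \<and> sq_int (\<lambda>x::'a. 0) \<and> (AE x in lborel. f x = 0))"
      using f by (simp add: sq_int_zero)
  qed
  show "norm u = sqrt (inner u u)" by (rule norm_lsq_def)
qed

end

lift_definition restr :: "'a::euclidean_space set \<Rightarrow> 'a lsq \<Rightarrow> 'a lsq"
  is "\<lambda>S f. if S \<in> sets borel then (\<lambda>x. indicat_real S x * f x) else (\<lambda>x. 0)"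
  by (auto intro: sq_int_indicator sq_int_zero)

text \<open>
  Elements of \<open>L\<^sub>2(S)\<close> are identified with their extension by zero, so restriction to \<open>S\<close> is
  multiplication with the indicator function, and the norm of \<open>L\<^sub>2(S)\<close> is the norm of the type.
\<close>

definition L2 :: "'a::euclidean_space set \<Rightarrow> 'a lsq set" where
  "L2 S = {u. restr S u = u}"


section \<open>Dual spaces and operator norms\<close>

text \<open>
  Functionals and operators on a subspace \<open>V\<close> with norm \<open>N\<close> are total functions of which only the
  values on \<open>V\<close> matter.  As for \<^const>\<open>onorm\<close>, the term \<open>v = 0\<close> contributes \<open>0 / 0 = 0\<close> to the
  suprema, which are therefore those over \<open>0 \<noteq> v \<in> V\<close>, and \<open>0\<close> if \<open>V = {0}\<close>.
\<close>

definition bounded_linear_on ::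
  "'v::real_vector set \<Rightarrow> ('v \<Rightarrow> real) \<Rightarrow> ('w::real_vector \<Rightarrow> real) \<Rightarrow> ('v \<Rightarrow> 'w) \<Rightarrow> bool" where
  "bounded_linear_on V N N' l \<longleftrightarrow>
     (\<forall>u\<in>V. \<forall>v\<in>V. l (u + v) = l u + l v) \<and>
     (\<forall>c. \<forall>v\<in>V. l (c *\<^sub>R v) = c *\<^sub>R l v) \<and>
     (\<exists>K. \<forall>v\<in>V. N' (l v) \<le> K * N v)"

definition op_norm ::
  "'v set \<Rightarrow> ('v \<Rightarrow> real) \<Rightarrow> ('w \<Rightarrow> real) \<Rightarrow> ('v \<Rightarrow> 'w) \<Rightarrow> real" where
  "op_norm V N N' l = (SUP v\<in>V. N' (l v) / N v)"

definition dual :: "'v::real_vector set \<Rightarrow> ('v \<Rightarrow> real) \<Rightarrow> ('v \<Rightarrow> real) set" where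
  "dual V N = {l. bounded_linear_on V N abs l}"

definition dual_norm :: "'v set \<Rightarrow> ('v \<Rightarrow> real) \<Rightarrow> ('v \<Rightarrow> real) \<Rightarrow> real" where
  "dual_norm V N l = op_norm V N abs l"


section \<open>Sobolev spaces on a domain\<close>

definition partial_deriv :: "'a::euclidean_space \<Rightarrow> ('a \<Rightarrow> real) \<Rightarrow> 'a \<Rightarrow> real" where
  "partial_deriv b f x = frechet_derivative f (at x) b"

primrec Ck :: "nat \<Rightarrow> ('a::euclidean_space \<Rightarrow> real) \<Rightarrow> bool" where
  "Ck 0 f \<longleftrightarrow> continuous_on UNIV f"
| "Ck (Suc k) f \<longleftrightarrow> f differentiable_on UNIV \<and> (\<forall>b\<in>Basis. Ck k (partial_deriv b f))"

definition test_fun :: "'a::euclidean_space set \<Rightarrow> ('a \<Rightarrow> real) set" where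
  "test_fun S = {\<phi>. (\<forall>k. Ck k \<phi>) \<and> compact (closure {x. \<phi> x \<noteq> 0}) \<and> closure {x. \<phi> x \<noteq> 0} \<subseteq> S}"

definition weak_deriv :: "'a::euclidean_space set \<Rightarrow> 'a \<Rightarrow> 'a lsq \<Rightarrow> 'a lsq \<Rightarrow> bool" where
  "weak_deriv \<Omega> b u u' \<longleftrightarrow> u' \<in> L2 \<Omega> \<and>
     (\<forall>\<phi>\<in>test_fun \<Omega>. inner u (abs_lsq (partial_deriv b \<phi>)) = - inner u' (abs_lsq \<phi>))"

definition D :: "'a::euclidean_space set \<Rightarrow> 'a \<Rightarrow> 'a lsq \<Rightarrow> 'a lsq" where
  "D \<Omega> b u = (THE u'. weak_deriv \<Omega> b u u')"

definition H1 :: "'a::euclidean_space set \<Rightarrow> 'a lsq set" where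
  "H1 \<Omega> = {u\<in>L2 \<Omega>. \<forall>b\<in>Basis. \<exists>u'. weak_deriv \<Omega> b u u'}"

definition grad_inner :: "'a::euclidean_space set \<Rightarrow> 'a lsq \<Rightarrow> 'a lsq \<Rightarrow> real" where
  "grad_inner \<Omega> u v = (\<Sum>b\<in>Basis. inner (D \<Omega> b u) (D \<Omega> b v))"

definition H1_norm :: "'a::euclidean_space set \<Rightarrow> 'a lsq \<Rightarrow> real" where
  "H1_norm \<Omega> u = sqrt ((norm u)\<^sup>2 + grad_inner \<Omega> u u)"

definition H10 :: "'a::euclidean_space set \<Rightarrow> 'a lsq set" where
  "H10 \<Omega> = {u\<in>H1 \<Omega>. \<forall>e>0. \<exists>\<phi>\<in>test_fun \<Omega>. H1_norm \<Omega> (u - abs_lsq \<phi>) < e}"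

definition Hm1 :: "'a::euclidean_space set \<Rightarrow> ('a lsq \<Rightarrow> real) set" where
  "Hm1 \<Omega> = dual (H10 \<Omega>) (H1_norm \<Omega>)"

definition Hm1_norm :: "'a::euclidean_space set \<Rightarrow> ('a lsq \<Rightarrow> real) \<Rightarrow> real" where
  "Hm1_norm \<Omega> = dual_norm (H10 \<Omega>) (H1_norm \<Omega>)"


section \<open>Bochner spaces\<close>

definition bochner_sq_int ::
  "real set \<Rightarrow> 'v set \<Rightarrow> ('v \<Rightarrow> 'v \<Rightarrow> 'v) \<Rightarrow> ('v \<Rightarrow> real) \<Rightarrow> (real \<Rightarrow> 'v) \<Rightarrow> bool" where
  \<comment> \<open>\<open>f\<close> is strongly measurable into the space \<open>V\<close> with subtraction \<open>sub\<close> and norm \<open>N\<close>,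
      and \<open>N \<circ> f\<close> is square-integrable\<close>
  "bochner_sq_int I V sub N f \<longleftrightarrow>
     (AE t in lebesgue_on I. f t \<in> V) \<and>
     (\<exists>s :: nat \<Rightarrow> real \<Rightarrow> 'v.
        (\<forall>n. simple_function (lebesgue_on I) (s n) \<and> s n ` I \<subseteq> V) \<and>
        (AE t in lebesgue_on I. (\<lambda>n. N (sub (s n t) (f t))) \<longlonglongrightarrow> 0)) \<and>
     integrable (lebesgue_on I) (\<lambda>t. (N (f t))\<^sup>2)"

text \<open>
  Functions of time and space are classes on \<open>I \<times> \<Omega>\<close>.  The value at time \<open>t\<close>
  depends on the chosen representative, but only for \<open>t\<close> in a null set; all definitions below
  are insensitive to this.
\<close>

definition slice :: "(real \<times> 'a::euclidean_space) lsq \<Rightarrow> real \<Rightarrow> 'a lsq" where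
  "slice w t = (if sq_int (\<lambda>x. rep_lsq w (t, x)) then abs_lsq (\<lambda>x. rep_lsq w (t, x)) else 0)"

text \<open>
  \<open>L\<^sub>2(I; H\<^sub>0\<^sup>1(\<Omega>))\<close>, as a subspace of \<open>L\<^sub>2(I; L\<^sub>2(\<Omega>)) = L\<^sub>2(I \<times> \<Omega>)\<close>.
\<close>

definition Y_space :: "real set \<Rightarrow> 'a::euclidean_space set \<Rightarrow> (real \<times> 'a) lsq set" where
  "Y_space I \<Omega> = {v\<in>L2 (I \<times> \<Omega>). bochner_sq_int I (H10 \<Omega>) (-) (H1_norm \<Omega>) (slice v)}"

definition Y_inner ::
  "real set \<Rightarrow> 'a::euclidean_space set \<Rightarrow> (real \<times> 'a) lsq \<Rightarrow> (real \<times> 'a) lsq \<Rightarrow> real" where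
  "Y_inner I \<Omega> v w = (\<integral>t. grad_inner \<Omega> (slice v t) (slice w t) \<partial>lebesgue_on I)"

definition Y_norm :: "real set \<Rightarrow> 'a::euclidean_space set \<Rightarrow> (real \<times> 'a) lsq \<Rightarrow> real" where
  "Y_norm I \<Omega> v = sqrt (Y_inner I \<Omega> v v)"

text \<open>
  The weak derivative \<open>\<psi> \<in> L\<^sub>2(I; H\<^sup>-\<^sup>1(\<Omega>))\<close> in time: \<open>\<integral> w \<phi>' dt = - \<integral> \<psi> \<phi> dt\<close> in \<open>H\<^sup>-\<^sup>1(\<Omega>)\<close>,
  where \<open>H\<^sub>0\<^sup>1(\<Omega>)\<close> is embedded into \<open>H\<^sup>-\<^sup>1(\<Omega>)\<close> via the inner product of \<open>L\<^sub>2(\<Omega>)\<close>.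
\<close>

definition weak_time_deriv ::
  "real set \<Rightarrow> 'a::euclidean_space set \<Rightarrow> (real \<times> 'a) lsq \<Rightarrow> (real \<Rightarrow> 'a lsq \<Rightarrow> real) \<Rightarrow> bool" where
  "weak_time_deriv I \<Omega> w \<psi> \<longleftrightarrow>
     bochner_sq_int I (Hm1 \<Omega>) (\<lambda>l m u. l u - m u) (Hm1_norm \<Omega>) \<psi> \<and>
     (\<forall>\<phi>\<in>test_fun (interior I). \<forall>\<zeta>\<in>H10 \<Omega>.
        (\<integral>t. deriv \<phi> t * inner (slice w t) \<zeta> \<partial>lebesgue_on I) =
        - (\<integral>t. \<phi> t * \<psi> t \<zeta> \<partial>lebesgue_on I))"

definition X_space :: "real set \<Rightarrow> 'a::euclidean_space set \<Rightarrow> (real \<times> 'a) lsq set" where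
  "X_space I \<Omega> = {w\<in>Y_space I \<Omega>. \<exists>\<psi>. weak_time_deriv I \<Omega> w \<psi>}"

definition ddt ::
  "real set \<Rightarrow> 'a::euclidean_space set \<Rightarrow> (real \<times> 'a) lsq \<Rightarrow> real \<Rightarrow> 'a lsq \<Rightarrow> real" where
  \<comment> \<open>determined on \<open>H10 \<Omega>\<close> for a.e. \<open>t\<close>\<close>
  "ddt I \<Omega> w = (SOME \<psi>. weak_time_deriv I \<Omega> w \<psi>)"

definition X_norm :: "real set \<Rightarrow> 'a::euclidean_space set \<Rightarrow> (real \<times> 'a) lsq \<Rightarrow> real" where
  "X_norm I \<Omega> w = sqrt ((\<integral>t. (H1_norm \<Omega> (slice w t))\<^sup>2 \<partial>lebesgue_on I) +
                        (\<integral>t. (Hm1_norm \<Omega> (ddt I \<Omega> w t))\<^sup>2 \<partial>lebesgue_on I))"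

definition X_eta_norm ::
  "real \<Rightarrow> real \<Rightarrow> 'a::euclidean_space set \<Rightarrow> (real \<times> 'a) lsq \<Rightarrow> real" where
  "X_eta_norm \<eta> T \<Omega> w = X_norm {\<eta>..T} \<Omega> (restr ({\<eta>..T} \<times> \<Omega>) w)"


section \<open>The parabolic operator and the observation and trace operators\<close>

definition bilinear_on ::
  "'v::real_vector set \<Rightarrow> ('v \<Rightarrow> 'v \<Rightarrow> real) \<Rightarrow> bool" where
  "bilinear_on V b \<longleftrightarrow>
     (\<forall>u\<in>V. \<forall>v\<in>V. \<forall>w\<in>V. b (u + v) w = b u w + b v w \<and> b w (u + v) = b w u + b w v) \<and>
     (\<forall>c. \<forall>u\<in>V. \<forall>v\<in>V. b (c *\<^sub>R u) v = c * b u v \<and> b u (c *\<^sub>R v) = c * b u v)"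

definition parabolic_form ::
  "real \<Rightarrow> 'a::euclidean_space set \<Rightarrow> (real \<Rightarrow> 'a lsq \<Rightarrow> 'a lsq \<Rightarrow> real) \<Rightarrow> bool" where
  "parabolic_form T \<Omega> a \<longleftrightarrow>
     (AE t in lebesgue_on {0..T}. bilinear_on (H10 \<Omega>) (a t)) \<and>
     (\<forall>\<theta>\<in>H10 \<Omega>. \<forall>\<zeta>\<in>H10 \<Omega>. (\<lambda>t. a t \<theta> \<zeta>) \<in> borel_measurable (lebesgue_on {0..T})) \<and>
     (\<exists>M. AE t in lebesgue_on {0..T}. \<forall>\<theta>\<in>H10 \<Omega>. \<forall>\<zeta>\<in>H10 \<Omega>.
        \<bar>a t \<theta> \<zeta>\<bar> \<le> M * H1_norm \<Omega> \<theta> * H1_norm \<Omega> \<zeta>) \<and>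
     (\<exists>\<alpha>>0. AE t in lebesgue_on {0..T}. \<forall>\<theta>\<in>H10 \<Omega>. a t \<theta> \<theta> \<ge> \<alpha> * (H1_norm \<Omega> \<theta>)\<^sup>2)"

definition B ::
  "real \<Rightarrow> 'a::euclidean_space set \<Rightarrow> (real \<Rightarrow> 'a lsq \<Rightarrow> 'a lsq \<Rightarrow> real) \<Rightarrow>
   (real \<times> 'a) lsq \<Rightarrow> (real \<times> 'a) lsq \<Rightarrow> real" where
  "B T \<Omega> a w v =
     (\<integral>t. ddt {0..T} \<Omega> w t (slice v t) + a t (slice w t) (slice v t) \<partial>lebesgue_on {0..T})"

definition \<gamma>\<^sub>0 :: "real \<Rightarrow> (real \<times> 'a::euclidean_space) lsq \<Rightarrow> 'a lsq" where
  \<comment> \<open>the value at \<open>0\<close> of the representative in \<open>C([0,T]; L\<^sub>2(\<Omega>))\<close>\<close>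
  "\<gamma>\<^sub>0 T w = (THE z. \<exists>c. continuous_on {0..T} c \<and>
                     (AE t in lebesgue_on {0..T}. slice w t = c t) \<and> c 0 = z)"

definition \<Gamma> ::
  "real \<Rightarrow> 'a::euclidean_space set \<Rightarrow> (real \<times> 'a) lsq \<Rightarrow> (real \<times> 'a) lsq" where
  "\<Gamma> T \<omega> w = restr ({0..T} \<times> \<omega>) w"

abbreviation "Y T \<Omega> \<equiv> Y_space {0..T} \<Omega>"
abbreviation "X T \<Omega> \<equiv> X_space {0..T} \<Omega>"
abbreviation "normY T \<Omega> \<equiv> Y_norm {0..T} \<Omega>"
abbreviation "Y' T \<Omega> \<equiv> dual (Y T \<Omega>) (normY T \<Omega>)"
abbreviation "normY' T \<Omega> \<equiv> dual_norm (Y T \<Omega>) (normY T \<Omega>)"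

definition carleman ::
  "real \<Rightarrow> 'a::euclidean_space set \<Rightarrow> 'a set \<Rightarrow> (real \<Rightarrow> 'a lsq \<Rightarrow> 'a lsq \<Rightarrow> real) \<Rightarrow> bool" where
  "carleman T \<Omega> \<omega> a \<longleftrightarrow>
     (\<forall>\<eta>\<in>{0<..<T}. \<exists>C. \<forall>w\<in>X T \<Omega>.
        X_eta_norm \<eta> T \<Omega> w \<le> C * (norm (\<Gamma> T \<omega> w) + normY' T \<Omega> (B T \<Omega> a w)))"


section \<open>Discretization\<close>

definition fin_dim_subspace :: "'v::real_vector set \<Rightarrow> 'v set \<Rightarrow> bool" where
  "fin_dim_subspace S V \<longleftrightarrow> S \<subseteq> V \<and> (\<exists>E. finite E \<and> S = span E)"

definition infsup ::
  "real \<Rightarrow> 'a::euclidean_space set \<Rightarrow> (real \<Rightarrow> 'a lsq \<Rightarrow> 'a lsq \<Rightarrow> real) \<Rightarrow> 'i set \<Rightarrow>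
   ('i \<Rightarrow> (real \<times> 'a) lsq set) \<Rightarrow> ('i \<Rightarrow> (real \<times> 'a) lsq set) \<Rightarrow> ereal" where
  "infsup T \<Omega> a \<Delta> X\<delta> Y\<delta> =
     (INF \<delta>\<in>\<Delta>. INF w\<in>{w\<in>X\<delta> \<delta>. \<exists>v\<in>Y T \<Omega>. B T \<Omega> a w v \<noteq> 0}. SUP \<mu>\<in>Y\<delta> \<delta> - {0}.
        ereal (B T \<Omega> a w \<mu> / (normY' T \<Omega> (B T \<Omega> a w) * normY T \<Omega> \<mu>)))"

definition fortin_family ::
  "real \<Rightarrow> 'a::euclidean_space set \<Rightarrow> (real \<Rightarrow> 'a lsq \<Rightarrow> 'a lsq \<Rightarrow> real) \<Rightarrow> 'i set \<Rightarrow>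
   ('i \<Rightarrow> (real \<times> 'a) lsq set) \<Rightarrow> ('i \<Rightarrow> (real \<times> 'a) lsq set) \<Rightarrow>
   ('i \<Rightarrow> (real \<times> 'a) lsq \<Rightarrow> (real \<times> 'a) lsq) \<Rightarrow> bool" where
  "fortin_family T \<Omega> a \<Delta> X\<delta> Y\<delta> Q \<longleftrightarrow>
     (\<forall>\<delta>\<in>\<Delta>. bounded_linear_on (Y T \<Omega>) (normY T \<Omega>) (normY T \<Omega>) (Q \<delta>) \<and>
        Q \<delta> ` Y T \<Omega> \<subseteq> Y\<delta> \<delta> \<and>
        (\<forall>w\<in>X\<delta> \<delta>. \<forall>v\<in>Y T \<Omega>. B T \<Omega> a w (v - Q \<delta> v) = 0)) \<and>
     bdd_above ((\<lambda>\<delta>. op_norm (Y T \<Omega>) (normY T \<Omega>) (normY T \<Omega>) (Q \<delta>)) ` \<Delta>)"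

definition e_osc ::
  "real \<Rightarrow> 'a::euclidean_space set \<Rightarrow> ((real \<times> 'a) lsq \<Rightarrow> (real \<times> 'a) lsq) \<Rightarrow>
   ((real \<times> 'a) lsq \<Rightarrow> real) \<Rightarrow> real" where
  "e_osc T \<Omega> Q g = normY' T \<Omega> (\<lambda>v. g v - (g \<circ> Q) v)"

text \<open>
  The least-squares functional in which the equation is measured in the dual norm of \<open>V\<close>: \<open>V = Y\<close>
  gives the continuous functional, \<open>V = Y\<^sup>\<delta>\<close> the discrete one.
\<close>

definition G ::
  "real \<Rightarrow> 'a::euclidean_space set \<Rightarrow> 'a set \<Rightarrow> (real \<Rightarrow> 'a lsq \<Rightarrow> 'a lsq \<Rightarrow> real) \<Rightarrow>
   (real \<times> 'a) lsq set \<Rightarrow> real \<Rightarrow> ((real \<times> 'a) lsq \<Rightarrow> real) \<Rightarrow> (real \<times> 'a) lsq \<Rightarrow>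
   (real \<times> 'a) lsq \<Rightarrow> real" where
  "G T \<Omega> \<omega> a V \<epsilon> g f w =
     (dual_norm V (normY T \<Omega>) (\<lambda>v. B T \<Omega> a w v - g v))\<^sup>2
     + (norm (\<Gamma> T \<omega> w - f))\<^sup>2 + \<epsilon>\<^sup>2 * (norm (\<gamma>\<^sub>0 T w))\<^sup>2"

end

theory Submission
  imports Defs "HOL-Computational_Algebra.Polynomial"
begin

text \<open>
  The estimate is a perturbation argument.  The Carleman estimate bounds \<open>u - w\<close> on \<open>[\<eta>, T]\<close> by
  \<open>\<parallel>\<Gamma> (u - w)\<parallel> + \<parallel>B (u - w)\<parallel>\<close>, and the triangle inequality splits this into the data misfits
  \<open>\<parallel>\<Gamma> v - f\<parallel>\<close> and residuals \<open>\<parallel>B v - g\<parallel>\<close> of \<open>v = u\<close> and of \<open>v = w\<close>.  Those of \<open>u\<close> are at most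
  \<open>sqrt (G u)\<close>, and \<open>G u \<le> G w\<close> because \<open>u\<close> is a minimizer and \<open>w\<close> a competitor.  So everything
  is controlled by the continuous functional at \<open>w\<close>, which differs from the discrete one only in
  the norm of the residual.  Since \<open>B w = B w \<circ> Q\<close> by the Fortin property,
  \<open>(B w - g) v = (B w - g) (Q v) - (g - g \<circ> Q) v\<close>; here \<open>Q v\<close> lies in the discrete test space and
  has norm at most \<open>L * \<parallel>v\<parallel>\<close>, so that the continuous norm of the residual is at most \<open>L\<close> times its
  discrete norm plus the oscillation (\<open>dual_norm_le_osc\<close>).

  The norms in this argument are suprema of real numbers and say something only about bounded
  functionals, so one has to know that \<open>B w\<close> is a bounded linear functional (\<open>B_in_dual\<close>) which
  is additive in \<open>w\<close> (\<open>B_diff_left\<close>).  This is where the analysis lies: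

  \<^item> Weak derivatives are chosen by a description operator, and are linear because they are unique.
    Uniqueness is the fundamental lemma of the calculus of variations, for which enough smooth
    functions are built from \<open>exp (- 1 / s)\<close>.

  \<^item> The norm of \<open>Y\<close> sees only gradients, whereas the coefficient form and the time derivative are
    bounded in the full \<open>H1\<close> norm.  The Poincare inequality on bounded domains mediates.

  \<^item> The integrand of \<open>B w v\<close> is a pairing of two strongly measurable functions of time.  It is
    measurable as a limit of pairings of simple functions, and integrable by
    Young's inequality (\<open>bochner_pairing\<close>).

  \<^item> The time derivative of \<open>w\<close>, tested with a fixed \<open>\<zeta>\<close>, is unique outside a null set that depends
    on \<open>\<zeta>\<close>.  To insert the time-dependent argument \<open>v t\<close> one lets \<open>\<zeta>\<close> run through the countably
    many values of the simple functions that approximate \<open>v\<close> (\<open>weak_time_deriv_unique\<close>).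
\<close>

section \<open>Calculus of smooth functions\<close>

lemma Ck_imp_continuous: "Ck k f \<Longrightarrow> continuous_on UNIV f"
  by (cases k) (auto intro: differentiable_imp_continuous_on)

lemma Ck_mono: "Ck (Suc k) f \<Longrightarrow> Ck k f"
  by (induction k arbitrary: f) (auto intro: differentiable_imp_continuous_on)

lemma Ck_const: "Ck k (\<lambda>x. c)"
  by (induction k arbitrary: c)
     (auto simp: partial_deriv_def[abs_def] frechet_derivative_const differentiable_on_def)

lemma partial_deriv_unique:
  assumes "(f has_derivative f') (at x)"
  shows "partial_deriv b f x = f' b"
  using frechet_derivative_at[OF assms] by (simp add: partial_deriv_def)

lemma Ck_SucI:
  assumes "\<And>x. (f has_derivative f' x) (at x)" "\<And>b. b \<in> Basis \<Longrightarrow> Ck k (\<lambda>x. f' x b)"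
  shows "Ck (Suc k) f"
proof -
  have "partial_deriv b f = (\<lambda>x. f' x b)" for b
    using partial_deriv_unique[OF assms(1)] by auto
  then show ?thesis
    using assms by (auto simp: differentiable_on_def differentiable_def)
qed

lemma Ck_has_derivative:
  assumes "Ck (Suc k) f"
  shows "(f has_derivative (\<lambda>h. partial_deriv h f x)) (at x)"
  using assms frechet_derivative_works[of f "at x"]
  by (auto simp: differentiable_on_def partial_deriv_def[abs_def])

lemma Ck_partial: "Ck (Suc k) f \<Longrightarrow> b \<in> Basis \<Longrightarrow> Ck k (partial_deriv b f)"
  by simp

lemma Ck_add:
  assumes "Ck k f" "Ck k g"
  shows "Ck k (\<lambda>x. f x + g x)"
  using assms
proof (induction k arbitrary: f g)
  case 0
  then show ?case by (auto intro: continuous_intros)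
next
  case (Suc k)
  show ?case
    by (rule Ck_SucI[OF has_derivative_add[OF Ck_has_derivative[OF Suc.prems(1)]
            Ck_has_derivative[OF Suc.prems(2)]]])
       (intro Suc.IH Ck_partial Suc.prems)
qed

lemma Ck_mult:
  assumes "Ck k f" "Ck k g"
  shows "Ck k (\<lambda>x. f x * g x)"
  using assms
proof (induction k arbitrary: f g)
  case 0
  then show ?case by (auto intro: continuous_intros)
next
  case (Suc k)
  show ?case
    by (rule Ck_SucI[OF has_derivative_mult[OF Ck_has_derivative[OF Suc.prems(1)]
            Ck_has_derivative[OF Suc.prems(2)]]])
       (intro Suc.IH Ck_partial Suc.prems Ck_add Ck_mono)
qed

lemma Ck_linear:
  assumes "bounded_linear f"
  shows "Ck k f"
proof (cases k)
  case 0
  then show ?thesis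
    using assms by (simp add: linear_continuous_on)
next
  case (Suc l)
  show ?thesis unfolding Suc
    by (rule Ck_SucI[where f' = "\<lambda>x. f"])
       (auto intro: bounded_linear_imp_has_derivative assms Ck_const)
qed

lemma Ck_uminus: "Ck k f \<Longrightarrow> Ck k (\<lambda>x. - f x)"
  using Ck_mult[OF Ck_const[of k "-1"]] by simp

lemma Ck_diff: "Ck k f \<Longrightarrow> Ck k g \<Longrightarrow> Ck k (\<lambda>x. f x - g x)"
  using Ck_add[OF _ Ck_uminus] by simp

lemma Ck_sum: "(\<And>i. i \<in> I \<Longrightarrow> Ck k (f i)) \<Longrightarrow> Ck k (\<lambda>x. \<Sum>i\<in>I. f i x)"
  by (induction I rule: infinite_finite_induct) (auto intro: Ck_const Ck_add)

lemma Ck_prod: "(\<And>i. i \<in> I \<Longrightarrow> Ck k (f i)) \<Longrightarrow> Ck k (\<lambda>x. \<Prod>i\<in>I. f i x)"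
  by (induction I rule: infinite_finite_induct) (auto intro: Ck_const Ck_mult)

section \<open>Smooth functions with compact support\<close>

text \<open>
  For \<open>p = 1\<close> this is the classical smooth function that vanishes to infinite order at \<open>0\<close>.  The
  polynomial factor makes the family closed under differentiation.
\<close>

definition flat :: "real poly \<Rightarrow> real \<Rightarrow> real" where
  "flat p s = (if s > 0 then poly p (1 / s) * exp (- 1 / s) else 0)"

lemma flat_tendsto_0: "((\<lambda>s::real. poly p (1 / s) * exp (- 1 / s)) \<longlongrightarrow> 0) (at_right 0)"
proof -
  have "((\<lambda>t. poly p t * exp (- t)) \<longlongrightarrow> 0) at_top"
  proof -
    have "((\<lambda>t. \<Sum>i\<le>degree p. coeff p i * (t ^ i / exp t)) \<longlongrightarrow> (\<Sum>i\<le>degree p. coeff p i * 0)) at_top"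
      using tendsto_power_div_exp_0 by (intro tendsto_sum tendsto_mult tendsto_const) auto
    moreover have "poly p t * exp (- t) = (\<Sum>i\<le>degree p. coeff p i * (t ^ i / exp t))" for t
      by (simp add: poly_altdef exp_minus field_simps sum_divide_distrib)
    ultimately show ?thesis by simp
  qed
  then have "((\<lambda>s. poly p (inverse s) * exp (- inverse s)) \<longlongrightarrow> 0) (at_right 0)"
    by (rule filterlim_compose[OF _ filterlim_inverse_at_top_right])
  then show ?thesis by (simp add: inverse_eq_divide)
qed

lemma flat_has_derivative:
  "(flat p has_real_derivative flat (monom 1 2 * (p - pderiv p)) s) (at s)"
proof -
  consider "s < 0" | "s = 0" | "s > 0" by linarith
  then show ?thesis
  proof cases
    case 1
    have "((\<lambda>s. 0) has_real_derivative 0) (at s)" by simp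
    then have "(flat p has_real_derivative 0) (at s)"
      by (rule has_field_derivative_transform_within_open[where S = "{..<0}"])
         (use 1 in \<open>auto simp: flat_def\<close>)
    then show ?thesis using 1 by (simp add: flat_def)
  next
    case 2
    have "((\<lambda>h. flat p h / h) \<longlongrightarrow> 0) (at 0)"
    proof (rule filterlim_split_at)
      show "((\<lambda>h. flat p h / h) \<longlongrightarrow> 0) (at_left 0)"
        by (rule tendsto_eventually)
           (auto simp: flat_def eventually_at_left_field intro!: exI[of _ "-1"])
      have "\<forall>\<^sub>F h in at_right 0. poly (pCons 0 p) (1 / h) * exp (- 1 / h) = flat p h / h"
        by (auto simp: flat_def eventually_at_right_field intro!: exI[of _ "1"])
      from tendsto_cong[OF this] flat_tendsto_0[of "pCons 0 p"]
      show "((\<lambda>h. flat p h / h) \<longlongrightarrow> 0) (at_right 0)" by simp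
    qed
    then show ?thesis
      using 2 by (simp add: DERIV_def flat_def)
  next
    case 3
    have "((\<lambda>s. poly p (1 / s) * exp (- 1 / s)) has_real_derivative
        poly (monom 1 2 * (p - pderiv p)) (1 / s) * exp (- 1 / s)) (at s)"
      using 3 by (auto intro!: derivative_eq_intros DERIV_chain2[OF poly_DERIV]
          simp: poly_monom algebra_simps power2_eq_square)
    then have "(flat p has_real_derivative
        poly (monom 1 2 * (p - pderiv p)) (1 / s) * exp (- 1 / s)) (at s)"
      by (rule has_field_derivative_transform_within_open[where S = "{0<..}"])
         (use 3 in \<open>auto simp: flat_def\<close>)
    then show ?thesis using 3 by (simp add: flat_def)
  qed
qed

text \<open>
  The statement is for all \<open>p\<close> at once because the chain rule replaces \<open>p\<close> by another polynomial.
\<close>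

lemma Ck_flat_comp:
  assumes "\<And>k. Ck k q"
  shows "Ck k (\<lambda>x. flat p (q x))"
proof (induction k arbitrary: p)
  case 0
  have "continuous_on UNIV (flat p)"
    using DERIV_isCont[OF flat_has_derivative] by (auto simp: continuous_on_eq_continuous_at)
  then show ?case
    using Ck_imp_continuous[OF assms] continuous_on_compose2[of UNIV "flat p" UNIV q] by auto
next
  case (Suc k)
  have "((\<lambda>x. flat p (q x)) has_derivative
      (\<lambda>h. flat (monom 1 2 * (p - pderiv p)) (q x) * partial_deriv h q x)) (at x)" for x
    using has_derivative_compose[OF Ck_has_derivative[OF assms[of "Suc 0"], of x]
        has_field_derivative_imp_has_derivative[OF flat_has_derivative]] by simp
  then show ?case
    by (rule Ck_SucI) (intro Ck_mult Suc.IH Ck_partial assms)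
qed

text \<open>
  As \<open>flat 1 (n * s) = (flat 1 s) powr (1 / n)\<close> for \<open>n > 0\<close>, scaling the argument by \<open>n\<close> takes the
  \<open>n\<close>-th root of a bump function: the set where it is positive remains the ball, and the limit is
  the indicator function of this ball.
\<close>

definition bump :: "'a::euclidean_space \<Rightarrow> real \<Rightarrow> nat \<Rightarrow> 'a \<Rightarrow> real" where
  "bump c r n x = flat 1 (of_nat n * (r\<^sup>2 - (norm (x - c))\<^sup>2))"

lemma Ck_bump: "Ck k (bump c r n)"
proof -
  have "Ck k (\<lambda>x. of_nat n * (r\<^sup>2 - (\<Sum>b\<in>Basis. (x \<bullet> b - c \<bullet> b) * (x \<bullet> b - c \<bullet> b))))" for k
    by (intro Ck_mult Ck_diff Ck_const Ck_sum Ck_linear bounded_linear_inner_left)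
  moreover have "(norm (x - c))\<^sup>2 = (\<Sum>b\<in>Basis. (x \<bullet> b - c \<bullet> b) * (x \<bullet> b - c \<bullet> b))" for x
    unfolding power2_norm_eq_inner euclidean_inner[of "x - c" "x - c"] by (simp add: inner_diff_left)
  ultimately show ?thesis
    unfolding bump_def[abs_def] by (intro Ck_flat_comp) simp
qed

lemma bump_bounds: "0 \<le> bump c r n x" "bump c r n x \<le> 1"
  by (auto simp: bump_def flat_def)

lemma bump_nonzero: "r > 0 \<Longrightarrow> bump c r n x \<noteq> 0 \<Longrightarrow> x \<in> ball c r"
proof -
  assume "r > 0" "bump c r n x \<noteq> 0"
  then have "(norm (x - c))\<^sup>2 < r\<^sup>2"
    by (auto simp: bump_def flat_def zero_less_mult_iff split: if_splits)
  with \<open>r > 0\<close> show ?thesis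
    by (metis dist_norm mem_ball dist_commute power_less_imp_less_base less_imp_le)
qed

lemma bump_tendsto:
  assumes "x \<in> ball c r"
  shows "(\<lambda>n. bump c r n x) \<longlonglongrightarrow> 1"
proof -
  define s where "s = r\<^sup>2 - (norm (x - c))\<^sup>2"
  have "s > 0"
    using assms by (auto simp: s_def dist_norm norm_minus_commute intro!: power_strict_mono)
  have "(\<lambda>n. exp (- ((1 / s) * (1 / real n)))) \<longlonglongrightarrow> exp (- ((1 / s) * 0))"
    by (intro tendsto_intros lim_1_over_n)
  then have "(\<lambda>n. exp (- 1 / (real n * s))) \<longlonglongrightarrow> 1"
    by (simp add: field_simps)
  moreover have "\<forall>\<^sub>F n in sequentially. exp (- 1 / (real n * s)) = bump c r n x"
    using eventually_gt_at_top[of 0] by eventually_elim (use \<open>s > 0\<close> in \<open>auto simp: bump_def flat_def s_def\<close>)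
  ultimately show ?thesis
    using tendsto_cong by fastforce
qed

text \<open>
  Cover \<open>U\<close> by countably many balls whose closures lie in \<open>U\<close>.  For a finite union of sets the
  indicator function is \<open>1 - (\<Prod>i. 1 - indicator (A i))\<close>, which remains smooth when the indicators
  are replaced by bump functions; one further ball is included in each step.
\<close>

lemma test_fun_approx_open:
  fixes U :: "'a::euclidean_space set"
  assumes "open U"
  obtains \<phi> where "\<And>n::nat. \<phi> n \<in> test_fun U" "\<And>n x. 0 \<le> \<phi> n x \<and> \<phi> n x \<le> 1"
    "\<And>x. (\<lambda>n. \<phi> n x) \<longlonglongrightarrow> indicat_real U x"
proof (cases "U = {}")
  case True
  show ?thesis
    by (rule that[of "\<lambda>n x. 0"]) (auto simp: True test_fun_def Ck_const)
next
  case False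
  define F where "F = {ball c r | c r. 0 < r \<and> cball c r \<subseteq> U}"
  have "\<Union>F = U"
  proof
    show "U \<subseteq> \<Union>F"
    proof
      fix x assume "x \<in> U"
      then obtain e where "e > 0" "cball x e \<subseteq> U"
        using assms open_contains_cball by blast
      then show "x \<in> \<Union>F" by (auto simp: F_def intro!: exI[of _ "ball x e"])
    qed
  qed (use ball_subset_cball in \<open>fastforce simp: F_def\<close>)
  obtain F' where F': "F' \<subseteq> F" "countable F'" "\<Union>F' = U"
    using Lindelof[of F] \<open>\<Union>F = U\<close> by (auto simp: F_def)
  then have "F' \<noteq> {}" using False by auto
  define A where "A = from_nat_into F'"
  have A: "A i \<in> F" for i
    using F' from_nat_into[OF \<open>F' \<noteq> {}\<close>] by (auto simp: A_def)
  have UA: "\<Union>(range A) = U"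
    using F' \<open>F' \<noteq> {}\<close> by (simp add: A_def)
  from A have "\<forall>i. \<exists>c r. A i = ball c r \<and> 0 < r \<and> cball c r \<subseteq> U"
    by (auto simp: F_def)
  then obtain c r where cr: "\<And>i. A i = ball (c i) (r i)" "\<And>i. 0 < r i" "\<And>i. cball (c i) (r i) \<subseteq> U"
    by metis
  define \<phi> where "\<phi> n x = 1 - (\<Prod>i<n. 1 - bump (c i) (r i) n x)" for n x
  show ?thesis
  proof (rule that)
    show "\<phi> n \<in> test_fun U" for n
    proof -
      have "closure {x. \<phi> n x \<noteq> 0} \<subseteq> (\<Union>i<n. cball (c i) (r i))"
      proof (rule closure_minimal)
        show "{x. \<phi> n x \<noteq> 0} \<subseteq> (\<Union>i<n. cball (c i) (r i))"
        proof
          fix x assume "x \<in> {x. \<phi> n x \<noteq> 0}"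
          then obtain i where "i < n" "bump (c i) (r i) n x \<noteq> 0"
            by (auto simp: \<phi>_def) (metis (no_types, lifting) diff_zero lessThan_iff prod.neutral)
          then show "x \<in> (\<Union>i<n. cball (c i) (r i))"
            using bump_nonzero[OF cr(2)[of i], of "c i" n x] by (auto intro!: bexI[of _ i])
        qed
      qed auto
      moreover have "compact (\<Union>i<n. cball (c i) (r i))" by auto
      moreover have "Ck k (\<phi> n)" for k
        unfolding \<phi>_def[abs_def] by (intro Ck_diff Ck_const Ck_prod Ck_bump)
      ultimately show ?thesis
        using cr(3) compact_Int_closed[of "\<Union>i<n. cball (c i) (r i)" "closure {x. \<phi> n x \<noteq> 0}"]
        by (auto simp: test_fun_def Int_absorb1)
    qed
    show "0 \<le> \<phi> n x \<and> \<phi> n x \<le> 1" for n x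
      by (auto simp: \<phi>_def bump_bounds intro!: prod_le_1 prod_nonneg)
    show "(\<lambda>n. \<phi> n x) \<longlonglongrightarrow> indicat_real U x" for x
    proof (cases "x \<in> U")
      case True
      then obtain j where j: "x \<in> ball (c j) (r j)" using UA cr by auto
      have "(\<lambda>n. \<Prod>i<n. 1 - bump (c i) (r i) n x) \<longlonglongrightarrow> 0"
      proof (rule tendsto_sandwich[where f = "\<lambda>n. 0" and h = "\<lambda>n. 1 - bump (c j) (r j) n x"])
        show "\<forall>\<^sub>F n in sequentially. (\<Prod>i<n. 1 - bump (c i) (r i) n x) \<le> 1 - bump (c j) (r j) n x"
          using eventually_gt_at_top[of j]
        proof eventually_elim
          case (elim n)
          have "(\<Prod>i<n. 1 - bump (c i) (r i) n x) =
            (1 - bump (c j) (r j) n x) * (\<Prod>i\<in>{..<n} - {j}. 1 - bump (c i) (r i) n x)"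
            using elim by (subst prod.remove[of _ j]) auto
          also have "\<dots> \<le> (1 - bump (c j) (r j) n x) * 1"
            by (intro mult_left_mono prod_le_1) (auto simp: bump_bounds)
          finally show ?case by simp
        qed
        show "(\<lambda>n. 1 - bump (c j) (r j) n x) \<longlonglongrightarrow> 0"
          using tendsto_diff[OF tendsto_const bump_tendsto[OF j], of 1] by simp
      qed (auto intro!: always_eventually prod_nonneg simp: bump_bounds)
      from tendsto_diff[OF tendsto_const[of 1] this] show ?thesis
        using True by (simp add: \<phi>_def)
    next
      case False
      then have "x \<notin> A i" for i using UA by auto
      then have "bump (c i) (r i) n x = 0" for i n
        using bump_nonzero[OF cr(2)[of i], of "c i" n x] cr(1) by auto
      then show ?thesis using False by (simp add: \<phi>_def)
    qed
  qed
qed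

text \<open>
  By dominated convergence the hypothesis extends from test functions to indicator functions of open
  subsets of \<open>U\<close>.  These form a generator of the Borel sets that is closed under intersections, so
  all set integrals of \<open>f\<close> over Borel subsets of \<open>U\<close> vanish.
\<close>

lemma fundamental_lemma_calculus_of_variations:
  fixes f :: "'a::euclidean_space \<Rightarrow> real"
  assumes "open U" and f: "integrable lborel f"
    and 0: "\<And>\<phi>. \<phi> \<in> test_fun U \<Longrightarrow> (\<integral>x. f x * \<phi> x \<partial>lborel) = 0"
  shows "AE x in lborel. x \<in> U \<longrightarrow> f x = 0"
proof -
  let ?f = "\<lambda>x. indicat_real U x * f x"
  have f': "integrable lborel ?f"
    using integrable_mult_indicator[of U lborel f] assms by auto
  have opn: "(\<integral>x. indicat_real V x * ?f x \<partial>lborel) = 0" if "open V" for V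
  proof -
    obtain \<phi> where \<phi>: "\<And>n::nat. \<phi> n \<in> test_fun (U \<inter> V)" "\<And>n x. 0 \<le> \<phi> n x \<and> \<phi> n x \<le> 1"
      "\<And>x. (\<lambda>n. \<phi> n x) \<longlonglongrightarrow> indicat_real (U \<inter> V) x"
      using test_fun_approx_open[of "U \<inter> V"] assms \<open>open V\<close> by blast
    have [measurable]: "f \<in> borel_measurable borel" using f by auto
    have [measurable]: "U \<in> sets borel" "V \<in> sets borel" using assms \<open>open V\<close> by auto
    have [measurable]: "\<phi> n \<in> borel_measurable borel" for n
      using \<phi>(1)[of n] by (auto simp: test_fun_def intro!: borel_measurable_continuous_onI Ck_imp_continuous)
    have "(\<lambda>n. \<integral>x. f x * \<phi> n x \<partial>lborel) \<longlonglongrightarrow> (\<integral>x. f x * indicat_real (U \<inter> V) x \<partial>lborel)"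
    proof (rule integral_dominated_convergence[where w = "\<lambda>x. \<bar>f x\<bar>"])
      show "AE x in lborel. (\<lambda>n. f x * \<phi> n x) \<longlonglongrightarrow> f x * indicat_real (U \<inter> V) x"
        by (intro AE_I2 tendsto_intros \<phi>)
      show "AE x in lborel. norm (f x * \<phi> n x) \<le> \<bar>f x\<bar>" for n
        using \<phi>(2) by (auto simp: abs_mult intro!: mult_left_le)
    qed (use f in auto)
    moreover have "(\<integral>x. f x * \<phi> n x \<partial>lborel) = 0" for n
      using \<phi>(1)[of n] by (intro 0) (auto simp: test_fun_def)
    ultimately show ?thesis
      by (simp add: LIMSEQ_const_iff indicator_inter_arith mult_ac)
  qed
  have "AE x in lborel. ?f x = 0"
  proof (rule sigma_finite_measure.density_zero[OF sigma_finite_lborel f'])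
    fix A :: "'a set" assume "A \<in> sets lborel"
    then have A: "A \<in> sigma_sets UNIV {S. open S}" by (simp add: borel_def)
    have "Int_stable {S::'a set. open S}" by (auto simp: Int_stable_def)
    moreover have "{S::'a set. open S} \<subseteq> Pow UNIV" by simp
    ultimately have "(\<integral>x. indicat_real A x * ?f x \<partial>lborel) = 0" using A
    proof (induction rule: sigma_sets_induct_disjoint)
      case (basic A)
      then show ?case by (intro opn) simp
    next
      case empty
      then show ?case by simp
    next
      case (compl A)
      then have A: "A \<in> sets lborel" by (simp add: borel_def)
      have "(\<integral>x. indicat_real (UNIV - A) x * ?f x \<partial>lborel) =
        (\<integral>x. indicat_real UNIV x * ?f x - indicat_real A x * ?f x \<partial>lborel)"
        by (intro Bochner_Integration.integral_cong) (auto simp: indicator_def)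
      also have "\<dots> = 0"
        using f' integrable_mult_indicator[OF A f'] opn[of UNIV] compl
        by (subst Bochner_Integration.integral_diff) auto
      finally show ?case .
    next
      case (union A)
      then have A: "A i \<in> sets lborel" for i by (auto simp: borel_def)
      have "set_lebesgue_integral lborel (\<Union>i. A i) ?f = (\<Sum>i. set_lebesgue_integral lborel (A i) ?f)"
      proof (rule lebesgue_integral_countable_add)
        have "(\<Union>i. A i) \<in> sets lborel" using A by auto
        then show "set_integrable lborel (\<Union>i. A i) ?f"
          using integrable_mult_indicator[OF _ f'] by (auto simp: set_integrable_def)
      qed (use A union in \<open>auto simp: disjoint_family_on_def\<close>)
      then show ?case using union by (simp add: set_lebesgue_integral_def)
    qed
    then show "set_lebesgue_integral lborel A ?f = 0"
      by (simp add: set_lebesgue_integral_def)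
  qed
  then show ?thesis by eventually_elim auto
qed

section \<open>Representatives of square-integrable functions\<close>

lemma sq_int_rep: "sq_int (rep_lsq u)"
  using Quotient_rep_reflp[OF Quotient_lsq] by blast

lemma abs_rep_lsq: "abs_lsq (rep_lsq u) = u"
  using Quotient_abs_rep[OF Quotient_lsq] .

lemma rep_abs_lsq: "sq_int f \<Longrightarrow> AE x in lborel. rep_lsq (abs_lsq f) x = f x"
  using Quotient_rep_abs[OF Quotient_lsq, of f] by auto

lemma abs_lsq_eq: "sq_int f \<Longrightarrow> sq_int g \<Longrightarrow> abs_lsq f = abs_lsq g \<longleftrightarrow> (AE x in lborel. f x = g x)"
  using Quotient_rel[OF Quotient_lsq, of f g] by auto

lemma abs_lsq_add: "sq_int f \<Longrightarrow> sq_int g \<Longrightarrow> abs_lsq (\<lambda>x. f x + g x) = abs_lsq f + abs_lsq g"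
  by (simp add: plus_lsq.abs_eq)

lemma abs_lsq_scaleR: "sq_int f \<Longrightarrow> abs_lsq (\<lambda>x. c * f x) = c *\<^sub>R abs_lsq f"
  by (simp add: scaleR_lsq.abs_eq)

lemma inner_abs_lsq: "sq_int f \<Longrightarrow> sq_int g \<Longrightarrow> inner (abs_lsq f) (abs_lsq g) = (\<integral>x. f x * g x \<partial>lborel)"
  by (simp add: inner_lsq.abs_eq)

lemma restr_abs_lsq: "sq_int f \<Longrightarrow> S \<in> sets borel \<Longrightarrow> restr S (abs_lsq f) = abs_lsq (\<lambda>x. indicat_real S x * f x)"
  by (simp add: restr.abs_eq)

lemma restr_add: "restr S (u + v) = restr S u + restr S v"
  by transfer (auto simp: distrib_left intro: sq_int_add sq_int_indicator sq_int_zero)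

lemma restr_scaleR: "restr S (c *\<^sub>R u) = c *\<^sub>R restr S u"
  by transfer (auto simp: mult.left_commute intro: sq_int_scale sq_int_indicator sq_int_zero)

lemma restr_diff: "restr S (u - v) = restr S u - restr S v"
  using restr_add[of S u "-1 *\<^sub>R v"] restr_scaleR[of S "-1" v] by simp

lemma subspace_L2: "subspace (L2 S)"
  using restr_scaleR[of S 0 0]
  by (auto simp: subspace_def L2_def restr_add restr_scaleR)

section \<open>Integration by parts\<close>

lemma test_funD:
  assumes "\<phi> \<in> test_fun S"
  shows "Ck k \<phi>" "compact (closure {x. \<phi> x \<noteq> 0})" "closure {x. \<phi> x \<noteq> 0} \<subseteq> S"
    "continuous_on UNIV \<phi>"
  using assms by (auto simp: test_fun_def intro: Ck_imp_continuous)

lemma test_fun_zero_outside: "\<phi> \<in> test_fun S \<Longrightarrow> x \<notin> S \<Longrightarrow> \<phi> x = 0"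
  using test_funD(3)[of \<phi> S] closure_subset[of "{x. \<phi> x \<noteq> 0}"] by blast

lemma test_funI:
  assumes "\<And>k. Ck k \<psi>" "\<phi> \<in> test_fun S" "{x. \<psi> x \<noteq> 0} \<subseteq> closure {x. \<phi> x \<noteq> 0}"
  shows "\<psi> \<in> test_fun S"
proof -
  have "closure {x. \<psi> x \<noteq> 0} \<subseteq> closure {x. \<phi> x \<noteq> 0}"
    using assms(3) by (simp add: closure_minimal)
  moreover from this have "compact (closure {x. \<psi> x \<noteq> 0})"
    using bounded_subset[OF compact_imp_bounded[OF test_funD(2)[OF assms(2)]]]
    by (simp add: compact_eq_bounded_closed)
  ultimately show ?thesis
    using assms(1) test_funD(3)[OF assms(2)] by (auto simp: test_fun_def)
qed

lemma test_fun_mult: "\<phi> \<in> test_fun S \<Longrightarrow> (\<And>k. Ck k \<psi>) \<Longrightarrow> (\<lambda>x. \<psi> x * \<phi> x) \<in> test_fun S"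
  by (rule test_funI[of _ \<phi>])
     (auto intro: Ck_mult test_funD subsetD[OF closure_subset])

lemma test_fun_zero: "(\<lambda>x. 0) \<in> test_fun S"
  by (simp add: test_fun_def Ck_const)

lemma test_fun_add:
  assumes "\<phi> \<in> test_fun S" "\<psi> \<in> test_fun S"
  shows "(\<lambda>x. \<phi> x + \<psi> x) \<in> test_fun S"
proof -
  let ?K = "closure {x. \<phi> x \<noteq> 0} \<union> closure {x. \<psi> x \<noteq> 0}"
  have "closure {x. \<phi> x + \<psi> x \<noteq> 0} \<subseteq> ?K"
    using closure_subset[of "{x. \<phi> x \<noteq> 0}"] closure_subset[of "{x. \<psi> x \<noteq> 0}"]
    by (intro closure_minimal) (auto simp: subset_iff, metis add_0)
  moreover have "compact ?K"
    by (rule compact_Un[OF test_funD(2)[OF assms(1)] test_funD(2)[OF assms(2)]])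
  ultimately have "compact (closure {x. \<phi> x + \<psi> x \<noteq> 0})" "closure {x. \<phi> x + \<psi> x \<noteq> 0} \<subseteq> S"
    using bounded_subset[OF compact_imp_bounded, of ?K] test_funD(3)[OF assms(1)] test_funD(3)[OF assms(2)]
    by (auto simp only: compact_eq_bounded_closed closed_closure)
  then show ?thesis
    using test_funD(1)[OF assms(1)] test_funD(1)[OF assms(2)] by (simp add: test_fun_def Ck_add)
qed

lemma test_fun_partial_deriv:
  assumes "\<phi> \<in> test_fun S" "b \<in> Basis"
  shows "partial_deriv b \<phi> \<in> test_fun S"
proof (rule test_funI[OF _ assms(1)])
  show "Ck k (partial_deriv b \<phi>)" for k
    using test_funD(1)[OF assms(1), of "Suc k"] assms(2) by simp
  show "{x. partial_deriv b \<phi> x \<noteq> 0} \<subseteq> closure {x. \<phi> x \<noteq> 0}"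
  proof (rule subsetI, rule ccontr)
    fix x assume x: "x \<in> {x. partial_deriv b \<phi> x \<noteq> 0}" "x \<notin> closure {x. \<phi> x \<noteq> 0}"
    have "((\<lambda>x. 0) has_derivative (\<lambda>h. 0)) (at x)" by simp
    then have "(\<phi> has_derivative (\<lambda>h. 0)) (at x)"
      by (rule has_derivative_transform_within_open[where s = "- closure {x. \<phi> x \<noteq> 0}"])
         (use x(2) closure_subset[of "{x. \<phi> x \<noteq> 0}"] in auto)
    then show False using partial_deriv_unique x(1) by fastforce
  qed
qed

lemma test_fun_bounded:
  assumes "\<phi> \<in> test_fun S"
  obtains K where "K \<ge> 0" "\<And>x. \<bar>\<phi> x\<bar> \<le> K"
proof -
  let ?C = "closure {x. \<phi> x \<noteq> 0}"
  have "compact (\<phi> ` ?C)"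
    using test_funD[OF assms] by (blast intro: compact_continuous_image continuous_on_subset)
  then have "bounded (\<phi> ` ?C)" by (rule compact_imp_bounded)
  then obtain K where K: "\<And>x. x \<in> ?C \<Longrightarrow> \<bar>\<phi> x\<bar> \<le> K"
    unfolding bounded_iff by auto
  have "\<bar>\<phi> x\<bar> \<le> max K 0" for x
    using K[of x] closure_subset[of "{x. \<phi> x \<noteq> 0}"] by (cases "\<phi> x = 0") auto
  then show ?thesis by (rule that[rotated]) simp
qed

lemma test_fun_integrable:
  assumes "\<phi> \<in> test_fun S"
  shows "integrable lborel \<phi>"
proof -
  have "integrable lborel (\<lambda>x. indicat_real (closure {x. \<phi> x \<noteq> 0}) x *\<^sub>R \<phi> x)"
    using test_funD[OF assms] by (intro borel_integrable_compact) (auto intro: continuous_on_subset)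
  moreover have "(\<lambda>x. indicat_real (closure {x. \<phi> x \<noteq> 0}) x *\<^sub>R \<phi> x) = \<phi>"
    using closure_subset[of "{x. \<phi> x \<noteq> 0}"] by (auto simp: indicator_def fun_eq_iff)
  ultimately show ?thesis by simp
qed

lemma test_fun_sq_int:
  assumes "\<phi> \<in> test_fun S"
  shows "sq_int \<phi>"
  using test_fun_integrable[OF test_fun_mult[OF assms test_funD(1)[OF assms]]]
    test_funD(4)[OF assms]
  by (auto simp: sq_int_def power2_eq_square intro: borel_measurable_continuous_onI)

lemma test_fun_L2:
  assumes "\<phi> \<in> test_fun S" "open S"
  shows "abs_lsq \<phi> \<in> L2 S"
proof -
  have "(\<lambda>x. indicat_real S x * \<phi> x) = \<phi>"
    using test_fun_zero_outside[OF assms(1)] by (auto simp: indicator_def fun_eq_iff)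
  then show ?thesis
    using assms by (simp add: L2_def restr_abs_lsq test_fun_sq_int)
qed

text \<open>
  Translation invariance of Lebesgue measure: the difference quotients of \<open>\<phi>\<close> in direction \<open>b\<close> have
  integral \<open>0\<close>.  By the mean value theorem they are dominated by the maximum of the derivative on a
  ball that contains the supports of all translates of \<open>\<phi>\<close> by at most \<open>b\<close>.
\<close>

lemma integral_partial_deriv:
  fixes \<phi> :: "'a::euclidean_space \<Rightarrow> real"
  assumes \<phi>: "\<phi> \<in> test_fun S" and b: "b \<in> Basis"
  shows "(\<integral>x. partial_deriv b \<phi> x \<partial>lborel) = 0"
proof -
  let ?d = "partial_deriv b \<phi>"
  have d: "?d \<in> test_fun S" using test_fun_partial_deriv[OF assms] .
  obtain K where K: "K \<ge> 0" "\<And>x. \<bar>?d x\<bar> \<le> K" using test_fun_bounded[OF d] by blast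
  obtain R where R: "\<And>x. \<phi> x \<noteq> 0 \<Longrightarrow> norm x \<le> R"
    using compact_imp_bounded[OF test_funD(2)[OF \<phi>]] closure_subset[of "{x. \<phi> x \<noteq> 0}"]
    by (force simp: bounded_iff)
  define h where "h n = 1 / real (Suc n)" for n
  have h: "0 < h n" "h n \<le> 1" for n by (auto simp: h_def)
  have h0: "h \<longlonglongrightarrow> 0" unfolding h_def using LIMSEQ_inverse_real_of_nat by (simp add: inverse_eq_divide)
  have int: "integrable lborel \<phi>" using test_fun_integrable[OF \<phi>] .
  have meas[measurable]: "\<phi> \<in> borel_measurable borel" "?d \<in> borel_measurable borel"
    using int test_fun_integrable[OF d] by auto
  have trans: "integrable lborel (\<lambda>x. \<phi> (c + x))" "(\<integral>x. \<phi> (c + x) \<partial>lborel) = (\<integral>x. \<phi> x \<partial>lborel)" for c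
    using int integrable_distr_eq[of "(+) c" lborel borel \<phi>] integral_distr[of "(+) c" lborel borel \<phi>]
    by (auto simp: lborel_distr_plus)
  have line: "((\<lambda>t. \<phi> (x + t *\<^sub>R b)) has_real_derivative ?d (x + t *\<^sub>R b)) (at t)" for x t
  proof -
    have "bounded_linear (\<lambda>h. partial_deriv h \<phi> y)" for y
      using has_derivative_bounded_linear[OF Ck_has_derivative[OF test_funD(1)[OF \<phi>, of "Suc 0"]]] .
    then have "partial_deriv (s *\<^sub>R b) \<phi> y = s * ?d y" for s y
      using linear_scale[OF bounded_linear.linear] by fastforce
    moreover have "((\<lambda>t. \<phi> (x + t *\<^sub>R b)) has_derivative
        (\<lambda>s. partial_deriv (s *\<^sub>R b) \<phi> (x + t *\<^sub>R b))) (at t)"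
      by (rule has_derivative_compose[OF _ Ck_has_derivative[OF test_funD(1)[OF \<phi>, of "Suc 0"]]])
         (auto intro!: derivative_eq_intros)
    ultimately show ?thesis
      by (simp add: has_field_derivative_def mult.commute[of _ "?d _"])
  qed
  let ?q = "\<lambda>n x. (\<phi> (h n *\<^sub>R b + x) - \<phi> x) / h n"
  have "(\<lambda>n. \<integral>x. ?q n x \<partial>lborel) \<longlonglongrightarrow> (\<integral>x. ?d x \<partial>lborel)"
  proof (rule integral_dominated_convergence[where w = "\<lambda>x. indicat_real (cball 0 (R + 1)) x *\<^sub>R K"])
    show "integrable lborel (\<lambda>x::'a. indicat_real (cball 0 (R + 1)) x *\<^sub>R K)"
      by (rule borel_integrable_compact) auto
    show "AE x in lborel. (\<lambda>n. ?q n x) \<longlonglongrightarrow> ?d x"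
    proof (rule AE_I2)
      fix x
      have "((\<lambda>t. (\<phi> (x + t *\<^sub>R b) - \<phi> x) / t) \<longlongrightarrow> ?d x) (at 0)"
        using line[of x 0] by (simp add: DERIV_def)
      moreover have "filterlim h (at 0) sequentially"
        using h0 h(1) by (auto simp: filterlim_at intro!: always_eventually less_imp_neq[symmetric])
      ultimately show "(\<lambda>n. ?q n x) \<longlonglongrightarrow> ?d x"
        using filterlim_compose by (fastforce simp: add.commute)
    qed
    show "AE x in lborel. norm (?q n x) \<le> indicat_real (cball 0 (R + 1)) x *\<^sub>R K" for n
    proof (rule AE_I2)
      fix x
      obtain t where "0 < t" "t < h n" "\<phi> (x + h n *\<^sub>R b) - \<phi> (x + 0 *\<^sub>R b) = (h n - 0) * ?d (x + t *\<^sub>R b)"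
        using MVT2[OF h(1) line] by blast
      then have "\<bar>?q n x\<bar> \<le> K"
        using K(2) h(1)[of n] by (simp add: add.commute)
      \<comment> \<open>the support of \<open>\<phi>\<close> is moved by at most \<open>h n \<le> 1\<close>\<close>
      moreover have "?q n x = 0" if "x \<notin> cball 0 (R + 1)"
      proof -
        have "norm x > R + 1" using that by simp
        moreover have "norm x \<le> norm (h n *\<^sub>R b + x) + norm (h n *\<^sub>R b)"
          using norm_triangle_ineq4[of "h n *\<^sub>R b + x" "h n *\<^sub>R b"] by simp
        moreover have "norm (h n *\<^sub>R b) \<le> 1" using h[of n] b by simp
        ultimately have "\<not> norm x \<le> R" "\<not> norm (h n *\<^sub>R b + x) \<le> R" by auto
        then show ?thesis using R by (metis cancel_comm_monoid_add_class.diff_cancel div_0)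
      qed
      ultimately show "norm (?q n x) \<le> indicat_real (cball 0 (R + 1)) x *\<^sub>R K"
        using K(1) by (auto simp: indicator_def)
    qed
  qed measurable
  moreover have "(\<lambda>n. \<integral>x. ?q n x \<partial>lborel) = (\<lambda>n. 0)"
    using trans int by simp
  ultimately show ?thesis by (simp only: LIMSEQ_const_iff)
qed

lemma partial_deriv_mult:
  assumes "\<And>k. Ck k f" "\<And>k. Ck k g"
  shows "partial_deriv b (\<lambda>x. f x * g x) x = f x * partial_deriv b g x + partial_deriv b f x * g x"
  using partial_deriv_unique[OF has_derivative_mult[OF Ck_has_derivative[OF assms(1)[of "Suc 0"]]
        Ck_has_derivative[OF assms(2)[of "Suc 0"]]]] .

lemma integration_by_parts:
  assumes \<phi>: "\<phi> \<in> test_fun S" and \<psi>: "\<psi> \<in> test_fun S" and b: "b \<in> Basis"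
  shows "(\<integral>x. \<phi> x * partial_deriv b \<psi> x \<partial>lborel) = - (\<integral>x. partial_deriv b \<phi> x * \<psi> x \<partial>lborel)"
proof -
  have "(\<lambda>x. \<phi> x * \<psi> x) \<in> test_fun S" using assms by (intro test_fun_mult test_funD)
  from integral_partial_deriv[OF this b]
  have "0 = (\<integral>x. \<phi> x * partial_deriv b \<psi> x + partial_deriv b \<phi> x * \<psi> x \<partial>lborel)"
    using test_funD(1)[OF \<phi>] test_funD(1)[OF \<psi>] by (simp add: partial_deriv_mult)
  also have "\<dots> = (\<integral>x. \<phi> x * partial_deriv b \<psi> x \<partial>lborel) + (\<integral>x. partial_deriv b \<phi> x * \<psi> x \<partial>lborel)"
    by (intro Bochner_Integration.integral_add sq_int_mult test_fun_sq_int[of _ S]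
        test_fun_partial_deriv assms)
  finally show ?thesis by simp
qed

section \<open>Weak derivatives and Sobolev spaces\<close>

lemma bounded_indicator_sq_int:
  assumes "open S" "bounded S"
  shows "sq_int (indicat_real S)"
proof -
  have "emeasure lborel S < \<infinity>" using emeasure_bounded_finite[OF assms(2)] .
  moreover have "(\<lambda>x. (indicat_real S x)\<^sup>2) = indicat_real S" by (auto simp: indicator_def)
  ultimately show ?thesis using assms by (auto simp: sq_int_def)
qed

lemma L2_orthogonal_test_fun:
  fixes \<Omega> :: "'a::euclidean_space set"
  assumes "open \<Omega>" "bounded \<Omega>" "u \<in> L2 \<Omega>" "\<And>\<phi>. \<phi> \<in> test_fun \<Omega> \<Longrightarrow> inner u (abs_lsq \<phi>) = 0"
  shows "u = 0"
proof -
  let ?f = "rep_lsq u"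
  let ?g = "\<lambda>x. indicat_real \<Omega> x * ?f x"
  have sq: "sq_int ?f" "sq_int ?g"
    using assms by (auto intro: sq_int_rep sq_int_indicator)
  have ug: "u = abs_lsq ?g"
    using \<open>u \<in> L2 \<Omega>\<close> restr_abs_lsq[OF sq(1), of \<Omega>] assms(1) by (simp add: L2_def abs_rep_lsq)
  have "AE x in lborel. x \<in> \<Omega> \<longrightarrow> ?g x = 0"
  proof (rule fundamental_lemma_calculus_of_variations[OF \<open>open \<Omega>\<close>])
    show "integrable lborel ?g"
      by (rule sq_int_mult[OF bounded_indicator_sq_int[OF assms(1,2)] sq(1)])
    show "(\<integral>x. ?g x * \<phi> x \<partial>lborel) = 0" if "\<phi> \<in> test_fun \<Omega>" for \<phi>
      using assms(4)[OF that] inner_abs_lsq[OF sq(2) test_fun_sq_int[OF that]] ug by simp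
  qed
  then have "AE x in lborel. ?g x = 0"
    by eventually_elim (auto simp: indicator_def)
  then have "abs_lsq ?g = abs_lsq (\<lambda>x. 0)"
    using abs_lsq_eq[OF sq(2) sq_int_zero] by simp
  then show ?thesis using ug by (simp add: zero_lsq_def)
qed

lemma weak_deriv_test_fun:
  assumes "open \<Omega>" "\<phi> \<in> test_fun \<Omega>" "b \<in> Basis"
  shows "weak_deriv \<Omega> b (abs_lsq \<phi>) (abs_lsq (partial_deriv b \<phi>))"
  using assms integration_by_parts[OF assms(2) _ assms(3)]
  by (auto simp: weak_deriv_def inner_abs_lsq test_fun_sq_int[of _ \<Omega>] test_fun_partial_deriv
      intro!: test_fun_L2)

lemma weak_deriv_add:
  "weak_deriv \<Omega> b u u' \<Longrightarrow> weak_deriv \<Omega> b v v' \<Longrightarrow> weak_deriv \<Omega> b (u + v) (u' + v')"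
  by (auto simp: weak_deriv_def inner_add_left subspace_add[OF subspace_L2])

lemma weak_deriv_scaleR:
  "weak_deriv \<Omega> b u u' \<Longrightarrow> weak_deriv \<Omega> b (c *\<^sub>R u) (c *\<^sub>R u')"
  by (auto simp: weak_deriv_def subspace_scale[OF subspace_L2])

lemma grad_inner_self: "grad_inner \<Omega> u u = (\<Sum>b\<in>Basis. (norm (D \<Omega> b u))\<^sup>2)"
  by (simp add: grad_inner_def power2_norm_eq_inner)

lemma grad_inner_nonneg: "0 \<le> grad_inner \<Omega> u u"
  by (simp add: grad_inner_self sum_nonneg)

lemma H1_norm_sq: "(H1_norm \<Omega> u)\<^sup>2 = (norm u)\<^sup>2 + grad_inner \<Omega> u u"
  by (simp add: H1_norm_def grad_inner_nonneg)

lemma H1_norm_nonneg: "0 \<le> H1_norm \<Omega> u"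
  by (simp add: H1_norm_def grad_inner_nonneg)

lemma norm_le_H1_norm: "norm u \<le> H1_norm \<Omega> u"
  by (rule power2_le_imp_le) (simp_all add: H1_norm_sq grad_inner_nonneg H1_norm_nonneg)

lemma norm_D_le_H1_norm:
  assumes "b \<in> Basis"
  shows "norm (D \<Omega> b u) \<le> H1_norm \<Omega> u"
proof (rule power2_le_imp_le)
  have "(norm (D \<Omega> b u))\<^sup>2 \<le> grad_inner \<Omega> u u"
    unfolding grad_inner_self using assms by (intro member_le_sum) auto
  then show "(norm (D \<Omega> b u))\<^sup>2 \<le> (H1_norm \<Omega> u)\<^sup>2"
    by (simp add: H1_norm_sq add_increasing)
qed (rule H1_norm_nonneg)

text \<open>
  The vector \<open>0\<close> is not in \<open>Basis\<close> and serves as the index of \<open>u\<close> itself among its derivatives.  In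
  this form the triangle inequality is that of the Euclidean norm.
\<close>

lemma H1_norm_L2_set:
  "H1_norm \<Omega> u = L2_set (\<lambda>b. norm (if b = 0 then u else D \<Omega> b u)) (insert 0 Basis)"
proof -
  have "(\<Sum>b\<in>Basis. (norm (if b = 0 then u else D \<Omega> b u))\<^sup>2) = (\<Sum>b\<in>Basis. (norm (D \<Omega> b u))\<^sup>2)"
    by (rule sum.cong) auto
  then show ?thesis
    by (simp add: H1_norm_def L2_set_def grad_inner_self)
qed

locale bounded_open =
  fixes \<Omega> :: "'a::euclidean_space set"
  assumes open_dom: "open \<Omega>" and bounded_dom: "bounded \<Omega>"
begin

lemma weak_deriv_unique:
  assumes "weak_deriv \<Omega> b u v" "weak_deriv \<Omega> b u w"
  shows "v = w"
proof -
  have "v - w = 0"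
    using assms by (intro L2_orthogonal_test_fun[OF open_dom bounded_dom])
      (auto simp: weak_deriv_def inner_diff_left subspace_diff[OF subspace_L2])
  then show ?thesis by simp
qed

lemma D_eq: "weak_deriv \<Omega> b u v \<Longrightarrow> D \<Omega> b u = v"
  unfolding D_def by (rule the_equality) (auto intro: weak_deriv_unique)

lemma weak_deriv_D: "u \<in> H1 \<Omega> \<Longrightarrow> b \<in> Basis \<Longrightarrow> weak_deriv \<Omega> b u (D \<Omega> b u)"
  unfolding H1_def using D_eq by fastforce

lemma subspace_H1: "subspace (H1 \<Omega>)"
proof (rule subspaceI)
  have "weak_deriv \<Omega> b 0 0" for b
    by (simp add: weak_deriv_def subspace_0[OF subspace_L2])
  then show "0 \<in> H1 \<Omega>"
    by (auto simp: H1_def subspace_0[OF subspace_L2])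
qed (auto simp: H1_def subspace_add[OF subspace_L2] subspace_scale[OF subspace_L2]
    intro: weak_deriv_add weak_deriv_scaleR dest!: bspec; blast intro: weak_deriv_add weak_deriv_scaleR)+

lemma D_add: "u \<in> H1 \<Omega> \<Longrightarrow> v \<in> H1 \<Omega> \<Longrightarrow> b \<in> Basis \<Longrightarrow> D \<Omega> b (u + v) = D \<Omega> b u + D \<Omega> b v"
  by (intro D_eq weak_deriv_add weak_deriv_D)

lemma D_scaleR: "u \<in> H1 \<Omega> \<Longrightarrow> b \<in> Basis \<Longrightarrow> D \<Omega> b (c *\<^sub>R u) = c *\<^sub>R D \<Omega> b u"
  by (intro D_eq weak_deriv_scaleR weak_deriv_D)

lemma H1_norm_triangle:
  assumes "u \<in> H1 \<Omega>" "v \<in> H1 \<Omega>"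
  shows "H1_norm \<Omega> (u + v) \<le> H1_norm \<Omega> u + H1_norm \<Omega> v"
proof -
  have "H1_norm \<Omega> (u + v) \<le> L2_set (\<lambda>b. norm (if b = 0 then u else D \<Omega> b u)
      + norm (if b = 0 then v else D \<Omega> b v)) (insert 0 Basis)"
    unfolding H1_norm_L2_set
    by (rule L2_set_mono) (auto simp: D_add[OF assms] norm_triangle_ineq)
  also have "\<dots> \<le> H1_norm \<Omega> u + H1_norm \<Omega> v"
    unfolding H1_norm_L2_set by (rule L2_set_triangle_ineq)
  finally show ?thesis .
qed

lemma H1_norm_scaleR:
  assumes "u \<in> H1 \<Omega>"
  shows "H1_norm \<Omega> (c *\<^sub>R u) = \<bar>c\<bar> * H1_norm \<Omega> u"
proof -
  have "H1_norm \<Omega> (c *\<^sub>R u) = L2_set (\<lambda>b. \<bar>c\<bar> * norm (if b = 0 then u else D \<Omega> b u)) (insert 0 Basis)"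
    unfolding H1_norm_L2_set
    by (rule L2_set_cong) (auto simp: D_scaleR[OF assms])
  then show ?thesis
    unfolding H1_norm_L2_set by (subst (asm) L2_set_right_distrib[symmetric]) auto
qed

lemma test_fun_H1: "\<phi> \<in> test_fun \<Omega> \<Longrightarrow> abs_lsq \<phi> \<in> H1 \<Omega>"
  using weak_deriv_test_fun[OF open_dom] test_fun_L2[OF _ open_dom] by (auto simp: H1_def)

lemma D_test_fun: "\<phi> \<in> test_fun \<Omega> \<Longrightarrow> b \<in> Basis \<Longrightarrow> D \<Omega> b (abs_lsq \<phi>) = abs_lsq (partial_deriv b \<phi>)"
  by (intro D_eq weak_deriv_test_fun open_dom)

lemma H10_subset_H1: "H10 \<Omega> \<subseteq> H1 \<Omega>"
  by (auto simp: H10_def)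

lemma subspace_H10: "subspace (H10 \<Omega>)"
proof (rule subspaceI)
  have "H1_norm \<Omega> (0 - abs_lsq (\<lambda>x. 0)) = 0"
    using H1_norm_scaleR[OF subspace_0[OF subspace_H1], of 0] by (simp flip: zero_lsq_def)
  then show "0 \<in> H10 \<Omega>"
    using subspace_0[OF subspace_H1] by (auto simp: H10_def intro!: bexI[OF _ test_fun_zero])
next
  fix u v assume u: "u \<in> H10 \<Omega>" and v: "v \<in> H10 \<Omega>"
  have H1: "u \<in> H1 \<Omega>" "v \<in> H1 \<Omega>" using u v H10_subset_H1 by auto
  have "\<exists>\<phi>\<in>test_fun \<Omega>. H1_norm \<Omega> (u + v - abs_lsq \<phi>) < e" if "e > 0" for e
  proof -
    obtain \<phi> \<psi> where \<phi>: "\<phi> \<in> test_fun \<Omega>" "H1_norm \<Omega> (u - abs_lsq \<phi>) < e / 2"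
      and \<psi>: "\<psi> \<in> test_fun \<Omega>" "H1_norm \<Omega> (v - abs_lsq \<psi>) < e / 2"
      using u v half_gt_zero[OF \<open>e > 0\<close>] unfolding H10_def by blast
    have "u + v - abs_lsq (\<lambda>x. \<phi> x + \<psi> x) = (u - abs_lsq \<phi>) + (v - abs_lsq \<psi>)"
      using \<phi> \<psi> by (simp add: abs_lsq_add test_fun_sq_int[of _ \<Omega>])
    moreover have "H1_norm \<Omega> ((u - abs_lsq \<phi>) + (v - abs_lsq \<psi>))
      \<le> H1_norm \<Omega> (u - abs_lsq \<phi>) + H1_norm \<Omega> (v - abs_lsq \<psi>)"
      using \<phi> \<psi> H1 by (intro H1_norm_triangle subspace_diff[OF subspace_H1] test_fun_H1)
    ultimately have "H1_norm \<Omega> (u + v - abs_lsq (\<lambda>x. \<phi> x + \<psi> x)) < e / 2 + e / 2"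
      using add_strict_mono[OF \<phi>(2) \<psi>(2)] by (simp only:)
    then show ?thesis using test_fun_add[OF \<phi>(1) \<psi>(1)] by auto
  qed
  then show "u + v \<in> H10 \<Omega>"
    using subspace_add[OF subspace_H1] H1 by (auto simp: H10_def)
next
  fix c u assume u: "u \<in> H10 \<Omega>"
  have H1: "u \<in> H1 \<Omega>" using u H10_subset_H1 by auto
  have "\<exists>\<phi>\<in>test_fun \<Omega>. H1_norm \<Omega> (c *\<^sub>R u - abs_lsq \<phi>) < e" if "e > 0" for e
  proof -
    have "e / (\<bar>c\<bar> + 1) > 0" using \<open>e > 0\<close> by simp
    then obtain \<phi> where \<phi>: "\<phi> \<in> test_fun \<Omega>" "H1_norm \<Omega> (u - abs_lsq \<phi>) < e / (\<bar>c\<bar> + 1)"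
      using u unfolding H10_def by blast
    have "H1_norm \<Omega> (c *\<^sub>R u - abs_lsq (\<lambda>x. c * \<phi> x)) = H1_norm \<Omega> (c *\<^sub>R (u - abs_lsq \<phi>))"
      using \<phi> by (simp add: abs_lsq_scaleR test_fun_sq_int[of _ \<Omega>] scaleR_diff_right)
    also have "\<dots> = \<bar>c\<bar> * H1_norm \<Omega> (u - abs_lsq \<phi>)"
      using \<phi> H1 by (intro H1_norm_scaleR subspace_diff[OF subspace_H1] test_fun_H1)
    also have "\<dots> \<le> (\<bar>c\<bar> + 1) * H1_norm \<Omega> (u - abs_lsq \<phi>)"
      by (intro mult_right_mono) (auto simp: H1_norm_nonneg)
    also have "\<dots> < e" using \<phi>(2) by (simp add: field_simps)
    finally show ?thesis using test_fun_mult[OF \<phi>(1) Ck_const] by blast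
  qed
  then show "c *\<^sub>R u \<in> H10 \<Omega>"
    using subspace_scale[OF subspace_H1] H1 by (auto simp: H10_def)
qed

text \<open>
  Integrate \<open>\<phi>\<^sup>2 = \<phi>\<^sup>2 * \<partial>\<^sub>b (x \<bullet> b)\<close> by parts: the result is \<open>- 2 * \<integral> (x \<bullet> b) * \<phi> * \<partial>\<^sub>b \<phi>\<close>, and
  \<open>\<bar>x \<bullet> b\<bar> \<le> R\<close> on the support of \<open>\<phi>\<close>.
\<close>

lemma Poincare_test_fun:
  assumes \<phi>: "\<phi> \<in> test_fun \<Omega>" and b: "b \<in> Basis" and R: "\<And>x. x \<in> \<Omega> \<Longrightarrow> norm x \<le> R" "R \<ge> 0"
  shows "norm (abs_lsq \<phi>) \<le> 2 * R * norm (abs_lsq (partial_deriv b \<phi>))"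
proof -
  let ?d = "partial_deriv b \<phi>" and ?\<psi> = "\<lambda>x. (x \<bullet> b) * \<phi> x"
  have lin: "Ck k (\<lambda>x. x \<bullet> b)" for k by (intro Ck_linear bounded_linear_inner_left)
  have d: "?d \<in> test_fun \<Omega>" using test_fun_partial_deriv[OF \<phi> b] .
  have \<psi>: "?\<psi> \<in> test_fun \<Omega>" by (rule test_fun_mult[OF \<phi> lin])
  note sq = test_fun_sq_int[OF \<phi>] test_fun_sq_int[OF d] test_fun_sq_int[OF \<psi>]
  have "partial_deriv b (\<lambda>x. x \<bullet> b) x = 1" for x
    using partial_deriv_unique[OF bounded_linear_imp_has_derivative[OF bounded_linear_inner_left], of b b x] b
    by simp
  then have d\<psi>: "partial_deriv b ?\<psi> x = (x \<bullet> b) * ?d x + \<phi> x" for x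
    using partial_deriv_mult[OF lin test_funD(1)[OF \<phi>], of b x] by simp
  have "(\<integral>x. ?\<psi> x * ?d x \<partial>lborel) = - (\<integral>x. partial_deriv b ?\<psi> x * \<phi> x \<partial>lborel)"
    by (rule integration_by_parts[OF \<psi> \<phi> b])
  also have "(\<integral>x. partial_deriv b ?\<psi> x * \<phi> x \<partial>lborel) = (\<integral>x. ?\<psi> x * ?d x + \<phi> x * \<phi> x \<partial>lborel)"
    by (rule Bochner_Integration.integral_cong) (simp_all only: d\<psi>, simp add: algebra_simps)
  also have "\<dots> = (\<integral>x. ?\<psi> x * ?d x \<partial>lborel) + (\<integral>x. \<phi> x * \<phi> x \<partial>lborel)"
    by (intro Bochner_Integration.integral_add sq_int_mult sq)
  finally have "(norm (abs_lsq \<phi>))\<^sup>2 = - 2 * inner (abs_lsq ?\<psi>) (abs_lsq ?d)"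
    by (simp add: power2_norm_eq_inner inner_abs_lsq sq)
  also have "\<dots> \<le> 2 * (norm (abs_lsq ?\<psi>) * norm (abs_lsq ?d))"
    using Cauchy_Schwarz_ineq2[of "abs_lsq ?\<psi>" "abs_lsq ?d"] by linarith
  also have "norm (abs_lsq ?\<psi>) \<le> R * norm (abs_lsq \<phi>)"
  proof (rule power2_le_imp_le)
    have "(norm (abs_lsq ?\<psi>))\<^sup>2 = (\<integral>x. ?\<psi> x * ?\<psi> x \<partial>lborel)"
      by (simp add: power2_norm_eq_inner inner_abs_lsq sq)
    also have "\<dots> \<le> (\<integral>x. R\<^sup>2 * (\<phi> x * \<phi> x) \<partial>lborel)"
    proof (rule integral_mono)
      show "?\<psi> x * ?\<psi> x \<le> R\<^sup>2 * (\<phi> x * \<phi> x)" for x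
      proof (cases "x \<in> \<Omega>")
        case True
        have "\<bar>x \<bullet> b\<bar> \<le> R" using R(1)[OF True] Basis_le_norm[OF b, of x] by linarith
        then have "(x \<bullet> b)\<^sup>2 \<le> R\<^sup>2" using R(2) by (metis abs_ge_zero power2_abs power_mono)
        then have "(x \<bullet> b)\<^sup>2 * (\<phi> x * \<phi> x) \<le> R\<^sup>2 * (\<phi> x * \<phi> x)" by (intro mult_right_mono) auto
        then show ?thesis by (simp add: power2_eq_square mult_ac)
      next
        case False
        then show ?thesis using test_fun_zero_outside[OF \<phi>] by simp
      qed
      show "integrable lborel (\<lambda>x. R\<^sup>2 * (\<phi> x * \<phi> x))"
        by (intro integrable_mult_right sq_int_mult sq)
    qed (intro sq_int_mult sq)
    also have "\<dots> = (R * norm (abs_lsq \<phi>))\<^sup>2"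
      by (simp add: power_mult_distrib power2_norm_eq_inner inner_abs_lsq sq)
    finally show "(norm (abs_lsq ?\<psi>))\<^sup>2 \<le> (R * norm (abs_lsq \<phi>))\<^sup>2" .
  qed (use R(2) in simp)
  finally have "norm (abs_lsq \<phi>) * norm (abs_lsq \<phi>) \<le> (2 * R * norm (abs_lsq ?d)) * norm (abs_lsq \<phi>)"
    by (simp add: power2_eq_square mult_ac mult_left_mono mult_right_mono)
  then show ?thesis
    using R(2) by (cases "norm (abs_lsq \<phi>) = 0") (auto simp: mult_le_cancel_right)
qed

text \<open>
  Both sides are continuous in the \<open>H1\<close> norm, so the inequality passes from test functions to their
  closure \<open>H10\<close>.
\<close>

lemma Poincare:
  obtains C where "C > 0" "\<And>u. u \<in> H10 \<Omega> \<Longrightarrow> (H1_norm \<Omega> u)\<^sup>2 \<le> C * grad_inner \<Omega> u u"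
proof -
  obtain R0 where R0: "\<And>x. x \<in> \<Omega> \<Longrightarrow> norm x \<le> R0"
    using bounded_dom by (auto simp: bounded_iff)
  \<comment> \<open>\<open>R0\<close> may be negative if \<open>\<Omega>\<close> is empty\<close>
  define R where "R = max R0 0"
  have R: "\<And>x. x \<in> \<Omega> \<Longrightarrow> norm x \<le> R" "R \<ge> 0"
    using R0 by (auto simp: R_def intro: le_max_iff_disj[THEN iffD2])
  obtain b :: 'a where b: "b \<in> Basis" using nonempty_Basis by blast
  show ?thesis
  proof (rule that[of "4 * R\<^sup>2 + 1"])
    fix u assume u: "u \<in> H10 \<Omega>"
    have "norm u \<le> 2 * R * norm (D \<Omega> b u)"
    proof (rule field_le_epsilon)
      fix e :: real assume "e > 0"
      \<comment> \<open>replacing \<open>u\<close> by \<open>\<phi>\<close> costs \<open>e'\<close> on the left and \<open>2 * R * e'\<close> on the right\<close>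
      define e' where "e' = e / (2 * R + 1)"
      have "e' > 0" using \<open>e > 0\<close> R(2) by (simp add: e'_def)
      then obtain \<phi> where \<phi>: "\<phi> \<in> test_fun \<Omega>" "H1_norm \<Omega> (u - abs_lsq \<phi>) < e'"
        using u unfolding H10_def by blast
      have "D \<Omega> b (abs_lsq \<phi>) = D \<Omega> b u - D \<Omega> b (u - abs_lsq \<phi>)"
        using D_add[of "u - abs_lsq \<phi>" "abs_lsq \<phi>" b] u H10_subset_H1 test_fun_H1[OF \<phi>(1)] b
          subspace_diff[OF subspace_H1] by fastforce
      then have "norm (D \<Omega> b (abs_lsq \<phi>)) \<le> norm (D \<Omega> b u) + norm (D \<Omega> b (u - abs_lsq \<phi>))"
        by (simp add: norm_triangle_ineq4)
      then have "norm (D \<Omega> b (abs_lsq \<phi>)) \<le> norm (D \<Omega> b u) + e'"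
        using norm_D_le_H1_norm[OF b, of \<Omega> "u - abs_lsq \<phi>"] \<phi>(2) by linarith
      then have "2 * R * norm (D \<Omega> b (abs_lsq \<phi>)) \<le> 2 * R * (norm (D \<Omega> b u) + e')"
        using R(2) by (intro mult_left_mono) auto
      moreover have "norm (abs_lsq \<phi>) \<le> 2 * R * norm (D \<Omega> b (abs_lsq \<phi>))"
        using Poincare_test_fun[OF \<phi>(1) b R] D_test_fun[OF \<phi>(1) b] by simp
      moreover have "norm u \<le> norm (abs_lsq \<phi>) + e'"
        using norm_triangle_ineq[of "u - abs_lsq \<phi>" "abs_lsq \<phi>"] norm_le_H1_norm[of "u - abs_lsq \<phi>" \<Omega>] \<phi>(2)
        by simp
      ultimately have "norm u \<le> 2 * R * norm (D \<Omega> b u) + (2 * R + 1) * e'"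
        by (simp add: algebra_simps)
      also have "(2 * R + 1) * e' = e" using R(2) by (simp add: e'_def)
      finally show "norm u \<le> 2 * R * norm (D \<Omega> b u) + e" .
    qed
    then have "(norm u)\<^sup>2 \<le> (2 * R * norm (D \<Omega> b u))\<^sup>2" by (intro power_mono) auto
    also have "\<dots> = 4 * R\<^sup>2 * (norm (D \<Omega> b u))\<^sup>2" by (simp add: power_mult_distrib)
    also have "\<dots> \<le> 4 * R\<^sup>2 * grad_inner \<Omega> u u"
      unfolding grad_inner_self using b by (intro mult_left_mono member_le_sum) auto
    finally show "(H1_norm \<Omega> u)\<^sup>2 \<le> (4 * R\<^sup>2 + 1) * grad_inner \<Omega> u u"
      by (simp add: H1_norm_sq algebra_simps)
  qed (simp add: add_nonneg_pos)
qed

end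

section \<open>Dual norms\<close>

lemma op_norm_bdd:
  assumes l: "bounded_linear_on V N N' l" and N: "\<And>v. 0 \<le> N v"
  shows "bdd_above ((\<lambda>v. N' (l v) / N v) ` V)"
proof -
  obtain K where K: "\<And>v. v \<in> V \<Longrightarrow> N' (l v) \<le> K * N v"
    using l unfolding bounded_linear_on_def by blast
  have "N' (l v) / N v \<le> max K 0" if "v \<in> V" for v
  proof (cases "N v = 0")
    case False
    then have "N v > 0" using N[of v] by simp
    then have "N' (l v) / N v \<le> K" using K[OF that] by (simp add: field_simps)
    then show ?thesis by simp
  qed simp
  then show ?thesis by (rule bdd_aboveI2)
qed

lemma op_norm_bound:
  assumes l: "bounded_linear_on V N N' l" and v: "v \<in> V" and N: "\<And>v. 0 \<le> N v"
  shows "N' (l v) \<le> op_norm V N N' l * N v"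
proof (cases "N v = 0")
  case True
  obtain K where "N' (l v) \<le> K * N v"
    using l v unfolding bounded_linear_on_def by blast
  then show ?thesis using True by simp
next
  case False
  then have "N v > 0" using N[of v] by simp
  moreover have "N' (l v) / N v \<le> op_norm V N N' l"
    unfolding op_norm_def by (rule cSUP_upper[OF v op_norm_bdd[OF l N]])
  ultimately show ?thesis by (simp add: field_simps)
qed

lemma op_norm_le:
  assumes "V \<noteq> {}" "0 \<le> K" "\<And>v. 0 \<le> N v" "\<And>v. v \<in> V \<Longrightarrow> N' (l v) \<le> K * N v"
  shows "op_norm V N N' l \<le> K"
  unfolding op_norm_def
proof (rule cSUP_least[OF assms(1)])
  fix v assume v: "v \<in> V"
  show "N' (l v) / N v \<le> K"
  proof (cases "N v = 0")
    case False
    then have "N v > 0" using assms(3)[of v] by simp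
    then show ?thesis using assms(4)[OF v] by (simp add: field_simps)
  qed (use assms(2) in simp)
qed

lemma op_norm_nonneg:
  assumes "V \<noteq> {}" "bounded_linear_on V N N' l" "\<And>v. 0 \<le> N v" "\<And>w. 0 \<le> N' w"
  shows "0 \<le> op_norm V N N' l"
proof -
  obtain v where v: "v \<in> V" using assms(1) by blast
  show ?thesis unfolding op_norm_def
    by (rule cSUP_upper2[OF op_norm_bdd[OF assms(2,3)] v]) (simp add: assms)
qed

lemma dual_norm_bound:
  assumes "l \<in> dual V N" "v \<in> V" "\<And>v. 0 \<le> N v"
  shows "\<bar>l v\<bar> \<le> dual_norm V N l * N v"
  using op_norm_bound[of V N abs l v] assms by (simp add: dual_def dual_norm_def)

lemma dual_norm_le:
  assumes "V \<noteq> {}" "0 \<le> K" "\<And>v. 0 \<le> N v" "\<And>v. v \<in> V \<Longrightarrow> \<bar>l v\<bar> \<le> K * N v"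
  shows "dual_norm V N l \<le> K"
  unfolding dual_norm_def using assms by (intro op_norm_le)

lemma dual_norm_nonneg:
  assumes "V \<noteq> {}" "l \<in> dual V N" "\<And>v. 0 \<le> N v"
  shows "0 \<le> dual_norm V N l"
  unfolding dual_norm_def using assms by (intro op_norm_nonneg) (auto simp: dual_def)

lemma dual_antimono: "W \<subseteq> V \<Longrightarrow> l \<in> dual V N \<Longrightarrow> l \<in> dual W N"
  unfolding dual_def bounded_linear_on_def by blast

lemma dual_add_eq: "l \<in> dual V N \<Longrightarrow> u \<in> V \<Longrightarrow> v \<in> V \<Longrightarrow> l (u + v) = l u + l v"
  and dual_scaleR_eq: "l \<in> dual V N \<Longrightarrow> v \<in> V \<Longrightarrow> l (c *\<^sub>R v) = c * l v"
  by (auto simp: dual_def bounded_linear_on_def)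

lemma dual_diff_eq:
  assumes "l \<in> dual V N" "u \<in> V" "v \<in> V" "subspace V"
  shows "l (u - v) = l u - l v"
  using dual_add_eq[OF assms(1,2), of "- 1 *\<^sub>R v"] dual_scaleR_eq[OF assms(1,3), of "-1"]
    subspace_scale[OF assms(4,3), of "-1"] by simp

lemma dual_diff:
  assumes "l \<in> dual V N" "m \<in> dual V N"
  shows "(\<lambda>v. l v - m v) \<in> dual V N"
proof -
  obtain K L where "\<forall>v\<in>V. \<bar>l v\<bar> \<le> K * N v" "\<forall>v\<in>V. \<bar>m v\<bar> \<le> L * N v"
    using assms by (auto simp: dual_def bounded_linear_on_def)
  then have "\<bar>l v - m v\<bar> \<le> (K + L) * N v" if "v \<in> V" for v
    using that by (force simp: algebra_simps)
  then have "\<exists>K. \<forall>v\<in>V. \<bar>l v - m v\<bar> \<le> K * N v" by blast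
  with assms show ?thesis
    by (auto simp: dual_def bounded_linear_on_def right_diff_distrib)
qed

text \<open>
  The Bochner spaces are built over \<open>H10\<close>, a set of vectors, and over \<open>Hm1\<close>, a set of functionals
  whose underlying function type carries no vector space structure and on which the norm is
  meaningful only for bounded functionals.  The following properties of subtraction are all that
  the measure-theoretic arguments use, and they hold in both cases.
\<close>

locale subtraction_seminorm =
  fixes V :: "'v set" and sub :: "'v \<Rightarrow> 'v \<Rightarrow> 'v" and N :: "'v \<Rightarrow> real"
  assumes sub_closed: "u \<in> V \<Longrightarrow> v \<in> V \<Longrightarrow> sub u v \<in> V"
    and nonneg: "u \<in> V \<Longrightarrow> 0 \<le> N u"
    and self: "u \<in> V \<Longrightarrow> N (sub u u) = 0"
    and sub_le: "u \<in> V \<Longrightarrow> v \<in> V \<Longrightarrow> N (sub u v) \<le> N u + N v"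
    and reverse_le: "u \<in> V \<Longrightarrow> v \<in> V \<Longrightarrow> \<bar>N u - N v\<bar> \<le> N (sub u v)"
    and sub_sub_le: "u \<in> V \<Longrightarrow> v \<in> V \<Longrightarrow> u' \<in> V \<Longrightarrow> v' \<in> V \<Longrightarrow>
      N (sub (sub u v) (sub u' v')) \<le> N (sub u u') + N (sub v v')"

lemma subtraction_seminorm_dual:
  assumes V: "V \<noteq> {}" and N: "\<And>v. 0 \<le> N v"
  shows "subtraction_seminorm (dual V N) (\<lambda>l m v. l v - m v) (dual_norm V N)"
proof
  have bnd: "\<bar>l v\<bar> \<le> dual_norm V N l * N v" if "l \<in> dual V N" "v \<in> V" for l v
    using that N by (rule dual_norm_bound)
  have nn: "0 \<le> dual_norm V N l" if "l \<in> dual V N" for l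
    using V that N by (rule dual_norm_nonneg)
  have le: "dual_norm V N l \<le> K" if "0 \<le> K" "\<And>v. v \<in> V \<Longrightarrow> \<bar>l v\<bar> \<le> K * N v" for l K
    using V that(1) N that(2) by (rule dual_norm_le)
  show "(\<lambda>v. l v - m v) \<in> dual V N" if "l \<in> dual V N" "m \<in> dual V N" for l m
    using that by (rule dual_diff)
  show nonneg: "0 \<le> dual_norm V N l" if "l \<in> dual V N" for l
    using that by (rule nn)
  show "dual_norm V N (\<lambda>v. l v - l v) = 0" if "l \<in> dual V N" for l
    by (rule antisym[OF le nn[OF dual_diff[OF that that]]]) simp_all
  show "dual_norm V N (\<lambda>v. l v - m v) \<le> dual_norm V N l + dual_norm V N m"
    if "l \<in> dual V N" "m \<in> dual V N" for l m
  proof (rule le)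
    show "\<bar>l v - m v\<bar> \<le> (dual_norm V N l + dual_norm V N m) * N v" if "v \<in> V" for v
      using bnd[of l v] bnd[of m v] that \<open>l \<in> _\<close> \<open>m \<in> _\<close> by (simp add: algebra_simps)
  qed (use that nn in auto)
  have *: "dual_norm V N l \<le> dual_norm V N m + dual_norm V N (\<lambda>v. l v - m v)"
      "dual_norm V N m \<le> dual_norm V N l + dual_norm V N (\<lambda>v. l v - m v)"
    if "l \<in> dual V N" "m \<in> dual V N" for l m
  proof -
    have "\<bar>l v\<bar> \<le> (dual_norm V N m + dual_norm V N (\<lambda>v. l v - m v)) * N v"
      and "\<bar>m v\<bar> \<le> (dual_norm V N l + dual_norm V N (\<lambda>v. l v - m v)) * N v" if "v \<in> V" for v
      using bnd[of l v] bnd[of m v] bnd[of "\<lambda>v. l v - m v" v] that dual_diff[of l V N m] \<open>l \<in> _\<close> \<open>m \<in> _\<close>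
      by (auto simp: distrib_right)
    then show "dual_norm V N l \<le> dual_norm V N m + dual_norm V N (\<lambda>v. l v - m v)"
      "dual_norm V N m \<le> dual_norm V N l + dual_norm V N (\<lambda>v. l v - m v)"
      using nn that dual_diff[of l V N m] by (auto intro!: le add_nonneg_nonneg)
  qed
  show "\<bar>dual_norm V N l - dual_norm V N m\<bar> \<le> dual_norm V N (\<lambda>v. l v - m v)"
    if "l \<in> dual V N" "m \<in> dual V N" for l m
    using *[OF that] by linarith
  show "dual_norm V N (\<lambda>v. l v - m v - (l' v - m' v))
      \<le> dual_norm V N (\<lambda>v. l v - l' v) + dual_norm V N (\<lambda>v. m v - m' v)"
    if "l \<in> dual V N" "m \<in> dual V N" "l' \<in> dual V N" "m' \<in> dual V N" for l m l' m'
  proof (rule le)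
    show "\<bar>l v - m v - (l' v - m' v)\<bar>
      \<le> (dual_norm V N (\<lambda>v. l v - l' v) + dual_norm V N (\<lambda>v. m v - m' v)) * N v" if "v \<in> V" for v
      using bnd[OF dual_diff[of l V N l'] that] bnd[OF dual_diff[of m V N m'] that]
        \<open>l \<in> _\<close> \<open>m \<in> _\<close> \<open>l' \<in> _\<close> \<open>m' \<in> _\<close> unfolding distrib_right by linarith
  qed (intro add_nonneg_nonneg nn dual_diff that)
qed

section \<open>Strongly measurable functions of time\<close>

lemma AE_lebesgue_onI:
  assumes "AE x in lborel. P x" "S \<in> sets lebesgue"
  shows "AE x in lebesgue_on S. P x"
  using AE_completion[OF assms(1)] assms(2) by (auto simp: AE_restrict_space_iff elim: eventually_mono)

text \<open>
  Lebesgue measure is complete, so measurability does not depend on the values on a null set.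
\<close>

lemma borel_measurable_lebesgue_on_AE:
  fixes f g :: "real \<Rightarrow> real"
  assumes S: "S \<in> sets lebesgue" and f: "f \<in> borel_measurable (lebesgue_on S)"
    and ae: "AE x in lebesgue_on S. f x = g x"
  shows "g \<in> borel_measurable (lebesgue_on S)"
proof -
  have "(\<lambda>x. if x \<in> S then f x else 0) \<in> borel_measurable lebesgue"
    using f S by (simp add: borel_measurable_if)
  moreover have "AE x in lebesgue. (if x \<in> S then f x else 0) = (if x \<in> S then g x else 0)"
    using ae S by (auto simp: AE_restrict_space_iff elim: eventually_mono)
  ultimately have "(\<lambda>x. if x \<in> S then g x else 0) \<in> borel_measurable lebesgue"
    by (rule borel_measurable_AE)
  then show ?thesis using S by (simp add: borel_measurable_if)
qed

lemma borel_measurable_lebesgue_on_AE_LIMSEQ: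
  fixes f :: "nat \<Rightarrow> real \<Rightarrow> real"
  assumes S: "S \<in> sets lebesgue" and f: "\<And>n. f n \<in> borel_measurable (lebesgue_on S)"
    and ae: "AE x in lebesgue_on S. (\<lambda>n. f n x) \<longlonglongrightarrow> g x"
  shows "g \<in> borel_measurable (lebesgue_on S)"
proof (rule borel_measurable_lebesgue_on_AE[OF S])
  show "(\<lambda>x. lim (\<lambda>n. f n x)) \<in> borel_measurable (lebesgue_on S)"
    using f by measurable
  show "AE x in lebesgue_on S. lim (\<lambda>n. f n x) = g x"
    using ae by eventually_elim (rule limI)
qed

lemma bochner_sq_intE:
  assumes "bochner_sq_int I V sub N f"
  obtains s :: "nat \<Rightarrow> real \<Rightarrow> 'v" where "AE t in lebesgue_on I. f t \<in> V"
    "\<forall>n. simple_function (lebesgue_on I) (s n)" "\<forall>n. \<forall>t\<in>I. s n t \<in> V"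
    "AE t in lebesgue_on I. (\<lambda>n. N (sub (s n t) (f t))) \<longlonglongrightarrow> 0"
    "integrable (lebesgue_on I) (\<lambda>t. (N (f t))\<^sup>2)"
  using assms unfolding bochner_sq_int_def by blast

lemma AE_in_lebesgue_on: "AE t in lebesgue_on I. t \<in> I"
  by (rule AE_I2) simp

lemma bochner_sq_int_cong_AE:
  assumes f: "bochner_sq_int I V sub N f" and I: "I \<in> sets lebesgue"
    and eq: "AE t in lebesgue_on I. f t = g t"
  shows "bochner_sq_int I V sub N g"
proof -
  from f obtain s where s0: "AE t in lebesgue_on I. f t \<in> V"
    "\<forall>n. simple_function (lebesgue_on I) (s n)" "\<forall>n. \<forall>t\<in>I. s n t \<in> V"
    "AE t in lebesgue_on I. (\<lambda>n. N (sub (s n t) (f t))) \<longlonglongrightarrow> 0"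
    "integrable (lebesgue_on I) (\<lambda>t. (N (f t))\<^sup>2)"
    by (rule bochner_sq_intE)
  note s = s0[rule_format]
  have ae: "AE t in lebesgue_on I. (N (f t))\<^sup>2 = (N (g t))\<^sup>2"
    using eq by eventually_elim simp
  have "AE t in lebesgue_on I. g t \<in> V" using s(1) eq by eventually_elim simp
  moreover have "AE t in lebesgue_on I. (\<lambda>n. N (sub (s n t) (g t))) \<longlonglongrightarrow> 0"
    using s(4) eq by eventually_elim simp
  moreover have "integrable (lebesgue_on I) (\<lambda>t. (N (g t))\<^sup>2)"
    using integrable_cong_AE_imp[OF s(5) borel_measurable_lebesgue_on_AE[OF I _ ae]] s(5) ae
    by (auto elim: eventually_mono)
  ultimately show ?thesis using s(2,3) unfolding bochner_sq_int_def by blast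
qed

context subtraction_seminorm
begin

lemma bochner_sq_int_const:
  assumes "v \<in> V" "finite_measure (lebesgue_on I)"
  shows "bochner_sq_int I V sub N (\<lambda>t. v)"
  unfolding bochner_sq_int_def
  using assms by (auto intro!: exI[of _ "\<lambda>n t. v"] finite_measure.integrable_const simp: self)

lemma bochner_sq_int_diff:
  assumes f: "bochner_sq_int I V sub N f" and g: "bochner_sq_int I V sub N g" and I: "I \<in> sets lebesgue"
  shows "bochner_sq_int I V sub N (\<lambda>t. sub (f t) (g t))"
proof -
  from f obtain r where r0: "AE t in lebesgue_on I. f t \<in> V"
    "\<forall>n. simple_function (lebesgue_on I) (r n)" "\<forall>n. \<forall>t\<in>I. r n t \<in> V"
    "AE t in lebesgue_on I. (\<lambda>n. N (sub (r n t) (f t))) \<longlonglongrightarrow> 0"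
    "integrable (lebesgue_on I) (\<lambda>t. (N (f t))\<^sup>2)"
    by (rule bochner_sq_intE)
  note r = r0[rule_format]
  from g obtain s where s0: "AE t in lebesgue_on I. g t \<in> V"
    "\<forall>n. simple_function (lebesgue_on I) (s n)" "\<forall>n. \<forall>t\<in>I. s n t \<in> V"
    "AE t in lebesgue_on I. (\<lambda>n. N (sub (s n t) (g t))) \<longlonglongrightarrow> 0"
    "integrable (lebesgue_on I) (\<lambda>t. (N (g t))\<^sup>2)"
    by (rule bochner_sq_intE)
  note s = s0[rule_format]
  define q where "q n t = sub (r n t) (s n t)" for n t
  have q: "simple_function (lebesgue_on I) (q n)" "t \<in> I \<Longrightarrow> q n t \<in> V" for n t
    unfolding q_def[abs_def] using r(2,3) s(2,3)
    by (auto intro: simple_function_compose2 sub_closed)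
  have V: "AE t in lebesgue_on I. sub (f t) (g t) \<in> V"
    using r(1) s(1) by eventually_elim (rule sub_closed)
  have lim: "AE t in lebesgue_on I. (\<lambda>n. N (sub (q n t) (sub (f t) (g t)))) \<longlonglongrightarrow> 0"
    using r(1,4) s(1,4) AE_in_lebesgue_on
  proof eventually_elim
    case (elim t)
    have "(\<lambda>n. N (sub (r n t) (f t)) + N (sub (s n t) (g t))) \<longlonglongrightarrow> 0"
      using tendsto_add[OF elim(2,4)] by simp
    then show ?case
    proof (rule Lim_null_comparison[rotated])
      show "\<forall>\<^sub>F n in sequentially. norm (N (sub (q n t) (sub (f t) (g t))))
          \<le> N (sub (r n t) (f t)) + N (sub (s n t) (g t))"
        using elim r(3) s(3) by (auto simp: q_def sub_sub_le nonneg sub_closed)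
    qed
  qed
  have meas: "(\<lambda>t. N (sub (f t) (g t))) \<in> borel_measurable (lebesgue_on I)"
  proof (rule borel_measurable_lebesgue_on_AE_LIMSEQ[OF I])
    show "(\<lambda>t. N (q n t)) \<in> borel_measurable (lebesgue_on I)" for n
      by (intro borel_measurable_simple_function simple_function_compose1[OF q(1)])
    show "AE t in lebesgue_on I. (\<lambda>n. N (q n t)) \<longlonglongrightarrow> N (sub (f t) (g t))"
      using lim V AE_in_lebesgue_on
    proof eventually_elim
      case (elim t)
      have "(\<lambda>n. N (q n t) - N (sub (f t) (g t))) \<longlonglongrightarrow> 0"
        by (rule Lim_null_comparison[OF _ elim(1)]) (use elim q(2) in \<open>simp add: reverse_le\<close>)
      then show ?case by (rule LIM_zero_cancel)
    qed
  qed
  have "integrable (lebesgue_on I) (\<lambda>t. (N (sub (f t) (g t)))\<^sup>2)"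
  proof (rule Bochner_Integration.integrable_bound)
    show "integrable (lebesgue_on I) (\<lambda>t. 2 * (N (f t))\<^sup>2 + 2 * (N (g t))\<^sup>2)"
      using r(5) s(5) by simp
    show "AE t in lebesgue_on I. norm ((N (sub (f t) (g t)))\<^sup>2) \<le> norm (2 * (N (f t))\<^sup>2 + 2 * (N (g t))\<^sup>2)"
      using r(1) s(1)
    proof eventually_elim
      case (elim t)
      have "(N (sub (f t) (g t)))\<^sup>2 \<le> (N (f t) + N (g t))\<^sup>2"
        using elim by (intro power_mono sub_le nonneg sub_closed)
      also have "\<dots> \<le> 2 * (N (f t))\<^sup>2 + 2 * (N (g t))\<^sup>2"
        using sum_squares_bound[of "N (f t)" "N (g t)"] by (simp add: power2_sum)
      finally show ?case by simp
    qed
  qed (use meas in simp)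
  then show ?thesis
    unfolding bochner_sq_int_def using V lim q by blast
qed

end

lemma simple_function_count_space:
  "simple_function M s \<Longrightarrow> s \<in> measurable M (count_space (s ` space M))"
  by (subst measurable_count_space_eq2) (auto simp: simple_function_def)

text \<open>
  The pairing of simple functions with values \<open>\<theta>\<close> and \<open>\<zeta>\<close> is pieced together from the measurable
  functions \<open>\<lambda>t. b t \<theta> \<zeta>\<close>, and continuity of \<open>b t\<close> lets it converge to the pairing of \<open>f\<close> and \<open>g\<close>.
  The parameter \<open>s\<close> comes from Young's inequality \<open>x * y \<le> s * x\<^sup>2 + y\<^sup>2 / s\<close>; choosing \<open>s\<close> as the
  norm of \<open>g\<close> turns the bound into one that is linear in this norm.
\<close>

lemma bochner_pairing:
  fixes b :: "real \<Rightarrow> 'v \<Rightarrow> 'w \<Rightarrow> real"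
  assumes "subtraction_seminorm V sub N" "subtraction_seminorm V' sub' N'"
    and I: "I \<in> sets lebesgue"
    and f: "bochner_sq_int I V sub N f" and g: "bochner_sq_int I V' sub' N' g"
    and meas: "\<And>\<theta> \<zeta>. \<theta> \<in> V \<Longrightarrow> \<zeta> \<in> V' \<Longrightarrow> (\<lambda>t. b t \<theta> \<zeta>) \<in> borel_measurable (lebesgue_on I)"
    and bdd: "AE t in lebesgue_on I. \<forall>\<theta>\<in>V. \<forall>\<zeta>\<in>V'. \<bar>b t \<theta> \<zeta>\<bar> \<le> K * N \<theta> * N' \<zeta>"
    and diffl: "AE t in lebesgue_on I. \<forall>\<theta>\<in>V. \<forall>\<theta>'\<in>V. \<forall>\<zeta>\<in>V'. b t (sub \<theta> \<theta>') \<zeta> = b t \<theta> \<zeta> - b t \<theta>' \<zeta>"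
    and diffr: "AE t in lebesgue_on I. \<forall>\<theta>\<in>V. \<forall>\<zeta>\<in>V'. \<forall>\<zeta>'\<in>V'. b t \<theta> (sub' \<zeta> \<zeta>') = b t \<theta> \<zeta> - b t \<theta> \<zeta>'"
    and K: "K \<ge> 0"
  shows "integrable (lebesgue_on I) (\<lambda>t. b t (f t) (g t))"
    and "s > 0 \<Longrightarrow> \<bar>\<integral>t. b t (f t) (g t) \<partial>lebesgue_on I\<bar>
      \<le> K * (s * (\<integral>t. (N (f t))\<^sup>2 \<partial>lebesgue_on I) + (\<integral>t. (N' (g t))\<^sup>2 \<partial>lebesgue_on I) / s)"
proof -
  interpret V: subtraction_seminorm V sub N by fact
  interpret V': subtraction_seminorm V' sub' N' by fact
  from f obtain p where p0: "AE t in lebesgue_on I. f t \<in> V"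
    "\<forall>n. simple_function (lebesgue_on I) (p n)" "\<forall>n. \<forall>t\<in>I. p n t \<in> V"
    "AE t in lebesgue_on I. (\<lambda>n. N (sub (p n t) (f t))) \<longlonglongrightarrow> 0"
    "integrable (lebesgue_on I) (\<lambda>t. (N (f t))\<^sup>2)"
    by (rule bochner_sq_intE)
  note p = p0[rule_format]
  from g obtain q where q0: "AE t in lebesgue_on I. g t \<in> V'"
    "\<forall>n. simple_function (lebesgue_on I) (q n)" "\<forall>n. \<forall>t\<in>I. q n t \<in> V'"
    "AE t in lebesgue_on I. (\<lambda>n. N' (sub' (q n t) (g t))) \<longlonglongrightarrow> 0"
    "integrable (lebesgue_on I) (\<lambda>t. (N' (g t))\<^sup>2)"
    by (rule bochner_sq_intE)
  note q = q0[rule_format]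
  have meas_b: "(\<lambda>t. b t (f t) (g t)) \<in> borel_measurable (lebesgue_on I)"
  proof (rule borel_measurable_lebesgue_on_AE_LIMSEQ[OF I])
    show "(\<lambda>t. b t (p n t) (q n t)) \<in> borel_measurable (lebesgue_on I)" for n
    proof -
      have fin: "countable (p n ` I)" "countable (q n ` I)"
        using p(2)[of n] q(2)[of n] by (auto simp: simple_function_def countable_finite)
      have cs: "p n \<in> measurable (lebesgue_on I) (count_space (p n ` I))"
        "q n \<in> measurable (lebesgue_on I) (count_space (q n ` I))"
        using simple_function_count_space[OF p(2)[of n]] simple_function_count_space[OF q(2)[of n]] by auto
      have "(\<lambda>t. b t \<theta> (q n t)) \<in> borel_measurable (lebesgue_on I)" if "\<theta> \<in> p n ` I" for \<theta>
        by (rule measurable_compose_countable'[OF _ cs(2) fin(2)]) (use that p(3) q(3) in \<open>auto intro: meas\<close>)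
      then show ?thesis
        by (rule measurable_compose_countable'[OF _ cs(1) fin(1)])
    qed
    show "AE t in lebesgue_on I. (\<lambda>n. b t (p n t) (q n t)) \<longlonglongrightarrow> b t (f t) (g t)"
      using p(1,4) q(1,4) bdd diffl diffr AE_in_lebesgue_on
    proof eventually_elim
      case (elim t)
      let ?P = "\<lambda>n. N (sub (p n t) (f t))" and ?Q = "\<lambda>n. N' (sub' (q n t) (g t))"
      have "(\<lambda>n. K * ?P n * (N' (g t) + ?Q n) + K * N (f t) * ?Q n)
          \<longlonglongrightarrow> K * 0 * (N' (g t) + 0) + K * N (f t) * 0"
        using elim(2,4) by (intro tendsto_intros)
      then have lim: "(\<lambda>n. K * ?P n * (N' (g t) + ?Q n) + K * N (f t) * ?Q n) \<longlonglongrightarrow> 0" by simp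
      have "\<bar>b t (p n t) (q n t) - b t (f t) (g t)\<bar> \<le> K * ?P n * (N' (g t) + ?Q n) + K * N (f t) * ?Q n" for n
      proof -
        have pq: "p n t \<in> V" "q n t \<in> V'" using elim p(3) q(3) by auto
        have "\<bar>b t (p n t) (q n t) - b t (f t) (q n t)\<bar> \<le> K * ?P n * N' (q n t)"
          using elim pq by (metis V.sub_closed)
        also have "\<dots> \<le> K * ?P n * (N' (g t) + ?Q n)"
          using V'.reverse_le[OF pq(2) elim(3)] K V.nonneg[OF V.sub_closed[OF pq(1) elim(1)]]
          by (intro mult_left_mono) auto
        finally have "\<bar>b t (p n t) (q n t) - b t (f t) (q n t)\<bar> \<le> K * ?P n * (N' (g t) + ?Q n)" .
        moreover have "\<bar>b t (f t) (q n t) - b t (f t) (g t)\<bar> \<le> K * N (f t) * ?Q n"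
          using elim pq by (metis V'.sub_closed)
        ultimately show ?thesis by linarith
      qed
      then have "(\<lambda>n. b t (p n t) (q n t) - b t (f t) (g t)) \<longlonglongrightarrow> 0"
        by (intro Lim_null_comparison[OF _ lim] always_eventually allI) simp
      then show ?case by (rule LIM_zero_cancel)
    qed
  qed
  have ineq: "AE t in lebesgue_on I. \<bar>b t (f t) (g t)\<bar> \<le> K * (s * (N (f t))\<^sup>2 + (N' (g t))\<^sup>2 / s)"
    if "s > 0" for s
    using p(1) q(1) bdd
  proof eventually_elim
    case (elim t)
    have "\<bar>b t (f t) (g t)\<bar> \<le> K * (N (f t) * N' (g t))" using elim by (auto simp: mult.assoc)
    also have "\<dots> \<le> K * (s * (N (f t))\<^sup>2 + (N' (g t))\<^sup>2 / s)"
    proof (rule mult_left_mono[OF _ K])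
      have "0 \<le> (sqrt s * N (f t) - N' (g t) / sqrt s)\<^sup>2" by simp
      also have "\<dots> = s * (N (f t))\<^sup>2 + (N' (g t))\<^sup>2 / s - 2 * (N (f t) * N' (g t))"
        using that by (simp add: power2_diff power_mult_distrib power_divide)
      finally show "N (f t) * N' (g t) \<le> s * (N (f t))\<^sup>2 + (N' (g t))\<^sup>2 / s"
        using mult_nonneg_nonneg[OF V.nonneg[OF elim(1)] V'.nonneg[OF elim(2)]] by linarith
    qed
    finally show ?case .
  qed
  show int: "integrable (lebesgue_on I) (\<lambda>t. b t (f t) (g t))"
  proof (rule Bochner_Integration.integrable_bound[OF _ meas_b])
    show "integrable (lebesgue_on I) (\<lambda>t. K * (1 * (N (f t))\<^sup>2 + (N' (g t))\<^sup>2 / 1))"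
      using p(5) q(5) by auto
    show "AE t in lebesgue_on I. norm (b t (f t) (g t)) \<le> norm (K * (1 * (N (f t))\<^sup>2 + (N' (g t))\<^sup>2 / 1))"
      using ineq[of 1] K by (auto elim!: eventually_mono simp: abs_mult)
  qed
  assume s: "s > 0"
  have "\<bar>\<integral>t. b t (f t) (g t) \<partial>lebesgue_on I\<bar> \<le> (\<integral>t. \<bar>b t (f t) (g t)\<bar> \<partial>lebesgue_on I)"
    by (rule integral_abs_bound)
  also have "\<dots> \<le> (\<integral>t. K * (s * (N (f t))\<^sup>2 + (N' (g t))\<^sup>2 / s) \<partial>lebesgue_on I)"
    using int p(5) q(5) ineq[OF s] by (intro integral_mono_AE) auto
  also have "\<dots> = K * (s * (\<integral>t. (N (f t))\<^sup>2 \<partial>lebesgue_on I) + (\<integral>t. (N' (g t))\<^sup>2 \<partial>lebesgue_on I) / s)"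
    using p(5) q(5) by simp
  finally show "\<bar>\<integral>t. b t (f t) (g t) \<partial>lebesgue_on I\<bar>
      \<le> K * (s * (\<integral>t. (N (f t))\<^sup>2 \<partial>lebesgue_on I) + (\<integral>t. (N' (g t))\<^sup>2 \<partial>lebesgue_on I) / s)" .
qed

section \<open>Time slices\<close>

lemma sq_int_slice: "AE t in lborel. sq_int (\<lambda>x. rep_lsq u (t, x))"
  for u :: "(real \<times> 'a::euclidean_space) lsq"
proof -
  have sq: "rep_lsq u \<in> borel_measurable borel" "integrable lborel (\<lambda>z. (rep_lsq u z)\<^sup>2)"
    using sq_int_rep[of u] by (auto simp: sq_int_def)
  have "integrable (lborel \<Otimes>\<^sub>M lborel) (\<lambda>z. (rep_lsq u z)\<^sup>2)"
    using sq(2) by (simp add: lborel_prod)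
  then have "AE t in lborel. integrable lborel (\<lambda>x. (rep_lsq u (t, x))\<^sup>2)"
    by (rule lborel_pair.AE_integrable_fst')
  moreover have "(\<lambda>x. rep_lsq u (t, x)) \<in> borel_measurable borel" for t
    using sq(1) by measurable
  ultimately show ?thesis by (simp add: sq_int_def)
qed

lemma slice_eqI:
  assumes "sq_int f" "sq_int (\<lambda>x. rep_lsq u (t, x))" "AE x in lborel. rep_lsq u (t, x) = f x"
  shows "slice u t = abs_lsq f"
  using assms by (simp add: slice_def abs_lsq_eq)

text \<open>
  The representative of a linear combination agrees with the linear combination of representatives
  almost everywhere in space-time, hence by Fubini almost everywhere in space for almost every time.
\<close>

lemma slice_lincomb:
  fixes u v :: "(real \<times> 'a::euclidean_space) lsq"
  shows "AE t in lborel. slice (c *\<^sub>R u + d *\<^sub>R v) t = c *\<^sub>R slice u t + d *\<^sub>R slice v t"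
proof -
  let ?w = "c *\<^sub>R u + d *\<^sub>R v" and ?f = "\<lambda>z. c * rep_lsq u z + d * rep_lsq v z"
  have sq: "sq_int (\<lambda>z. c * rep_lsq u z)" "sq_int (\<lambda>z. d * rep_lsq v z)"
    by (auto intro: sq_int_scale sq_int_rep)
  have "?w = abs_lsq ?f"
    using sq by (simp add: abs_lsq_add abs_lsq_scaleR sq_int_rep abs_rep_lsq)
  then have "AE z in lborel. rep_lsq ?w z = ?f z"
    using rep_abs_lsq[OF sq_int_add[OF sq]] by simp
  then have "AE z in lborel \<Otimes>\<^sub>M lborel. rep_lsq ?w z = ?f z" unfolding lborel_prod .
  then have "AE t in lborel. AE x in lborel. rep_lsq ?w (t, x) = ?f (t, x)"
    by (rule lborel_pair.AE_pair)
  with sq_int_slice[of u] sq_int_slice[of v] sq_int_slice[of ?w] show ?thesis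
  proof eventually_elim
    case (elim t)
    note sq = sq_int_scale[OF elim(1), of c] sq_int_scale[OF elim(2), of d]
    have "slice ?w t = abs_lsq (\<lambda>x. ?f (t, x))"
      using sq elim by (intro slice_eqI) (auto intro: sq_int_add)
    also have "\<dots> = c *\<^sub>R slice u t + d *\<^sub>R slice v t"
      using sq elim by (simp add: abs_lsq_add abs_lsq_scaleR slice_def)
    finally show ?case .
  qed
qed

lemma slice_diff: "AE t in lborel. slice (u - v) t = slice u t - slice v t"
  using slice_lincomb[of 1 u "-1" v] by simp

section \<open>Weak time derivatives\<close>

lemma deriv_eq_partial_deriv:
  assumes "Ck (Suc 0) (\<phi> :: real \<Rightarrow> real)"
  shows "deriv \<phi> t = partial_deriv 1 \<phi> t"
proof -
  have d: "(\<phi> has_derivative (\<lambda>h. partial_deriv h \<phi> t)) (at t)"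
    using Ck_has_derivative[OF assms] .
  have "partial_deriv (h *\<^sub>R 1) \<phi> t = h *\<^sub>R partial_deriv 1 \<phi> t" for h
    by (rule linear_scale[OF bounded_linear.linear[OF has_derivative_bounded_linear[OF d]]])
  then have "(\<lambda>h. partial_deriv h \<phi> t) = (*) (partial_deriv 1 \<phi> t)"
    by (intro ext) (metis mult.commute mult.right_neutral real_scaleR_def)
  then show ?thesis
    using d by (intro DERIV_imp_deriv) (simp add: has_field_derivative_def)
qed

lemma borel_measurable_lebesgue_onI: "f \<in> borel_measurable borel \<Longrightarrow> f \<in> borel_measurable (lebesgue_on S)"
  by (intro measurable_restrict_space1 measurable_completion) simp

lemma finite_measure_lebesgue_on_interval: "finite_measure (lebesgue_on {\<alpha>..\<beta>::real})"
  by (rule finite_measure_lebesgue_on) simp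

context bounded_open
begin

lemma H1_norm_diff_le:
  assumes "u \<in> H1 \<Omega>" "v \<in> H1 \<Omega>"
  shows "H1_norm \<Omega> (u - v) \<le> H1_norm \<Omega> u + H1_norm \<Omega> v"
  using H1_norm_triangle[of u "-1 *\<^sub>R v"] H1_norm_scaleR[OF assms(2), of "-1"]
    subspace_scale[OF subspace_H1 assms(2), of "-1"] assms by simp

lemma subtraction_seminorm_H10: "subtraction_seminorm (H10 \<Omega>) (-) (H1_norm \<Omega>)"
proof
  note diff = subspace_diff[OF subspace_H1] and H1 = subsetD[OF H10_subset_H1]
  show "u - v \<in> H10 \<Omega>" if "u \<in> H10 \<Omega>" "v \<in> H10 \<Omega>" for u v
    using that by (rule subspace_diff[OF subspace_H10])
  show "0 \<le> H1_norm \<Omega> u" for u by (rule H1_norm_nonneg)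
  show "H1_norm \<Omega> (u - u) = 0" for u
    using H1_norm_scaleR[OF subspace_0[OF subspace_H1], of 0] by simp
  show "H1_norm \<Omega> (u - v) \<le> H1_norm \<Omega> u + H1_norm \<Omega> v" if "u \<in> H10 \<Omega>" "v \<in> H10 \<Omega>" for u v
    using that by (intro H1_norm_diff_le H1)
  show "\<bar>H1_norm \<Omega> u - H1_norm \<Omega> v\<bar> \<le> H1_norm \<Omega> (u - v)" if "u \<in> H10 \<Omega>" "v \<in> H10 \<Omega>" for u v
    using H1_norm_triangle[of "u - v" v] H1_norm_diff_le[of u "u - v"] diff[of u v] H1[OF that(1)] H1[OF that(2)]
    by simp
  show "H1_norm \<Omega> (u - v - (u' - v')) \<le> H1_norm \<Omega> (u - u') + H1_norm \<Omega> (v - v')"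
    if "u \<in> H10 \<Omega>" "v \<in> H10 \<Omega>" "u' \<in> H10 \<Omega>" "v' \<in> H10 \<Omega>" for u v u' v'
    using H1_norm_diff_le[of "u - u'" "v - v'"] that H1 diff by (simp add: algebra_simps)
qed

lemma H10_nonempty: "H10 \<Omega> \<noteq> {}"
  using subspace_0[OF subspace_H10] by blast

lemma subtraction_seminorm_Hm1:
  "subtraction_seminorm (Hm1 \<Omega>) (\<lambda>l m u. l u - m u) (Hm1_norm \<Omega>)"
  unfolding Hm1_def Hm1_norm_def
  using H10_nonempty H1_norm_nonneg by (rule subtraction_seminorm_dual)

lemma Hm1_bound:
  assumes "l \<in> Hm1 \<Omega>" "u \<in> H10 \<Omega>"
  shows "\<bar>l u\<bar> \<le> Hm1_norm \<Omega> l * H1_norm \<Omega> u"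
  using assms H1_norm_nonneg unfolding Hm1_def Hm1_norm_def by (rule dual_norm_bound)

lemma Hm1_diff:
  assumes "l \<in> Hm1 \<Omega>" "u \<in> H10 \<Omega>" "v \<in> H10 \<Omega>"
  shows "l (u - v) = l u - l v"
  using dual_diff_eq[OF assms[unfolded Hm1_def] subspace_H10] .

abbreviation sq_int_H10 :: "real set \<Rightarrow> (real \<Rightarrow> 'a lsq) \<Rightarrow> bool" where
  "sq_int_H10 I f \<equiv> bochner_sq_int I (H10 \<Omega>) (-) (H1_norm \<Omega>) f"

abbreviation sq_int_Hm1 :: "real set \<Rightarrow> (real \<Rightarrow> 'a lsq \<Rightarrow> real) \<Rightarrow> bool" where
  "sq_int_Hm1 I f \<equiv> bochner_sq_int I (Hm1 \<Omega>) (\<lambda>l m u. l u - m u) (Hm1_norm \<Omega>) f"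

lemma sq_int_H10_const: "\<zeta> \<in> H10 \<Omega> \<Longrightarrow> sq_int_H10 {\<alpha>..\<beta>} (\<lambda>t. \<zeta>)"
  using subtraction_seminorm.bochner_sq_int_const[OF subtraction_seminorm_H10]
    finite_measure_lebesgue_on_interval by blast

lemma Hm1_pairing:
  assumes f: "sq_int_Hm1 I f" and g: "sq_int_H10 I g" and I: "I \<in> sets lebesgue"
    and c: "c \<in> borel_measurable borel" "\<And>t. \<bar>c t\<bar> \<le> K"
  shows "integrable (lebesgue_on I) (\<lambda>t. c t * f t (g t))"
    and "s > 0 \<Longrightarrow> \<bar>\<integral>t. c t * f t (g t) \<partial>lebesgue_on I\<bar> \<le>
      K * (s * (\<integral>t. (Hm1_norm \<Omega> (f t))\<^sup>2 \<partial>lebesgue_on I) + (\<integral>t. (H1_norm \<Omega> (g t))\<^sup>2 \<partial>lebesgue_on I) / s)"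
proof -
  have K: "0 \<le> K" using c(2)[of 0] by linarith
  have bnd: "\<bar>c t * l u\<bar> \<le> K * Hm1_norm \<Omega> l * H1_norm \<Omega> u" if "l \<in> Hm1 \<Omega>" "u \<in> H10 \<Omega>" for t l u
    using mult_mono[OF c(2)[of t] Hm1_bound[OF that] K] by (simp add: abs_mult mult.assoc)
  note pairing = bochner_pairing[OF subtraction_seminorm_Hm1 subtraction_seminorm_H10 I f g,
      where b = "\<lambda>t l u. c t * l u" and K = K]
  show "integrable (lebesgue_on I) (\<lambda>t. c t * f t (g t))"
    by (rule pairing)
       (auto intro!: AE_I2 bnd K borel_measurable_times borel_measurable_lebesgue_onI c(1)
         simp: right_diff_distrib Hm1_diff)
  show "\<bar>\<integral>t. c t * f t (g t) \<partial>lebesgue_on I\<bar> \<le>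
      K * (s * (\<integral>t. (Hm1_norm \<Omega> (f t))\<^sup>2 \<partial>lebesgue_on I) + (\<integral>t. (H1_norm \<Omega> (g t))\<^sup>2 \<partial>lebesgue_on I) / s)"
    if "s > 0"
    by (rule pairing)
       (auto intro!: AE_I2 bnd K borel_measurable_times borel_measurable_lebesgue_onI c(1) that
         simp: right_diff_distrib Hm1_diff)
qed

lemma L2_pairing:
  assumes f: "sq_int_H10 I f" and g: "sq_int_H10 I g" and I: "I \<in> sets lebesgue"
    and c: "c \<in> borel_measurable borel" "\<And>t. \<bar>c t\<bar> \<le> K"
  shows "integrable (lebesgue_on I) (\<lambda>t. c t * inner (f t) (g t))"
proof -
  have K: "0 \<le> K" using c(2)[of 0] by linarith
  have "\<bar>inner u v\<bar> \<le> H1_norm \<Omega> u * H1_norm \<Omega> v" for u v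
    using Cauchy_Schwarz_ineq2[of u v] mult_mono[OF norm_le_H1_norm norm_le_H1_norm H1_norm_nonneg]
    by (meson norm_ge_zero order_trans)
  then have bnd: "\<bar>c t * inner u v\<bar> \<le> K * H1_norm \<Omega> u * H1_norm \<Omega> v" for t u v
    using mult_mono[OF c(2)[of t] _ K] by (simp add: abs_mult mult.assoc)
  show ?thesis
    by (rule bochner_pairing[OF subtraction_seminorm_H10 subtraction_seminorm_H10 I f g,
      where b = "\<lambda>t u v. c t * inner u v" and K = K])
       (auto intro!: AE_I2 bnd K borel_measurable_times borel_measurable_lebesgue_onI c(1)
         simp: right_diff_distrib inner_diff_left inner_diff_right)
qed

text \<open>
  The fundamental lemma is about Borel functions on the whole line.  It is applied to a Borel version
  of the difference, extended by zero; the end points of the interval form a null set.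
\<close>

lemma weak_time_deriv_unique_const:
  assumes \<psi>: "weak_time_deriv {\<alpha>..\<beta>} \<Omega> w \<psi>" and \<psi>': "weak_time_deriv {\<alpha>..\<beta>} \<Omega> w \<psi>'"
    and \<zeta>: "\<zeta> \<in> H10 \<Omega>"
  shows "AE t in lebesgue_on {\<alpha>..\<beta>}. \<psi> t \<zeta> = \<psi>' t \<zeta>"
proof -
  let ?I = "{\<alpha>..\<beta>}"
  define f where "f t = \<psi> t \<zeta> - \<psi>' t \<zeta>" for t
  have \<psi>H: "sq_int_Hm1 ?I \<psi>" "sq_int_Hm1 ?I \<psi>'"
    using \<psi> \<psi>' by (auto simp: weak_time_deriv_def)
  note pair = Hm1_pairing(1)[OF _ sq_int_H10_const[OF \<zeta>]]
  have f: "integrable (lebesgue_on ?I) f"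
    unfolding f_def using pair[OF \<psi>H(1), of "\<lambda>t. 1" 1] pair[OF \<psi>H(2), of "\<lambda>t. 1" 1] by simp
  let ?F = "\<lambda>t. if t \<in> ?I then f t else 0"
  have F: "integrable lebesgue ?F" using f by (subst Lebesgue_Measure.integrable_restrict_UNIV) auto
  then obtain h where h: "h \<in> borel_measurable lborel" "AE t in lborel. ?F t = h t"
    using completion_ex_borel_measurable_real[of ?F lborel] by auto
  have Fh: "AE t in lebesgue. ?F t = h t" using AE_completion[OF h(2)] .
  have hm: "h \<in> borel_measurable lebesgue" using h(1) by (rule measurable_completion)
  have "integrable lebesgue h"
    using integrable_cong_AE_imp[OF F hm] Fh by (auto elim: eventually_mono)
  then have h_int: "integrable lborel h" using h(1) by (simp add: integrable_completion)
  have "AE t in lborel. t \<in> {\<alpha><..<\<beta>} \<longrightarrow> h t = 0"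
  proof (rule fundamental_lemma_calculus_of_variations[OF _ h_int])
    fix \<phi> assume \<phi>: "\<phi> \<in> test_fun {\<alpha><..<\<beta>}"
    obtain K where K: "\<And>t. \<bar>\<phi> t\<bar> \<le> K" using test_fun_bounded[OF \<phi>] by blast
    have \<phi>m: "\<phi> \<in> borel_measurable borel"
      using test_funD(4)[OF \<phi>] by (rule borel_measurable_continuous_onI)
    then have \<phi>l: "\<phi> \<in> borel_measurable lebesgue" by (intro measurable_completion) simp
    have "(\<integral>t. h t * \<phi> t \<partial>lborel) = (\<integral>t. h t * \<phi> t \<partial>lebesgue)"
      using h(1) \<phi>m by (intro integral_completion[symmetric]) auto
    also have "\<dots> = (\<integral>t. (if t \<in> ?I then f t * \<phi> t else 0) \<partial>lebesgue)"
    proof (rule integral_cong_AE)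
      show "(\<lambda>t. if t \<in> ?I then f t * \<phi> t else 0) \<in> borel_measurable lebesgue"
        using borel_measurable_times[OF borel_measurable_integrable[OF F] \<phi>l]
        by (rule measurable_cong[THEN iffD1, rotated]) auto
      show "AE t in lebesgue. h t * \<phi> t = (if t \<in> ?I then f t * \<phi> t else 0)"
        using Fh by eventually_elim auto
    qed (use hm \<phi>l in simp)
    also have "\<dots> = (\<integral>t. f t * \<phi> t \<partial>lebesgue_on ?I)"
      by (rule Lebesgue_Measure.integral_restrict_UNIV) simp
    also have "\<dots> = (\<integral>t. \<phi> t * \<psi> t \<zeta> - \<phi> t * \<psi>' t \<zeta> \<partial>lebesgue_on ?I)"
      by (simp add: f_def algebra_simps)
    also have "\<dots> = (\<integral>t. \<phi> t * \<psi> t \<zeta> \<partial>lebesgue_on ?I) - (\<integral>t. \<phi> t * \<psi>' t \<zeta> \<partial>lebesgue_on ?I)"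
      by (intro Bochner_Integration.integral_diff pair[OF \<psi>H(1) _ \<phi>m K] pair[OF \<psi>H(2) _ \<phi>m K]) auto
    also have "\<dots> = 0"
      using \<psi> \<psi>' \<phi> \<zeta> unfolding weak_time_deriv_def interior_atLeastAtMost_real by force
    finally show "(\<integral>t. h t * \<phi> t \<partial>lborel) = 0" .
  qed simp
  with h(2) AE_lborel_singleton[of \<alpha>] AE_lborel_singleton[of \<beta>]
  have "AE t in lborel. t \<in> ?I \<longrightarrow> \<psi> t \<zeta> = \<psi>' t \<zeta>"
    by eventually_elim (auto simp: f_def)
  then have "AE t in lebesgue_on ?I. t \<in> ?I \<longrightarrow> \<psi> t \<zeta> = \<psi>' t \<zeta>"
    by (rule AE_lebesgue_onI) simp
  with AE_in_lebesgue_on[of ?I] show ?thesis by eventually_elim simp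
qed

text \<open>
  The null set outside which the two derivatives agree at \<open>\<zeta>\<close> depends on \<open>\<zeta>\<close>.  The simple functions
  \<open>s n\<close> approximating \<open>g\<close> have only countably many values, so that a single null set suffices for all
  of them, and outside it the derivatives agree at \<open>g t\<close> by continuity.
\<close>

lemma weak_time_deriv_unique:
  assumes \<psi>: "weak_time_deriv {\<alpha>..\<beta>} \<Omega> w \<psi>" and \<psi>': "weak_time_deriv {\<alpha>..\<beta>} \<Omega> w \<psi>'"
    and g: "sq_int_H10 {\<alpha>..\<beta>} g"
  shows "AE t in lebesgue_on {\<alpha>..\<beta>}. \<psi> t (g t) = \<psi>' t (g t)"
proof -
  let ?I = "{\<alpha>..\<beta>}"
  from g obtain s where s0: "AE t in lebesgue_on ?I. g t \<in> H10 \<Omega>"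
    "\<forall>n. simple_function (lebesgue_on ?I) (s n)" "\<forall>n. \<forall>t\<in>?I. s n t \<in> H10 \<Omega>"
    "AE t in lebesgue_on ?I. (\<lambda>n. H1_norm \<Omega> (s n t - g t)) \<longlonglongrightarrow> 0"
    "integrable (lebesgue_on ?I) (\<lambda>t. (H1_norm \<Omega> (g t))\<^sup>2)"
    by (rule bochner_sq_intE)
  note s = s0[rule_format]
  let ?S = "\<Union>n. s n ` ?I"
  have "finite (s n ` ?I)" for n using s(2)[of n] by (simp add: simple_function_def)
  then have "countable ?S" by (intro countable_UN) (auto intro: countable_finite)
  moreover have "AE t in lebesgue_on ?I. \<psi> t \<zeta> = \<psi>' t \<zeta>" if "\<zeta> \<in> ?S" for \<zeta>
    using that s(3) by (intro weak_time_deriv_unique_const[OF \<psi> \<psi>']) auto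
  ultimately have "AE t in lebesgue_on ?I. \<forall>\<zeta>\<in>?S. \<psi> t \<zeta> = \<psi>' t \<zeta>"
    by (subst AE_ball_countable) auto
  moreover have "AE t in lebesgue_on ?I. \<psi> t \<in> Hm1 \<Omega>" "AE t in lebesgue_on ?I. \<psi>' t \<in> Hm1 \<Omega>"
    using \<psi> \<psi>' by (auto simp: weak_time_deriv_def bochner_sq_int_def)
  ultimately show ?thesis
    using s(1,4) AE_in_lebesgue_on[of ?I]
  proof eventually_elim
    case (elim t)
    have lim: "(\<lambda>n. l (s n t)) \<longlonglongrightarrow> l (g t)" if l: "l \<in> Hm1 \<Omega>" for l
    proof (rule LIM_zero_cancel, rule Lim_null_comparison)
      show "\<forall>\<^sub>F n in sequentially. norm (l (s n t) - l (g t)) \<le> Hm1_norm \<Omega> l * H1_norm \<Omega> (s n t - g t)"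
      proof (intro always_eventually allI)
        fix n
        have "s n t \<in> H10 \<Omega>" using s(3) elim by blast
        then show "norm (l (s n t) - l (g t)) \<le> Hm1_norm \<Omega> l * H1_norm \<Omega> (s n t - g t)"
          using Hm1_bound[OF l, of "s n t - g t"] Hm1_diff[OF l, of "s n t" "g t"] elim(4)
            subspace_diff[OF subspace_H10] by simp
      qed
      show "(\<lambda>n. Hm1_norm \<Omega> l * H1_norm \<Omega> (s n t - g t)) \<longlonglongrightarrow> 0"
        using tendsto_mult_right_zero[OF elim(5)] .
    qed
    have "\<psi> t (s n t) = \<psi>' t (s n t)" for n using elim(1,6) by blast
    then have "(\<lambda>n. \<psi> t (s n t)) \<longlonglongrightarrow> \<psi>' t (g t)" using lim[OF elim(3)] by simp
    with lim[OF elim(2)] show ?case by (rule LIMSEQ_unique)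
  qed
qed

lemma weak_time_deriv_diff:
  assumes u: "sq_int_H10 {\<alpha>..\<beta>} (slice u)" and w: "sq_int_H10 {\<alpha>..\<beta>} (slice w)"
    and \<psi>: "weak_time_deriv {\<alpha>..\<beta>} \<Omega> u \<psi>" and \<xi>: "weak_time_deriv {\<alpha>..\<beta>} \<Omega> w \<xi>"
  shows "weak_time_deriv {\<alpha>..\<beta>} \<Omega> (u - w) (\<lambda>t \<zeta>. \<psi> t \<zeta> - \<xi> t \<zeta>)"
  unfolding weak_time_deriv_def
proof (intro conjI ballI)
  let ?I = "{\<alpha>..\<beta>}"
  have H: "sq_int_Hm1 ?I \<psi>" "sq_int_Hm1 ?I \<xi>"
    using \<psi> \<xi> by (auto simp: weak_time_deriv_def)
  show "sq_int_Hm1 ?I (\<lambda>t \<zeta>. \<psi> t \<zeta> - \<xi> t \<zeta>)"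
    using subtraction_seminorm.bochner_sq_int_diff[OF subtraction_seminorm_Hm1 H] by simp
  fix \<phi> \<zeta> assume \<phi>: "\<phi> \<in> test_fun (interior ?I)" and \<zeta>: "\<zeta> \<in> H10 \<Omega>"
  obtain K where K: "\<And>t. \<bar>\<phi> t\<bar> \<le> K" using test_fun_bounded[OF \<phi>] by blast
  have \<phi>m: "\<phi> \<in> borel_measurable borel"
    using test_funD(4)[OF \<phi>] by (rule borel_measurable_continuous_onI)
  have d: "deriv \<phi> \<in> test_fun (interior ?I)"
  proof -
    have "deriv \<phi> = partial_deriv 1 \<phi>"
      by (rule ext) (rule deriv_eq_partial_deriv[OF test_funD(1)[OF \<phi>]])
    then show ?thesis using test_fun_partial_deriv[OF \<phi>, of 1] by simp
  qed
  obtain L where L: "\<And>t. \<bar>deriv \<phi> t\<bar> \<le> L" using test_fun_bounded[OF d] by blast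
  have dm: "deriv \<phi> \<in> borel_measurable borel"
    using test_funD(4)[OF d] by (rule borel_measurable_continuous_onI)
  note ip = L2_pairing[OF _ sq_int_H10_const[OF \<zeta>] _ dm L]
    and pair = Hm1_pairing(1)[OF _ sq_int_H10_const[OF \<zeta>] _ \<phi>m K]
  have AE: "AE t in lebesgue_on ?I. slice (u - w) t = slice u t - slice w t"
    by (rule AE_lebesgue_onI[OF slice_diff]) simp
  have ig: "integrable (lebesgue_on ?I) (\<lambda>t. deriv \<phi> t * inner (slice u t) \<zeta> - deriv \<phi> t * inner (slice w t) \<zeta>)"
    by (intro Bochner_Integration.integrable_diff ip u w) auto
  have eq: "AE t in lebesgue_on ?I. deriv \<phi> t * inner (slice u t) \<zeta> - deriv \<phi> t * inner (slice w t) \<zeta>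
      = deriv \<phi> t * inner (slice (u - w) t) \<zeta>"
    using AE by eventually_elim (simp add: inner_diff_left right_diff_distrib)
  have "(\<integral>t. deriv \<phi> t * inner (slice (u - w) t) \<zeta> \<partial>lebesgue_on ?I) =
    (\<integral>t. deriv \<phi> t * inner (slice u t) \<zeta> - deriv \<phi> t * inner (slice w t) \<zeta> \<partial>lebesgue_on ?I)"
    using borel_measurable_lebesgue_on_AE[OF _ borel_measurable_integrable[OF ig] eq]
      borel_measurable_integrable[OF ig] eq
    by (intro integral_cong_AE) (auto elim: eventually_mono)
  also have "\<dots> = (\<integral>t. deriv \<phi> t * inner (slice u t) \<zeta> \<partial>lebesgue_on ?I)
      - (\<integral>t. deriv \<phi> t * inner (slice w t) \<zeta> \<partial>lebesgue_on ?I)"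
    by (intro Bochner_Integration.integral_diff ip u w) auto
  also have "\<dots> = - ((\<integral>t. \<phi> t * \<psi> t \<zeta> \<partial>lebesgue_on ?I) - (\<integral>t. \<phi> t * \<xi> t \<zeta> \<partial>lebesgue_on ?I))"
    using \<psi> \<xi> \<phi> \<zeta> by (simp add: weak_time_deriv_def)
  also have "\<dots> = - (\<integral>t. \<phi> t * \<psi> t \<zeta> - \<phi> t * \<xi> t \<zeta> \<partial>lebesgue_on ?I)"
    by (subst Bochner_Integration.integral_diff) (auto intro: pair H)
  finally show "(\<integral>t. deriv \<phi> t * inner (slice (u - w) t) \<zeta> \<partial>lebesgue_on ?I) =
    - (\<integral>t. \<phi> t * (\<psi> t \<zeta> - \<xi> t \<zeta>) \<partial>lebesgue_on ?I)"
    by (simp add: right_diff_distrib)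
qed

section \<open>The spaces X and Y\<close>

lemma Y_sq_int_H10: "v \<in> Y_space I \<Omega> \<Longrightarrow> sq_int_H10 I (slice v)"
  by (simp add: Y_space_def)

lemma X_subset_Y: "X_space I \<Omega> \<subseteq> Y_space I \<Omega>"
  by (auto simp: X_space_def)

lemma Y_diff:
  assumes "u \<in> Y_space {\<alpha>..\<beta>} \<Omega>" "v \<in> Y_space {\<alpha>..\<beta>} \<Omega>"
  shows "u - v \<in> Y_space {\<alpha>..\<beta>} \<Omega>"
proof -
  have eq: "AE t in lebesgue_on {\<alpha>..\<beta>}. slice u t - slice v t = slice (u - v) t"
    using AE_lebesgue_onI[OF slice_diff[of u v], of "{\<alpha>..\<beta>}"] by (simp add: eq_commute)
  have "sq_int_H10 {\<alpha>..\<beta>} (\<lambda>t. slice u t - slice v t)"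
    using assms by (intro subtraction_seminorm.bochner_sq_int_diff[OF subtraction_seminorm_H10] Y_sq_int_H10) auto
  from bochner_sq_int_cong_AE[OF this _ eq] have "sq_int_H10 {\<alpha>..\<beta>} (slice (u - v))" by simp
  then show ?thesis
    using assms by (auto simp: Y_space_def subspace_diff[OF subspace_L2])
qed

lemma weak_time_deriv_ddt: "w \<in> X_space I \<Omega> \<Longrightarrow> weak_time_deriv I \<Omega> w (ddt I \<Omega> w)"
  using someI_ex[of "weak_time_deriv I \<Omega> w"] by (simp add: X_space_def ddt_def)

lemma X_diff:
  assumes u: "u \<in> X_space {\<alpha>..\<beta>} \<Omega>" and w: "w \<in> X_space {\<alpha>..\<beta>} \<Omega>"
  shows "u - w \<in> X_space {\<alpha>..\<beta>} \<Omega>"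
proof -
  have Y: "u \<in> Y_space {\<alpha>..\<beta>} \<Omega>" "w \<in> Y_space {\<alpha>..\<beta>} \<Omega>"
    using u w X_subset_Y by blast+
  from weak_time_deriv_diff[OF Y_sq_int_H10[OF Y(1)] Y_sq_int_H10[OF Y(2)]
      weak_time_deriv_ddt[OF u] weak_time_deriv_ddt[OF w]] Y_diff[OF Y]
  show ?thesis unfolding X_space_def by blast
qed

lemma ddt_diff:
  assumes u: "u \<in> X_space {\<alpha>..\<beta>} \<Omega>" and w: "w \<in> X_space {\<alpha>..\<beta>} \<Omega>"
    and v: "sq_int_H10 {\<alpha>..\<beta>} v"
  shows "AE t in lebesgue_on {\<alpha>..\<beta>}.
    ddt {\<alpha>..\<beta>} \<Omega> (u - w) t (v t) = ddt {\<alpha>..\<beta>} \<Omega> u t (v t) - ddt {\<alpha>..\<beta>} \<Omega> w t (v t)"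
proof -
  have "sq_int_H10 {\<alpha>..\<beta>} (slice u)" "sq_int_H10 {\<alpha>..\<beta>} (slice w)"
    using u w X_subset_Y Y_sq_int_H10 by blast+
  from weak_time_deriv_unique[OF weak_time_deriv_ddt[OF X_diff[OF u w]]
      weak_time_deriv_diff[OF this weak_time_deriv_ddt[OF u] weak_time_deriv_ddt[OF w]] v]
  show ?thesis .
qed

lemma Y_norm_nonneg: "0 \<le> Y_norm I \<Omega> v"
  by (simp add: Y_norm_def Y_inner_def grad_inner_nonneg)

text \<open>The Poincare inequality in space, integrated over time.\<close>

lemma Y_norm_H1:
  obtains C where "C > 0" "\<And>I v. I \<in> sets lebesgue \<Longrightarrow> v \<in> Y_space I \<Omega> \<Longrightarrow>
    (\<integral>t. (H1_norm \<Omega> (slice v t))\<^sup>2 \<partial>lebesgue_on I) \<le> C * (Y_norm I \<Omega> v)\<^sup>2"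
proof -
  obtain C where C: "C > 0" "\<And>u. u \<in> H10 \<Omega> \<Longrightarrow> (H1_norm \<Omega> u)\<^sup>2 \<le> C * grad_inner \<Omega> u u"
    using Poincare by blast
  show ?thesis
  proof (rule that[OF C(1)])
    fix I v assume I: "I \<in> sets lebesgue" and "v \<in> Y_space I \<Omega>"
    then have v: "sq_int_H10 I (slice v)" by (rule_tac Y_sq_int_H10)
    then have vH: "AE t in lebesgue_on I. slice v t \<in> H10 \<Omega>"
      and N: "integrable (lebesgue_on I) (\<lambda>t. (H1_norm \<Omega> (slice v t))\<^sup>2)"
      by (auto simp: bochner_sq_int_def)
    have "integrable (lebesgue_on I) (\<lambda>t. 1 * inner (slice v t) (slice v t))"
      by (rule L2_pairing[OF v v I, where K = 1]) auto
    then have "integrable (lebesgue_on I) (\<lambda>t. (H1_norm \<Omega> (slice v t))\<^sup>2 - inner (slice v t) (slice v t))"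
      using N by simp
    then have g: "integrable (lebesgue_on I) (\<lambda>t. grad_inner \<Omega> (slice v t) (slice v t))"
      by (simp add: H1_norm_sq power2_norm_eq_inner)
    have "(\<integral>t. (H1_norm \<Omega> (slice v t))\<^sup>2 \<partial>lebesgue_on I)
      \<le> (\<integral>t. C * grad_inner \<Omega> (slice v t) (slice v t) \<partial>lebesgue_on I)"
      using vH N g by (intro integral_mono_AE) (auto elim!: eventually_mono intro: C(2))
    also have "\<dots> = C * (Y_norm I \<Omega> v)\<^sup>2"
      by (simp add: Y_norm_def Y_inner_def grad_inner_nonneg)
    finally show "(\<integral>t. (H1_norm \<Omega> (slice v t))\<^sup>2 \<partial>lebesgue_on I) \<le> C * (Y_norm I \<Omega> v)\<^sup>2" .
  qed
qed

section \<open>The parabolic operator\<close>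

lemma parabolic_form_AE:
  assumes "parabolic_form T \<Omega> a"
  obtains M where "M \<ge> 0" "AE t in lebesgue_on {0..T}. \<forall>\<theta>\<in>H10 \<Omega>. \<forall>\<zeta>\<in>H10 \<Omega>.
        \<bar>a t \<theta> \<zeta>\<bar> \<le> M * H1_norm \<Omega> \<theta> * H1_norm \<Omega> \<zeta>"
proof -
  obtain M where M: "AE t in lebesgue_on {0..T}. \<forall>\<theta>\<in>H10 \<Omega>. \<forall>\<zeta>\<in>H10 \<Omega>.
        \<bar>a t \<theta> \<zeta>\<bar> \<le> M * H1_norm \<Omega> \<theta> * H1_norm \<Omega> \<zeta>"
    using assms by (auto simp: parabolic_form_def)
  have "M * H1_norm \<Omega> \<theta> * H1_norm \<Omega> \<zeta> \<le> \<bar>M\<bar> * H1_norm \<Omega> \<theta> * H1_norm \<Omega> \<zeta>" for \<theta> \<zeta>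
    by (intro mult_right_mono H1_norm_nonneg) simp
  then have "AE t in lebesgue_on {0..T}. \<forall>\<theta>\<in>H10 \<Omega>. \<forall>\<zeta>\<in>H10 \<Omega>.
        \<bar>a t \<theta> \<zeta>\<bar> \<le> \<bar>M\<bar> * H1_norm \<Omega> \<theta> * H1_norm \<Omega> \<zeta>"
    using M by (rule_tac eventually_mono[OF M]) (meson order_trans)
  then show ?thesis by (rule that[rotated]) simp
qed

lemma bilinear_on_diff:
  assumes b: "bilinear_on V b" and V: "subspace V" and uvw: "u \<in> V" "v \<in> V" "w \<in> V"
  shows "b (u - v) w = b u w - b v w" "b w (u - v) = b w u - b w v"
proof -
  have neg: "- 1 *\<^sub>R v \<in> V" using subspace_scale[OF V uvw(2)] .
  have "b (u + - 1 *\<^sub>R v) w = b u w + b (- 1 *\<^sub>R v) w \<and> b w (u + - 1 *\<^sub>R v) = b w u + b w (- 1 *\<^sub>R v)"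
    using b uvw neg unfolding bilinear_on_def by blast
  moreover have "b (- 1 *\<^sub>R v) w = - 1 * b v w" "b w (- 1 *\<^sub>R v) = - 1 * b w v"
    using b uvw unfolding bilinear_on_def by blast+
  ultimately show "b (u - v) w = b u w - b v w" "b w (u - v) = b w u - b w v"
    by simp_all
qed

lemma form_pairing:
  assumes a: "parabolic_form T \<Omega> a"
    and f: "sq_int_H10 {0..T} f" and g: "sq_int_H10 {0..T} g"
  shows "integrable (lebesgue_on {0..T}) (\<lambda>t. a t (f t) (g t))"
    and "M \<ge> 0 \<Longrightarrow> AE t in lebesgue_on {0..T}. \<forall>\<theta>\<in>H10 \<Omega>. \<forall>\<zeta>\<in>H10 \<Omega>.
        \<bar>a t \<theta> \<zeta>\<bar> \<le> M * H1_norm \<Omega> \<theta> * H1_norm \<Omega> \<zeta> \<Longrightarrow> s > 0 \<Longrightarrow>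
      \<bar>\<integral>t. a t (f t) (g t) \<partial>lebesgue_on {0..T}\<bar> \<le>
      M * (s * (\<integral>t. (H1_norm \<Omega> (f t))\<^sup>2 \<partial>lebesgue_on {0..T}) + (\<integral>t. (H1_norm \<Omega> (g t))\<^sup>2 \<partial>lebesgue_on {0..T}) / s)"
proof -
  have bil: "AE t in lebesgue_on {0..T}. bilinear_on (H10 \<Omega>) (a t)"
    and meas: "\<And>\<theta> \<zeta>. \<theta> \<in> H10 \<Omega> \<Longrightarrow> \<zeta> \<in> H10 \<Omega> \<Longrightarrow> (\<lambda>t. a t \<theta> \<zeta>) \<in> borel_measurable (lebesgue_on {0..T})"
    using a by (auto simp: parabolic_form_def)
  have l: "AE t in lebesgue_on {0..T}. \<forall>\<theta>\<in>H10 \<Omega>. \<forall>\<theta>'\<in>H10 \<Omega>. \<forall>\<zeta>\<in>H10 \<Omega>. a t (\<theta> - \<theta>') \<zeta> = a t \<theta> \<zeta> - a t \<theta>' \<zeta>"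
    and r: "AE t in lebesgue_on {0..T}. \<forall>\<theta>\<in>H10 \<Omega>. \<forall>\<zeta>\<in>H10 \<Omega>. \<forall>\<zeta>'\<in>H10 \<Omega>. a t \<theta> (\<zeta> - \<zeta>') = a t \<theta> \<zeta> - a t \<theta> \<zeta>'"
    using bil by (eventually_elim, simp add: bilinear_on_diff[OF _ subspace_H10])+
  note pairing = bochner_pairing[OF subtraction_seminorm_H10 subtraction_seminorm_H10 _ f g meas _ l r]
  obtain M0 where "M0 \<ge> 0" "AE t in lebesgue_on {0..T}. \<forall>\<theta>\<in>H10 \<Omega>. \<forall>\<zeta>\<in>H10 \<Omega>.
        \<bar>a t \<theta> \<zeta>\<bar> \<le> M0 * H1_norm \<Omega> \<theta> * H1_norm \<Omega> \<zeta>"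
    using parabolic_form_AE[OF a] by blast
  from pairing(1)[OF _ _ _ this(2,1)] show "integrable (lebesgue_on {0..T}) (\<lambda>t. a t (f t) (g t))" by simp
  assume "M \<ge> 0" "AE t in lebesgue_on {0..T}. \<forall>\<theta>\<in>H10 \<Omega>. \<forall>\<zeta>\<in>H10 \<Omega>.
        \<bar>a t \<theta> \<zeta>\<bar> \<le> M * H1_norm \<Omega> \<theta> * H1_norm \<Omega> \<zeta>" "s > 0"
  from pairing(2)[OF _ _ _ this(2,1,3)]
  show "\<bar>\<integral>t. a t (f t) (g t) \<partial>lebesgue_on {0..T}\<bar> \<le>
      M * (s * (\<integral>t. (H1_norm \<Omega> (f t))\<^sup>2 \<partial>lebesgue_on {0..T}) + (\<integral>t. (H1_norm \<Omega> (g t))\<^sup>2 \<partial>lebesgue_on {0..T}) / s)"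
    by simp
qed

lemma B_integrable:
  assumes a: "parabolic_form T \<Omega> a" and w: "w \<in> X T \<Omega>" and v: "v \<in> Y T \<Omega>"
  shows "integrable (lebesgue_on {0..T}) (\<lambda>t. ddt {0..T} \<Omega> w t (slice v t))"
    and "integrable (lebesgue_on {0..T}) (\<lambda>t. a t (slice w t) (slice v t))"
proof -
  have "sq_int_Hm1 {0..T} (ddt {0..T} \<Omega> w)"
    using weak_time_deriv_ddt[OF w] by (simp add: weak_time_deriv_def)
  from Hm1_pairing(1)[OF this Y_sq_int_H10[OF v], of "\<lambda>t. 1" 1]
  show "integrable (lebesgue_on {0..T}) (\<lambda>t. ddt {0..T} \<Omega> w t (slice v t))" by simp
  show "integrable (lebesgue_on {0..T}) (\<lambda>t. a t (slice w t) (slice v t))"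
    using w v X_subset_Y by (intro form_pairing(1)[OF a] Y_sq_int_H10) auto
qed

lemma B_eq:
  assumes "parabolic_form T \<Omega> a" "w \<in> X T \<Omega>" "v \<in> Y T \<Omega>"
  shows "B T \<Omega> a w v = (\<integral>t. ddt {0..T} \<Omega> w t (slice v t) \<partial>lebesgue_on {0..T})
      + (\<integral>t. a t (slice w t) (slice v t) \<partial>lebesgue_on {0..T})"
  unfolding B_def by (rule Bochner_Integration.integral_add[OF B_integrable[OF assms]])

lemma integral_lebesgue_on_cong_AE:
  fixes f g :: "real \<Rightarrow> real"
  assumes "integrable (lebesgue_on S) f" "S \<in> sets lebesgue" "AE t in lebesgue_on S. f t = g t"
  shows "integral\<^sup>L (lebesgue_on S) g = integral\<^sup>L (lebesgue_on S) f"
  using assms borel_measurable_lebesgue_on_AE[OF assms(2) borel_measurable_integrable[OF assms(1)] assms(3)]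
  by (intro integral_cong_AE) (auto elim: eventually_mono)

lemma B_lincomb:
  assumes a: "parabolic_form T \<Omega> a" and w: "w \<in> X T \<Omega>" and u: "u \<in> Y T \<Omega>" and v: "v \<in> Y T \<Omega>"
  shows "B T \<Omega> a w (c *\<^sub>R u + d *\<^sub>R v) = c * B T \<Omega> a w u + d * B T \<Omega> a w v"
proof -
  let ?M = "lebesgue_on {0..T}" and ?b = "\<lambda>t v. ddt {0..T} \<Omega> w t v + a t (slice w t) v"
  have int: "integrable ?M (\<lambda>t. ?b t (slice v t))" if "v \<in> Y T \<Omega>" for v
    using B_integrable[OF a w that] by simp
  have sl: "AE t in ?M. slice (c *\<^sub>R u + d *\<^sub>R v) t = c *\<^sub>R slice u t + d *\<^sub>R slice v t"
    by (rule AE_lebesgue_onI[OF slice_lincomb]) simp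
  have V: "AE t in ?M. slice u t \<in> H10 \<Omega>" "AE t in ?M. slice v t \<in> H10 \<Omega>" "AE t in ?M. slice w t \<in> H10 \<Omega>"
    using Y_sq_int_H10[OF u] Y_sq_int_H10[OF v] Y_sq_int_H10[OF subsetD[OF X_subset_Y w]]
    by (auto simp: bochner_sq_int_def)
  have l: "AE t in ?M. ddt {0..T} \<Omega> w t \<in> dual (H10 \<Omega>) (H1_norm \<Omega>)"
    using weak_time_deriv_ddt[OF w] by (simp add: weak_time_deriv_def bochner_sq_int_def Hm1_def)
  have "AE t in ?M. bilinear_on (H10 \<Omega>) (a t)" using a by (simp add: parabolic_form_def)
  with sl V l have "AE t in ?M. c * ?b t (slice u t) + d * ?b t (slice v t) = ?b t (slice (c *\<^sub>R u + d *\<^sub>R v) t)"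
  proof eventually_elim
    case (elim t)
    note sc = subspace_scale[OF subspace_H10 elim(2), of c] subspace_scale[OF subspace_H10 elim(3), of d]
    have "a t (slice w t) (c *\<^sub>R slice u t + d *\<^sub>R slice v t) =
      c * a t (slice w t) (slice u t) + d * a t (slice w t) (slice v t)"
      using elim(2,3,4,6) sc by (auto simp: bilinear_on_def)
    moreover have "ddt {0..T} \<Omega> w t (c *\<^sub>R slice u t + d *\<^sub>R slice v t) =
      c * ddt {0..T} \<Omega> w t (slice u t) + d * ddt {0..T} \<Omega> w t (slice v t)"
      using elim(2,3) sc by (simp add: dual_add_eq[OF elim(5)] dual_scaleR_eq[OF elim(5)])
    ultimately show ?case unfolding elim(1) by (simp add: algebra_simps)
  qed
  then have "B T \<Omega> a w (c *\<^sub>R u + d *\<^sub>R v) = (\<integral>t. c * ?b t (slice u t) + d * ?b t (slice v t) \<partial>?M)"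
    unfolding B_def using int[OF u] int[OF v] by (intro integral_lebesgue_on_cong_AE) auto
  also have "\<dots> = c * B T \<Omega> a w u + d * B T \<Omega> a w v"
    unfolding B_def using int[OF u] int[OF v]
    by (subst Bochner_Integration.integral_add) auto
  finally show ?thesis .
qed

lemma B_diff_left:
  assumes a: "parabolic_form T \<Omega> a" and u: "u \<in> X T \<Omega>" and w: "w \<in> X T \<Omega>" and v: "v \<in> Y T \<Omega>"
  shows "B T \<Omega> a (u - w) v = B T \<Omega> a u v - B T \<Omega> a w v"
proof -
  let ?M = "lebesgue_on {0..T}"
  let ?b = "\<lambda>w t. ddt {0..T} \<Omega> w t (slice v t) + a t (slice w t) (slice v t)"
  have int: "integrable ?M (?b w)" if "w \<in> X T \<Omega>" for w
    using B_integrable[OF a that v] by simp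
  have sl: "AE t in ?M. slice (u - w) t = slice u t - slice w t"
    by (rule AE_lebesgue_onI[OF slice_diff]) simp
  have V: "AE t in ?M. slice u t \<in> H10 \<Omega>" "AE t in ?M. slice v t \<in> H10 \<Omega>" "AE t in ?M. slice w t \<in> H10 \<Omega>"
    using Y_sq_int_H10[OF subsetD[OF X_subset_Y u]] Y_sq_int_H10[OF v] Y_sq_int_H10[OF subsetD[OF X_subset_Y w]]
    by (auto simp: bochner_sq_int_def)
  have "AE t in ?M. bilinear_on (H10 \<Omega>) (a t)" using a by (simp add: parabolic_form_def)
  with sl V ddt_diff[OF u w Y_sq_int_H10[OF v]] have "AE t in ?M. ?b u t - ?b w t = ?b (u - w) t"
    by eventually_elim (simp add: bilinear_on_diff[OF _ subspace_H10])
  then have "B T \<Omega> a (u - w) v = (\<integral>t. ?b u t - ?b w t \<partial>?M)"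
    unfolding B_def using int[OF u] int[OF w] by (intro integral_lebesgue_on_cong_AE) auto
  also have "\<dots> = B T \<Omega> a u v - B T \<Omega> a w v"
    unfolding B_def using int[OF u] int[OF w] by (rule Bochner_Integration.integral_diff)
  finally show ?thesis .
qed

text \<open>
  With \<open>s\<close> equal to the norm of \<open>v\<close> the bounds of the two pairings are linear in this norm.  As \<open>s\<close>
  must be positive, \<open>s\<close> is the norm plus \<open>e\<close>, and then \<open>e\<close> tends to \<open>0\<close>.
\<close>

lemma B_bounded:
  assumes a: "parabolic_form T \<Omega> a" and w: "w \<in> X T \<Omega>"
  shows "\<exists>K. \<forall>v\<in>Y T \<Omega>. \<bar>B T \<Omega> a w v\<bar> \<le> K * normY T \<Omega> v"
proof -
  obtain C where C: "C > 0" "\<And>v. v \<in> Y T \<Omega> \<Longrightarrow>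
      (\<integral>t. (H1_norm \<Omega> (slice v t))\<^sup>2 \<partial>lebesgue_on {0..T}) \<le> C * (normY T \<Omega> v)\<^sup>2"
    using Y_norm_H1 by (metis lborelD sets_completionI_sets borel_closed closed_real_atLeastAtMost)
  obtain M where M: "M \<ge> 0" "AE t in lebesgue_on {0..T}. \<forall>\<theta>\<in>H10 \<Omega>. \<forall>\<zeta>\<in>H10 \<Omega>.
        \<bar>a t \<theta> \<zeta>\<bar> \<le> M * H1_norm \<Omega> \<theta> * H1_norm \<Omega> \<zeta>"
    using parabolic_form_AE[OF a] by blast
  define A where "A = (\<integral>t. (Hm1_norm \<Omega> (ddt {0..T} \<Omega> w t))\<^sup>2 \<partial>lebesgue_on {0..T})
    + M * (\<integral>t. (H1_norm \<Omega> (slice w t))\<^sup>2 \<partial>lebesgue_on {0..T})"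
  have d: "sq_int_Hm1 {0..T} (ddt {0..T} \<Omega> w)"
    using weak_time_deriv_ddt[OF w] by (simp add: weak_time_deriv_def)
  have "\<bar>B T \<Omega> a w v\<bar> \<le> (A + (1 + M) * C) * normY T \<Omega> v" if v: "v \<in> Y T \<Omega>" for v
  proof -
    let ?N = "normY T \<Omega> v" and ?H = "\<integral>t. (H1_norm \<Omega> (slice v t))\<^sup>2 \<partial>lebesgue_on {0..T}"
    have N: "?N \<ge> 0" by (rule Y_norm_nonneg)
    have A: "A \<ge> 0" using M(1) by (simp add: A_def)
    have le: "\<bar>B T \<Omega> a w v\<bar> \<le> s * A + (1 + M) * (?H / s)" if "s > 0" for s
    proof -
      let ?A1 = "\<integral>t. (Hm1_norm \<Omega> (ddt {0..T} \<Omega> w t))\<^sup>2 \<partial>lebesgue_on {0..T}"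
        and ?A2 = "\<integral>t. (H1_norm \<Omega> (slice w t))\<^sup>2 \<partial>lebesgue_on {0..T}"
      have "\<bar>\<integral>t. ddt {0..T} \<Omega> w t (slice v t) \<partial>lebesgue_on {0..T}\<bar> \<le> s * ?A1 + ?H / s"
        using Hm1_pairing(2)[OF d Y_sq_int_H10[OF v], of "\<lambda>t. 1" 1 s] that by simp
      moreover have "\<bar>\<integral>t. a t (slice w t) (slice v t) \<partial>lebesgue_on {0..T}\<bar> \<le> M * (s * ?A2 + ?H / s)"
        by (rule form_pairing(2)[OF a Y_sq_int_H10[OF subsetD[OF X_subset_Y w]] Y_sq_int_H10[OF v] M that])
      moreover have "s * A + (1 + M) * (?H / s) = (s * ?A1 + ?H / s) + M * (s * ?A2 + ?H / s)"
        by (simp add: A_def distrib_left distrib_right mult.left_commute add_divide_distrib)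
      ultimately show ?thesis unfolding B_eq[OF a w v] by linarith
    qed
    have "\<bar>B T \<Omega> a w v\<bar> \<le> (?N + e) * (A + (1 + M) * C)" if "e > 0" for e
    proof -
      have "?H / (?N + e) \<le> C * (?N + e)"
      proof -
        have "?H \<le> C * ?N\<^sup>2" by (rule C(2)[OF v])
        also have "\<dots> \<le> C * (?N + e)\<^sup>2" using C(1) N that by (intro mult_left_mono power_mono) auto
        finally show ?thesis using N that by (simp add: power2_eq_square field_simps)
      qed
      then have "(1 + M) * (?H / (?N + e)) \<le> (1 + M) * (C * (?N + e))"
        using M(1) by (intro mult_left_mono) auto
      with le[of "?N + e"] N that show ?thesis by (simp add: algebra_simps)
    qed
    note bound = this
    let ?L = "A + (1 + M) * C"
    have L: "?L > 0" using A M(1) C(1) by (intro add_nonneg_pos[OF A] mult_pos_pos) simp_all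
    show ?thesis
    proof (rule field_le_epsilon)
      fix e :: real assume "e > 0"
      with L have "e / ?L > 0" by simp
      have "(?N + e / l) * l = l * ?N + e" if "l > 0" for l
        using that by (simp add: field_simps)
      from this[OF L] bound[OF \<open>e / ?L > 0\<close>] show "\<bar>B T \<Omega> a w v\<bar> \<le> ?L * ?N + e"
        by (simp only:)
    qed
  qed
  then show ?thesis by blast
qed

lemma B_in_dual:
  assumes a: "parabolic_form T \<Omega> a" and w: "w \<in> X T \<Omega>"
  shows "B T \<Omega> a w \<in> Y' T \<Omega>"
proof -
  have "B T \<Omega> a w (u + v) = B T \<Omega> a w u + B T \<Omega> a w v" if "u \<in> Y T \<Omega>" "v \<in> Y T \<Omega>" for u v
    using B_lincomb[OF a w that, of 1 1] by simp
  moreover have "B T \<Omega> a w (c *\<^sub>R v) = c * B T \<Omega> a w v" if "v \<in> Y T \<Omega>" for c v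
    using B_lincomb[OF a w that that, of c 0] by simp
  ultimately show ?thesis
    using B_bounded[OF a w] by (simp add: dual_def bounded_linear_on_def)
qed

lemma B_diff_right:
  assumes a: "parabolic_form T \<Omega> a" and w: "w \<in> X T \<Omega>" and u: "u \<in> Y T \<Omega>" and v: "v \<in> Y T \<Omega>"
  shows "B T \<Omega> a w (u - v) = B T \<Omega> a w u - B T \<Omega> a w v"
  using B_lincomb[OF a w u v, of 1 "-1"] by simp

end

section \<open>The error estimate\<close>

lemma dual_norm_diff_le:
  assumes V: "V \<noteq> {}" and N: "\<And>v. 0 \<le> N v" and l: "l \<in> dual V N" and m: "m \<in> dual V N"
    and eq: "\<And>v. v \<in> V \<Longrightarrow> k v = l v - m v"
  shows "dual_norm V N k \<le> dual_norm V N l + dual_norm V N m"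
proof (rule dual_norm_le[OF V _ N])
  show "0 \<le> dual_norm V N l + dual_norm V N m"
    using dual_norm_nonneg[OF V l N] dual_norm_nonneg[OF V m N] by simp
  show "\<bar>k v\<bar> \<le> (dual_norm V N l + dual_norm V N m) * N v" if "v \<in> V" for v
    using dual_norm_bound[OF l that N] dual_norm_bound[OF m that N] eq[OF that]
    by (simp add: distrib_right)
qed

lemma dual_comp:
  assumes Q: "bounded_linear_on V N N Q" and QV: "Q ` V \<subseteq> V" and l: "l \<in> dual V N" and N: "\<And>v. 0 \<le> N v"
  shows "l \<circ> Q \<in> dual V N"
proof -
  have "\<bar>l (Q v)\<bar> \<le> (dual_norm V N l * op_norm V N N Q) * N v" if "v \<in> V" for v
  proof -
    have "\<bar>l (Q v)\<bar> \<le> dual_norm V N l * N (Q v)"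
      using QV that by (intro dual_norm_bound l N) auto
    also have "\<dots> \<le> dual_norm V N l * (op_norm V N N Q * N v)"
      using that dual_norm_nonneg[OF _ l N] op_norm_bound[OF Q that N]
      by (intro mult_left_mono) auto
    finally show ?thesis by (simp add: mult.assoc)
  qed
  then have "\<exists>K. \<forall>v\<in>V. \<bar>l (Q v)\<bar> \<le> K * N v" by blast
  then show ?thesis
    using Q QV l unfolding dual_def bounded_linear_on_def by (auto simp: image_subset_iff)
qed

text \<open>
  The residual \<open>l - g\<close> at \<open>v\<close> is its value at \<open>Q v \<in> W\<close>, up to the oscillation \<open>g - g \<circ> Q\<close>.
\<close>

lemma dual_norm_le_osc:
  assumes Q: "bounded_linear_on V N N Q" and QW: "Q ` V \<subseteq> W" and WV: "W \<subseteq> V" "V \<noteq> {}"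
    and N: "\<And>v. 0 \<le> N v" and L: "op_norm V N N Q \<le> L"
    and l: "l \<in> dual V N" and g: "g \<in> dual V N" and inv: "\<And>v. v \<in> V \<Longrightarrow> l (Q v) = l v"
  shows "dual_norm V N (\<lambda>v. l v - g v)
    \<le> L * dual_norm W N (\<lambda>v. l v - g v) + dual_norm V N (\<lambda>v. g v - (g \<circ> Q) v)"
proof -
  let ?r = "\<lambda>v. l v - g v" and ?o = "\<lambda>v. g v - (g \<circ> Q) v"
  have W: "W \<noteq> {}" using QW WV by auto
  have r: "?r \<in> dual W N" using dual_antimono[OF WV(1) dual_diff[OF l g]] .
  have o: "?o \<in> dual V N" using QW WV by (intro dual_diff dual_comp Q g N) auto
  have nn: "0 \<le> dual_norm W N ?r" "0 \<le> dual_norm V N ?o" "0 \<le> op_norm V N N Q"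
    by (intro dual_norm_nonneg op_norm_nonneg W r WV(2) o N Q)+
  show ?thesis
  proof (rule dual_norm_le[OF WV(2) _ N])
    show "0 \<le> L * dual_norm W N ?r + dual_norm V N ?o" using nn L by simp
    fix v assume v: "v \<in> V"
    have "N (Q v) \<le> L * N v"
      using op_norm_bound[OF Q v N] mult_right_mono[OF L N[of v]] by linarith
    then have "dual_norm W N ?r * N (Q v) \<le> dual_norm W N ?r * (L * N v)"
      using nn(1) by (intro mult_left_mono)
    moreover have "\<bar>?r (Q v)\<bar> \<le> dual_norm W N ?r * N (Q v)"
      using QW v by (intro dual_norm_bound r N) auto
    moreover have "\<bar>?o v\<bar> \<le> dual_norm V N ?o * N v" by (rule dual_norm_bound[OF o v N])
    moreover have "?r v = ?r (Q v) - ?o v" using inv[OF v] by simp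
    ultimately show "\<bar>?r v\<bar> \<le> (L * dual_norm W N ?r + dual_norm V N ?o) * N v"
      unfolding distrib_right by (simp add: mult_ac)
  qed
qed

theorem corollary3p13:
  fixes \<Omega> \<omega> :: "'a::euclidean_space set"
    and T \<eta> :: real
    and a :: "real \<Rightarrow> 'a lsq \<Rightarrow> 'a lsq \<Rightarrow> real"
    and \<Delta> :: "'i set"
    and X\<delta> Y\<delta> :: "'i \<Rightarrow> (real \<times> 'a) lsq set"
    and Q :: "'i \<Rightarrow> (real \<times> 'a) lsq \<Rightarrow> (real \<times> 'a) lsq"
  assumes "open \<Omega>" and "connected \<Omega>" and "\<Omega> \<noteq> {}" and "bounded \<Omega>"
    and "open \<omega>" and "connected \<omega>" and "\<omega> \<noteq> {}" and "\<omega> \<subseteq> \<Omega>"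
    and "T > 0"
    and "parabolic_form T \<Omega> a"
    and "carleman T \<Omega> \<omega> a"
    and "\<And>\<delta>. \<delta> \<in> \<Delta> \<Longrightarrow> fin_dim_subspace (X\<delta> \<delta>) (X T \<Omega>)"
    and "\<And>\<delta>. \<delta> \<in> \<Delta> \<Longrightarrow> fin_dim_subspace (Y\<delta> \<delta>) (Y T \<Omega>)"
    and "infsup T \<Omega> a \<Delta> X\<delta> Y\<delta> > 0"
    and "fortin_family T \<Omega> a \<Delta> X\<delta> Y\<delta> Q"
    and "\<eta> \<in> {0<..<T}"
  shows "\<exists>C>0. \<forall>\<epsilon>\<ge>0. \<forall>g\<in>Y' T \<Omega>. \<forall>f\<in>L2 ({0..T} \<times> \<omega>). \<forall>\<delta>\<in>\<Delta>. \<forall>w\<in>X\<delta> \<delta>. \<forall>u.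
           is_arg_min (G T \<Omega> \<omega> a (Y T \<Omega>) \<epsilon> g f) (\<lambda>v. v \<in> X T \<Omega>) u \<longrightarrow>
           X_eta_norm \<eta> T \<Omega> (u - w)
             \<le> C * (sqrt (G T \<Omega> \<omega> a (Y\<delta> \<delta>) \<epsilon> g f w) + e_osc T \<Omega> (Q \<delta>) g)"
proof -
  interpret bounded_open \<Omega> by standard fact+
  note a = \<open>parabolic_form T \<Omega> a\<close>
  let ?N = "normY T \<Omega>"
  have N: "\<And>v. 0 \<le> ?N v" by (rule Y_norm_nonneg)
  obtain C0 where C0: "\<And>w. w \<in> X T \<Omega> \<Longrightarrow>
      X_eta_norm \<eta> T \<Omega> w \<le> C0 * (norm (\<Gamma> T \<omega> w) + normY' T \<Omega> (B T \<Omega> a w))"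
    using \<open>carleman T \<Omega> \<omega> a\<close> \<open>\<eta> \<in> {0<..<T}\<close> unfolding carleman_def by blast
  obtain L0 where L0: "\<And>\<delta>. \<delta> \<in> \<Delta> \<Longrightarrow> op_norm (Y T \<Omega>) ?N ?N (Q \<delta>) \<le> L0"
  proof -
    have "bdd_above ((\<lambda>\<delta>. op_norm (Y T \<Omega>) ?N ?N (Q \<delta>)) ` \<Delta>)"
      using assms(15) unfolding fortin_family_def by simp
    then show ?thesis using that unfolding bdd_above_def by blast
  qed
  \<comment> \<open>\<open>C0\<close> may be negative, and \<open>L0\<close> is arbitrary if \<open>\<Delta>\<close> is empty\<close>
  define C1 where "C1 = max C0 1"
  define L where "L = max L0 1"
  have pos: "C1 \<ge> 1" "L \<ge> 1" by (auto simp: C1_def L_def)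
  show ?thesis
  proof (rule exI[of _ "4 * C1 * (L + 2)"], intro conjI allI ballI impI)
    show "0 < 4 * C1 * (L + 2)" using pos by simp
    fix \<epsilon> :: real and g f \<delta> w u
    assume g: "g \<in> Y' T \<Omega>" and \<delta>: "\<delta> \<in> \<Delta>" and wd: "w \<in> X\<delta> \<delta>"
      and min: "is_arg_min (G T \<Omega> \<omega> a (Y T \<Omega>) \<epsilon> g f) (\<lambda>v. v \<in> X T \<Omega>) u"
    have w: "w \<in> X T \<Omega>" using assms(12)[OF \<delta>] wd by (auto simp: fin_dim_subspace_def)
    have u: "u \<in> X T \<Omega>" using min by (simp add: is_arg_min_def)
    have Yd: "Y\<delta> \<delta> \<subseteq> Y T \<Omega>" using assms(13)[OF \<delta>] by (simp add: fin_dim_subspace_def)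
    have Y0: "Y T \<Omega> \<noteq> {}" using w X_subset_Y by blast
    have Q: "bounded_linear_on (Y T \<Omega>) ?N ?N (Q \<delta>)" "Q \<delta> ` Y T \<Omega> \<subseteq> Y\<delta> \<delta>"
      "\<And>v. v \<in> Y T \<Omega> \<Longrightarrow> B T \<Omega> a w (v - Q \<delta> v) = 0"
      using assms(15)[unfolded fortin_family_def, THEN conjunct1, THEN bspec, OF \<delta>] wd by simp_all
    note Bw = B_in_dual[OF a w] and Bu = B_in_dual[OF a u]
    define R where "R V v = dual_norm V ?N (\<lambda>\<mu>. B T \<Omega> a v \<mu> - g \<mu>)" for V v
    define \<rho> where "\<rho> v = norm (\<Gamma> T \<omega> v - f)" for v
    define z where "z v = \<epsilon>\<^sup>2 * (norm (\<gamma>\<^sub>0 T v))\<^sup>2" for v :: "(real \<times> 'a) lsq"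
    have G: "G T \<Omega> \<omega> a V \<epsilon> g f v = (R V v)\<^sup>2 + (\<rho> v)\<^sup>2 + z v" for V v
      by (simp add: G_def R_def \<rho>_def z_def)
    have z: "0 \<le> z v" for v by (simp add: z_def)
    define S where "S = sqrt (G T \<Omega> \<omega> a (Y\<delta> \<delta>) \<epsilon> g f w)"
    define e where "e = e_osc T \<Omega> (Q \<delta>) g"
    have S: "R (Y\<delta> \<delta>) w \<le> S" "\<rho> w \<le> S" "sqrt (z w) \<le> S"
      unfolding S_def G using z[of w] by (auto intro!: real_le_rsqrt)
    have S0: "0 \<le> S" unfolding S_def G using z[of w] by simp
    have "B T \<Omega> a w (Q \<delta> v) = B T \<Omega> a w v" if "v \<in> Y T \<Omega>" for v
    proof -
      have "Q \<delta> v \<in> Y T \<Omega>" using Q(2) Yd that by blast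
      then show ?thesis using Q(3)[OF that] B_diff_right[OF a w that] by simp
    qed
    then have "R (Y T \<Omega>) w \<le> L * R (Y\<delta> \<delta>) w + e"
      unfolding R_def e_def e_osc_def
      by (intro dual_norm_le_osc Q(1,2) Yd Y0 N Bw g) (auto simp: L_def L0[OF \<delta>] le_max_iff_disj)
    also have "\<dots> \<le> L * S + e" using S(1) pos by (simp add: mult_left_mono)
    finally have Rw: "R (Y T \<Omega>) w \<le> L * S + e" .
    have dw: "(\<lambda>\<mu>. B T \<Omega> a w \<mu> - g \<mu>) \<in> Y' T \<Omega>" and du: "(\<lambda>\<mu>. B T \<Omega> a u \<mu> - g \<mu>) \<in> Y' T \<Omega>"
      by (intro dual_diff Bw Bu g)+
    have Rw0: "0 \<le> R (Y T \<Omega>) w" unfolding R_def by (rule dual_norm_nonneg[OF Y0 dw N])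
    have e0: "0 \<le> e" unfolding e_def e_osc_def
      using Q Yd by (intro dual_norm_nonneg Y0 dual_diff dual_comp g N) auto
    \<comment> \<open>subadditivity of the square root, for the three terms of the functional\<close>
    have Gw: "sqrt (G T \<Omega> \<omega> a (Y T \<Omega>) \<epsilon> g f w) \<le> R (Y T \<Omega>) w + \<rho> w + sqrt (z w)"
    proof (rule real_le_lsqrt)
      have "0 \<le> \<rho> w" by (simp add: \<rho>_def)
      then show "0 \<le> R (Y T \<Omega>) w + \<rho> w + sqrt (z w)" using Rw0 z by simp
      show "G T \<Omega> \<omega> a (Y T \<Omega>) \<epsilon> g f w \<le> (R (Y T \<Omega>) w + \<rho> w + sqrt (z w))\<^sup>2"
        using Rw0 \<open>0 \<le> \<rho> w\<close> z[of w] unfolding G by (simp add: power2_sum)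
    qed
    have "G T \<Omega> \<omega> a (Y T \<Omega>) \<epsilon> g f u \<le> G T \<Omega> \<omega> a (Y T \<Omega>) \<epsilon> g f w"
      using min w by (auto simp: is_arg_min_linorder)
    then have Gu: "sqrt (G T \<Omega> \<omega> a (Y T \<Omega>) \<epsilon> g f u) \<le> R (Y T \<Omega>) w + \<rho> w + sqrt (z w)"
      using Gw by (meson order_trans real_sqrt_le_mono)
    have u_le: "R (Y T \<Omega>) u \<le> sqrt (G T \<Omega> \<omega> a (Y T \<Omega>) \<epsilon> g f u)"
      "\<rho> u \<le> sqrt (G T \<Omega> \<omega> a (Y T \<Omega>) \<epsilon> g f u)"
      unfolding G using z[of u] by (auto intro!: real_le_rsqrt)
    have 1: "normY' T \<Omega> (B T \<Omega> a (u - w)) \<le> R (Y T \<Omega>) u + R (Y T \<Omega>) w"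
      unfolding R_def by (rule dual_norm_diff_le[OF Y0 N du dw]) (simp add: B_diff_left[OF a u w])
    have 2: "norm (\<Gamma> T \<omega> (u - w)) \<le> \<rho> u + \<rho> w"
      using norm_triangle_ineq4[of "\<Gamma> T \<omega> u - f" "\<Gamma> T \<omega> w - f"]
      by (simp add: \<Gamma>_def \<rho>_def restr_diff)
    have sum: "norm (\<Gamma> T \<omega> (u - w)) + normY' T \<Omega> (B T \<Omega> a (u - w)) \<le> 4 * (L + 2) * (S + e)"
    proof -
      \<comment> \<open>each of the two terms of \<open>u\<close> is at most the sum of the three terms of \<open>w\<close>\<close>
      have "norm (\<Gamma> T \<omega> (u - w)) + normY' T \<Omega> (B T \<Omega> a (u - w)) \<le> 3 * (L * S + e) + 5 * S"
      proof -
        have "norm (\<Gamma> T \<omega> (u - w)) + normY' T \<Omega> (B T \<Omega> a (u - w)) \<le> (\<rho> u + \<rho> w) + (R (Y T \<Omega>) u + R (Y T \<Omega>) w)"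
          by (rule add_mono[OF 2 1])
        moreover have "R (Y T \<Omega>) u \<le> (L * S + e) + S + S" "\<rho> u \<le> (L * S + e) + S + S"
          using order_trans[OF u_le(1) Gu] order_trans[OF u_le(2) Gu] Rw S(2,3) by linarith+
        ultimately show ?thesis using Rw S(2) by (simp add: algebra_simps)
      qed
      also have "\<dots> \<le> 4 * (L + 2) * (S + e)"
        using pos S0 e0 mult_nonneg_nonneg[of L S] mult_nonneg_nonneg[of L e] by (simp add: algebra_simps)
      finally show ?thesis .
    qed
    have nn: "0 \<le> norm (\<Gamma> T \<omega> (u - w)) + normY' T \<Omega> (B T \<Omega> a (u - w))"
      using dual_norm_nonneg[OF Y0 B_in_dual[OF a X_diff[OF u w]] N] by simp
    have "X_eta_norm \<eta> T \<Omega> (u - w) \<le> C0 * (norm (\<Gamma> T \<omega> (u - w)) + normY' T \<Omega> (B T \<Omega> a (u - w)))"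
      by (rule C0[OF X_diff[OF u w]])
    also have "\<dots> \<le> C1 * (norm (\<Gamma> T \<omega> (u - w)) + normY' T \<Omega> (B T \<Omega> a (u - w)))"
      by (rule mult_right_mono[OF _ nn]) (simp add: C1_def)
    also have "\<dots> \<le> C1 * (4 * (L + 2) * (S + e))"
      using sum pos by (intro mult_left_mono) auto
    finally show "X_eta_norm \<eta> T \<Omega> (u - w)
        \<le> 4 * C1 * (L + 2) * (sqrt (G T \<Omega> \<omega> a (Y\<delta> \<delta>) \<epsilon> g f w) + e_osc T \<Omega> (Q \<delta>) g)"
      by (simp add: S_def e_def mult_ac)
  qed
qed

end
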